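(* Let $n\ge 6$ be an integer and let $l=\frac n2-1$. Suppose $(u_0,u_1)\in (H^{l+1}(\mathbf{R}^n)\cap L^{1,1}(\mathbf{R}^n))\times(H^{l}(\mathbf{R}^n)\cap L^{1,1}(\mathbf{R}^n))$, and let $u\in X_2$ be the solution of the Cauchy problem $$u_{tt}-\Delta u_{tt}+\Delta^2u-\Delta u+u_t=0 \ \text{ in } (0,\infty)\times\mathbf{R}^n,\qquad u(0,x)=u_0(x),\quad u_t(0,x)=u_1(x).$$ Then, for all $t\ge 1$, $$\left\|\hat u(t,\xi)-\left\{(P_1+P_0)\,e^{-t|\xi|^2}+\hat u_1(\xi)\, e^{-\frac{t}{2|\xi|^2}}\frac{\sin(t|\xi|)}{|\xi|}+\hat u_0(\xi)\, e^{-\frac{t}{2|\xi|^2}}\cos(t|\xi|)\right\}\right\|_2\le C I_0\, t^{-\frac{n+2}{4}},$$ where $C>0$ is a constant independent of $t$ and of $u_0,u_1$.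
   Context: The Fourier transform (in $x$) is $\hat f(\xi)=\int_{\mathbf{R}^n}f(x)e^{-i\xi\cdot x}\,dx$. $\|\cdot\|_p$ is the $L^p(\mathbf{R}^n)$ norm; for functions of $(t,\xi)$, $\|\cdot\|_2$ is the $L^2$ norm in $\xi\in\mathbf{R}^n$. For real $l\ge 0$, $\|f\|_{H^l}=\left(\int_{\mathbf{R}^n}(1+|\xi|^2)^l|\hat f(\xi)|^2d\xi\right)^{1/2}$. $L^{1,1}(\mathbf{R}^n)$ is the set of $f\in L^1(\mathbf{R}^n)$ with $\|f\|_{1,1}:=\int_{\mathbf{R}^n}(1+|x|)|f(x)|dx<\infty$. The solution class is $X_2:=C^2([0,\infty);H^1(\mathbf{R}^n))\cap C^1([0,\infty);H^2(\mathbf{R}^n))\cap C([0,\infty);H^3(\mathbf{R}^n))$. It is known that for $(u_0,u_1)\in H^3(\mathbf{R}^n)\times H^2(\mathbf{R}^n)$ the Cauchy problem has a unique solution in $X_2$. Put $P_j:=\int_{\mathbf{R}^n}u_j(x)\,dx$ for $j=0,1$, and $I_0:=\|u_1\|_{H^l}+\|u_0\|_{H^{l+1}}+\|u_1\|_{1,1}+\|u_0\|_{1,1}$. *)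

theory Defs
  imports "HOL-Analysis.Analysis"
begin

text \<open>
  Functions on \<open>\<real>\<^sup>n\<close> are complex valued (real-valued data are a special case), and elements of
  Lebesgue spaces are given by Borel representatives.
\<close>

definition L1 :: "('a::euclidean_space \<Rightarrow> complex) set" where
  "L1 = {f. integrable lborel f}"

definition L2 :: "('a::euclidean_space \<Rightarrow> complex) set" where
  "L2 = {f \<in> borel_measurable borel. integrable lborel (\<lambda>x. (cmod (f x))\<^sup>2)}"

definition L2_norm :: "('a::euclidean_space \<Rightarrow> complex) \<Rightarrow> real" where
  "L2_norm f = sqrt (LINT x|lborel. (cmod (f x))\<^sup>2)"

definition L11 :: "('a::euclidean_space \<Rightarrow> complex) set" where
  "L11 = {f \<in> L1. integrable lborel (\<lambda>x. (1 + norm x) * cmod (f x))}"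

definition L11_norm :: "('a::euclidean_space \<Rightarrow> complex) \<Rightarrow> real" where
  "L11_norm f = (LINT x|lborel. (1 + norm x) * cmod (f x))"

definition fourier :: "('a::euclidean_space \<Rightarrow> complex) \<Rightarrow> 'a \<Rightarrow> complex" where
  "fourier f \<xi> = (LINT x|lborel. f x * exp (- \<i> * complex_of_real (\<xi> \<bullet> x)))"

text \<open>
  The integral above is meaningful on \<open>L1\<close> only. On \<open>L2\<close> the transform is its Plancherel extension:
  the \<open>L2\<close> limit of the transforms of the truncations of \<open>f\<close> to balls of radius \<open>R\<close>. It is
  determined almost everywhere, and for \<open>f \<in> L1 \<inter> L2\<close> it agrees almost everywhere with \<open>fourier f\<close>.
  The limit is written with the nonnegative integral, which, unlike the Bochner integral, is not 0 by
  convention when the integrand is not integrable.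
\<close>

definition fourier_L2 :: "('a::euclidean_space \<Rightarrow> complex) \<Rightarrow> 'a \<Rightarrow> complex" where
  "fourier_L2 f = (SOME g. g \<in> L2 \<and>
     (\<lambda>R::nat. \<integral>\<^sup>+ \<xi>. ennreal ((cmod (fourier (\<lambda>x. indicat_real (cball 0 (real R)) x *\<^sub>R f x) \<xi> - g \<xi>))\<^sup>2) \<partial>lborel)
       \<longlonglongrightarrow> 0)"

definition Sobolev :: "real \<Rightarrow> ('a::euclidean_space \<Rightarrow> complex) set" where
  "Sobolev s = {f \<in> L2. integrable lborel (\<lambda>\<xi>. (1 + (norm \<xi>)\<^sup>2) powr s * (cmod (fourier_L2 f \<xi>))\<^sup>2)}"

definition Sobolev_norm :: "real \<Rightarrow> ('a::euclidean_space \<Rightarrow> complex) \<Rightarrow> real" where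
  "Sobolev_norm s f = sqrt (LINT \<xi>|lborel. (1 + (norm \<xi>)\<^sup>2) powr s * (cmod (fourier_L2 f \<xi>))\<^sup>2)"

text \<open>
  \<open>v\<close> is the derivative of the curve \<open>u : [0,\<infinity>) \<rightarrow> H\<^sup>s\<close> in the norm of \<open>H\<^sup>s\<close> (one-sided at 0).
  It is unique up to null sets at each time.
\<close>

definition Sobolev_deriv ::
  "real \<Rightarrow> (real \<Rightarrow> 'a::euclidean_space \<Rightarrow> complex) \<Rightarrow> (real \<Rightarrow> 'a \<Rightarrow> complex) \<Rightarrow> bool" where
  "Sobolev_deriv s u v \<longleftrightarrow> (\<forall>t\<ge>0. u t \<in> Sobolev s \<and> v t \<in> Sobolev s \<and>
     ((\<lambda>r. Sobolev_norm s (\<lambda>x. (u r x - u t x) /\<^sub>R (r - t) - v t x)) \<longlongrightarrow> 0) (at t within {0..}))"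

text \<open>\<open>C_Sobolev k s\<close> is the space \<open>C\<^sup>k([0,\<infinity>); H\<^sup>s)\<close>.\<close>

primrec C_Sobolev :: "nat \<Rightarrow> real \<Rightarrow> (real \<Rightarrow> 'a::euclidean_space \<Rightarrow> complex) set" where
  "C_Sobolev 0 s = {u. \<forall>t\<ge>0. u t \<in> Sobolev s \<and>
     ((\<lambda>r. Sobolev_norm s (\<lambda>x. u r x - u t x)) \<longlongrightarrow> 0) (at t within {0..})}"
| "C_Sobolev (Suc k) s = {u. \<exists>v \<in> C_Sobolev k s. Sobolev_deriv s u v}"

definition X2 :: "(real \<Rightarrow> 'a::euclidean_space \<Rightarrow> complex) set" where
  "X2 = C_Sobolev 2 1 \<inter> C_Sobolev 1 2 \<inter> C_Sobolev 0 3"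

definition partial :: "'a::euclidean_space \<Rightarrow> ('a \<Rightarrow> complex) \<Rightarrow> 'a \<Rightarrow> complex" where
  "partial b f x = frechet_derivative f (at x) b"

primrec C_fun :: "nat \<Rightarrow> ('a::euclidean_space \<Rightarrow> complex) \<Rightarrow> bool" where
  "C_fun 0 f \<longleftrightarrow> continuous_on UNIV f"
| "C_fun (Suc k) f \<longleftrightarrow> (\<forall>x. f differentiable (at x)) \<and> (\<forall>b\<in>Basis. C_fun k (partial b f))"

definition test_functions :: "('a::euclidean_space \<Rightarrow> complex) set" where
  "test_functions = {\<phi>. (\<forall>k. C_fun k \<phi>) \<and> compact (closure {x. \<phi> x \<noteq> 0})}"

definition laplacian :: "('a::euclidean_space \<Rightarrow> complex) \<Rightarrow> 'a \<Rightarrow> complex" where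
  "laplacian \<phi> x = (\<Sum>b\<in>Basis. partial b (partial b \<phi>) x)"

text \<open>
  Since \<open>u(t) \<in> H\<^sup>3\<close> and \<open>u\<^sub>t\<^sub>t(t) \<in> H\<^sup>1\<close>, the terms \<open>\<Delta>\<^sup>2u\<close> and \<open>\<Delta>u\<^sub>t\<^sub>t\<close> are in general only in
  \<open>H\<^sup>-\<^sup>1\<close>; the equation is read in the sense of distributions in \<open>x\<close>, at every time
  \<open>t > 0\<close>.
\<close>

definition dist_of :: "('a::euclidean_space \<Rightarrow> complex) \<Rightarrow> ('a \<Rightarrow> complex) \<Rightarrow> complex" where
  "dist_of f \<phi> = (LINT x|lborel. f x * \<phi> x)"

definition dist_laplacian ::
  "(('a::euclidean_space \<Rightarrow> complex) \<Rightarrow> complex) \<Rightarrow> ('a \<Rightarrow> complex) \<Rightarrow> complex" where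
  "dist_laplacian T \<phi> = T (laplacian \<phi>)"

definition solves_Cauchy_problem ::
  "('a::euclidean_space \<Rightarrow> complex) \<Rightarrow> ('a \<Rightarrow> complex) \<Rightarrow> (real \<Rightarrow> 'a \<Rightarrow> complex) \<Rightarrow> bool" where
  "solves_Cauchy_problem u0 u1 u \<longleftrightarrow>
     (\<exists>ut utt. Sobolev_deriv 1 u ut \<and> Sobolev_deriv 1 ut utt \<and>
        (\<forall>t>0. \<forall>\<phi>\<in>test_functions.
           dist_of (utt t) \<phi> - dist_laplacian (dist_of (utt t)) \<phi>
           + dist_laplacian (dist_laplacian (dist_of (u t))) \<phi>
           - dist_laplacian (dist_of (u t)) \<phi> + dist_of (ut t) \<phi> = 0) \<and>
        (AE x in lborel. u 0 x = u0 x) \<and> (AE x in lborel. ut 0 x = u1 x))"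

definition mean :: "('a::euclidean_space \<Rightarrow> complex) \<Rightarrow> complex" where
  "mean f = (LINT x|lborel. f x)"

definition I0 :: "real \<Rightarrow> ('a::euclidean_space \<Rightarrow> complex) \<Rightarrow> ('a \<Rightarrow> complex) \<Rightarrow> real" where
  "I0 l u0 u1 = Sobolev_norm l u1 + Sobolev_norm (l + 1) u0 + L11_norm u1 + L11_norm u0"

text \<open>
  The data are integrable, so their transforms are given by the integral. At \<open>\<xi> = 0\<close> the quotients
  take the value 0 by convention, which is irrelevant in \<open>L2\<close>.
\<close>

definition profile ::
  "('a::euclidean_space \<Rightarrow> complex) \<Rightarrow> ('a \<Rightarrow> complex) \<Rightarrow> real \<Rightarrow> 'a \<Rightarrow> complex" where
  "profile u0 u1 t \<xi> =
     (mean u1 + mean u0) * complex_of_real (exp (- t * (norm \<xi>)\<^sup>2))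
     + fourier u1 \<xi> * complex_of_real (exp (- t / (2 * (norm \<xi>)\<^sup>2)) * (sin (t * norm \<xi>) / norm \<xi>))
     + fourier u0 \<xi> * complex_of_real (exp (- t / (2 * (norm \<xi>)\<^sup>2)) * cos (t * norm \<xi>))"

end

theory Submission
  imports Defs "HOL-Probability.Characteristic_Functions"
begin

text \<open>
  Divided by \<open>1 + |\<xi>|\<^sup>2\<close>, the equation turns on the Fourier side, for each frequency \<open>\<xi>\<close> separately,
  into the damped oscillator \<open>y'' + a y' + \<rho>\<^sup>2 y = 0\<close> with \<open>\<rho> = |\<xi>|\<close> and \<open>a = 1 / (1 + \<rho>\<^sup>2)\<close>. Hence
  the transform of the solution is \<open>prop0 t \<rho>\<close> times that of \<open>u0\<close> plus \<open>prop1 t \<rho>\<close> times that of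
  \<open>u1\<close>, with two explicit real propagators (\<open>Cauchy_problem_fourier\<close>), and the theorem becomes a
  comparison of these with the profile.

  Near \<open>\<rho> = 0\<close> the slow characteristic root is \<open>-\<rho>\<^sup>2 + O(\<rho>\<^sup>4)\<close> and the fast mode decays exponentially in
  time, and for \<open>\<rho>\<close> between a small constant and 1 everything does. So for \<open>\<rho> \<le> 1\<close> both propagators equal
  \<open>exp (-t\<rho>\<^sup>2)\<close> up to \<open>\<rho> exp (-t\<rho>\<^sup>2/2)\<close> and an exponentially small term
  (\<open>bounded_frequency\<close>). Replacing the transforms of the data by their values \<open>P\<^sub>0\<close>, \<open>P\<^sub>1\<close> at the origin
  leaves an error with a factor \<open>\<rho>\<close>, by the weight in \<open>L11\<close>. The \<open>L2\<close> norm of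
  \<open>\<rho> exp (-t\<rho>\<^sup>2/2)\<close> is of the order \<open>t\<close> to the power \<open>-(n+2)/4\<close> by scaling (\<open>heat_weight_L2\<close>).

  For \<open>\<rho> \<ge> 1\<close> the oscillator is underdamped. Its damping rate \<open>a/2\<close> and its angular frequency differ from
  \<open>1/(2\<rho>\<^sup>2)\<close> and \<open>\<rho>\<close> by \<open>O(\<rho>\<^sup>-\<^sup>4)\<close>, and over the relevant times \<open>t \<approx> \<rho>\<^sup>2\<close> this makes the relative error
  \<open>O(1/\<rho>)\<close> times \<open>exp (-t/(8\<rho>\<^sup>2))\<close> (\<open>high_frequency\<close>). The exponential decays in time only as long as
  \<open>\<rho>\<close> stays bounded; decay is bought with the regularity of the data: a negative power of \<open>\<rho>\<close> times the
  exponential is at most a negative power of \<open>t\<close> (\<open>regularity_loss\<close>), and the indices \<open>l + 1\<close> and \<open>l\<close> are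
  exactly what turns \<open>1/\<rho>\<close> and \<open>1/\<rho>\<^sup>2\<close> into \<open>t\<close> to the power \<open>-(n+2)/4\<close>.

  The representation by propagators has to be extracted from a distributional notion of solution.
  Damping with Gaussians yields Bessel's inequality, Parseval's identity against test functions and the
  injectivity of the transform on \<open>L1\<close>. Testing the equation with all translates of a dilated bump
  function then gives the oscillator equation for almost every frequency at each time
  (\<open>distributional_equation_fourier\<close>). As the solution is a differentiable curve in \<open>L2\<close> only, the
  oscillator is solved in weak form: for a fixed time \<open>T\<close> the combination
  \<open>prop1 (T - s) U'(s) + prop0 (T - s) U(s)\<close>, paired with a function of \<open>\<xi>\<close>, does not depend on \<open>s\<close>
  (\<open>oscillator_solution\<close>).
\<close>

section \<open>Square integrable functions\<close>

text \<open>
  The squared norm as a nonnegative integral: unlike \<open>L2_norm\<close> it is meaningful before square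
  integrability is known, so completeness and Fatou arguments are carried out with it.
\<close>
definition sqint :: "('a::euclidean_space \<Rightarrow> complex) \<Rightarrow> ennreal" where
  "sqint f = (\<integral>\<^sup>+ x. ennreal ((cmod (f x))\<^sup>2) \<partial>lborel)"

lemma L2_iff_sqint: "f \<in> L2 \<longleftrightarrow> f \<in> borel_measurable borel \<and> sqint f < \<infinity>"
proof -
  have "integrable lborel (\<lambda>x. (cmod (f x))\<^sup>2) \<longleftrightarrow> sqint f < \<infinity>" if "f \<in> borel_measurable borel"
    using that unfolding sqint_def by (subst integrable_iff_bounded) auto
  then show ?thesis by (auto simp: L2_def)
qed

lemma L2_measurable[measurable_dest]: "f \<in> L2 \<Longrightarrow> f \<in> borel_measurable borel"
  by (simp add: L2_def)

lemma L2_sq_integrable: "f \<in> L2 \<Longrightarrow> integrable lborel (\<lambda>x. (cmod (f x))\<^sup>2)"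
  by (simp add: L2_def)

lemma L2_norm_nonneg: "0 \<le> L2_norm f"
  by (simp add: L2_norm_def)

lemma L2_norm_squared: "(L2_norm f)\<^sup>2 = (LINT x|lborel. (cmod (f x))\<^sup>2)"
  by (simp add: L2_norm_def)

lemma sqint_eq_L2_norm: "f \<in> L2 \<Longrightarrow> sqint f = ennreal ((L2_norm f)\<^sup>2)"
  unfolding sqint_def L2_norm_squared by (intro nn_integral_eq_integral L2_sq_integrable) auto

lemma sqint_mono_AE: "AE x in lborel. cmod (f x) \<le> cmod (g x) \<Longrightarrow> sqint f \<le> sqint g"
  unfolding sqint_def
  by (intro nn_integral_mono_AE) (auto elim!: AE_mp intro!: AE_I2 ennreal_leI power_mono)

lemma L2_bound:
  assumes "g \<in> L2" "f \<in> borel_measurable borel" "AE x in lborel. cmod (f x) \<le> cmod (g x)"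
  shows "f \<in> L2"
  using sqint_mono_AE[OF assms(3)] assms by (auto simp: L2_iff_sqint)

lemma cmod_add_sq_le: "(cmod (a + b))\<^sup>2 \<le> 2 * (cmod a)\<^sup>2 + 2 * (cmod b)\<^sup>2"
proof -
  have "(cmod (a + b))\<^sup>2 \<le> (cmod a + cmod b)\<^sup>2"
    by (intro power_mono norm_triangle_ineq) auto
  also have "\<dots> \<le> 2 * (cmod a)\<^sup>2 + 2 * (cmod b)\<^sup>2"
    using sum_squares_bound[of "cmod a" "cmod b"] by (simp add: power2_sum)
  finally show ?thesis .
qed

lemma sqint_add_le:
  assumes [measurable]: "f \<in> borel_measurable borel" "g \<in> borel_measurable borel"
  shows "sqint (\<lambda>x. f x + g x) \<le> 2 * sqint f + 2 * sqint g"
proof -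
  have "sqint (\<lambda>x. f x + g x) \<le> (\<integral>\<^sup>+ x. 2 * ennreal ((cmod (f x))\<^sup>2) + 2 * ennreal ((cmod (g x))\<^sup>2) \<partial>lborel)"
    unfolding sqint_def
  proof (rule nn_integral_mono)
    fix x
    have "2 * ennreal ((cmod (f x))\<^sup>2) + 2 * ennreal ((cmod (g x))\<^sup>2)
        = ennreal (2 * (cmod (f x))\<^sup>2 + 2 * (cmod (g x))\<^sup>2)"
      by (simp add: ennreal_mult)
    then show "ennreal ((cmod (f x + g x))\<^sup>2) \<le> 2 * ennreal ((cmod (f x))\<^sup>2) + 2 * ennreal ((cmod (g x))\<^sup>2)"
      by (simp only:) (intro ennreal_leI cmod_add_sq_le)
  qed
  also have "\<dots> = 2 * sqint f + 2 * sqint g"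
    unfolding sqint_def by (subst nn_integral_add) (auto simp: nn_integral_cmult)
  finally show ?thesis .
qed

lemma sqint_uminus: "sqint (\<lambda>x. - f x) = sqint f"
  by (simp add: sqint_def)

lemma sqint_diff_le:
  assumes [measurable]: "f \<in> borel_measurable borel" "g \<in> borel_measurable borel"
  shows "sqint (\<lambda>x. f x - g x) \<le> 2 * sqint f + 2 * sqint g"
  using sqint_add_le[of f "\<lambda>x. - g x"] by (simp add: sqint_uminus)

lemma sqint_cmult:
  assumes [measurable]: "f \<in> borel_measurable borel"
  shows "sqint (\<lambda>x. c * f x) = ennreal ((cmod c)\<^sup>2) * sqint f"
  unfolding sqint_def by (simp add: norm_mult power_mult_distrib ennreal_mult nn_integral_cmult)

lemma L2_add: "f \<in> L2 \<Longrightarrow> g \<in> L2 \<Longrightarrow> (\<lambda>x. f x + g x) \<in> L2"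
  using order.strict_trans1[OF sqint_add_le[of f g], of \<infinity>]
  by (auto simp: L2_iff_sqint ennreal_mult_less_top)

lemma L2_cmult: "f \<in> L2 \<Longrightarrow> (\<lambda>x. c * f x) \<in> L2"
  using sqint_cmult[of f c] by (auto simp: L2_iff_sqint ennreal_mult_less_top)

lemma L2_uminus: "f \<in> L2 \<Longrightarrow> (\<lambda>x. - f x) \<in> L2"
  using L2_cmult[of f "-1"] by simp

lemma L2_diff: "f \<in> L2 \<Longrightarrow> g \<in> L2 \<Longrightarrow> (\<lambda>x. f x - g x) \<in> L2"
  using L2_add[of f "\<lambda>x. - g x"] L2_uminus[of g] by simp

lemma cnj_measurable[measurable]: "cnj \<in> borel_measurable borel"
  by (intro borel_measurable_continuous_onI continuous_intros)

lemma L2_cnj: "f \<in> L2 \<Longrightarrow> (\<lambda>x. cnj (f x)) \<in> L2"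
  by (auto simp: L2_def)

lemma integrable_cball_indicator: "integrable lborel (indicat_real (cball (c::'a::euclidean_space) r))"
  by (intro integrable_real_indicator)
     (use emeasure_lborel_cball_finite in \<open>auto simp del: infinity_ennreal_def\<close>)

lemma cball_indicator_L2: "(\<lambda>x::'a::euclidean_space. complex_of_real (indicat_real (cball c r) x)) \<in> L2"
proof -
  have "(\<lambda>x. (cmod (complex_of_real (indicat_real (cball c r) x)))\<^sup>2) = indicat_real (cball c r)"
    by (auto simp: indicator_def)
  moreover have "cball c r \<in> sets borel" by auto
  then have "(\<lambda>x. complex_of_real (indicat_real (cball c r) x)) \<in> borel_measurable borel" by measurable
  ultimately show ?thesis by (simp add: L2_def integrable_cball_indicator)
qed

lemma L2_bounded_mult:
  assumes f: "f \<in> L2" and [measurable]: "m \<in> borel_measurable borel"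
    and le: "\<And>x. f x \<noteq> 0 \<Longrightarrow> cmod (m x) \<le> M"
  shows "(\<lambda>x. m x * f x) \<in> L2"
proof (rule L2_bound[OF L2_cmult[OF f, of "complex_of_real M"]])
  show "(\<lambda>x. m x * f x) \<in> borel_measurable borel"
    using f by measurable
  have "cmod (m x * f x) \<le> cmod (complex_of_real M * f x)" for x
  proof (cases "f x = 0")
    case False
    then show ?thesis
      using le[OF False] by (auto simp: norm_mult intro!: mult_right_mono)
  qed auto
  then show "AE x in lborel. cmod (m x * f x) \<le> cmod (complex_of_real M * f x)" by simp
qed

lemma L2_scaled_bound:
  assumes f: "f \<in> L2" and [measurable]: "g \<in> borel_measurable borel"
    and le: "AE x in lborel. cmod (g x) \<le> M * cmod (f x)" and M: "M \<ge> 0"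
  shows "g \<in> L2" "L2_norm g \<le> M * L2_norm f"
proof -
  show g: "g \<in> L2"
    using le M by (intro L2_bound[OF L2_cmult[OF f, of "complex_of_real M"]]) (auto simp: norm_mult)
  have "(L2_norm g)\<^sup>2 \<le> (M * L2_norm f)\<^sup>2"
    unfolding power_mult_distrib L2_norm_squared integral_mult_right_zero[symmetric]
  proof (rule integral_mono_AE)
    show "AE x in lborel. (cmod (g x))\<^sup>2 \<le> M\<^sup>2 * (cmod (f x))\<^sup>2"
      using le by eventually_elim (metis power_mult_distrib power_mono norm_ge_zero)
  qed (use g f in \<open>auto intro!: L2_sq_integrable\<close>)
  then show "L2_norm g \<le> M * L2_norm f"
    by (rule power2_le_imp_le) (use M in \<open>auto simp: L2_norm_nonneg\<close>)
qed

text \<open>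
  Cauchy-Schwarz, reduced to its version for nonnegative integrals, which also gives integrability.
\<close>
lemma L2_mult_integrable:
  assumes "f \<in> L2" "g \<in> L2"
  shows "integrable lborel (\<lambda>x. f x * g x)"
    and "cmod (LINT x|lborel. f x * g x) \<le> L2_norm f * L2_norm g"
proof -
  have [measurable]: "f \<in> borel_measurable borel" "g \<in> borel_measurable borel"
    using assms by auto
  have "(\<integral>\<^sup>+x. ennreal (cmod (f x * g x)) \<partial>lborel)\<^sup>2
      = (\<integral>\<^sup>+x. ennreal (cmod (f x)) * ennreal (cmod (g x)) \<partial>lborel)\<^sup>2"
    by (simp add: norm_mult ennreal_mult)
  also have "\<dots> \<le> (\<integral>\<^sup>+x. ennreal (cmod (f x)) ^ 2 \<partial>lborel) * (\<integral>\<^sup>+x. ennreal (cmod (g x)) ^ 2 \<partial>lborel)"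
    by (intro Cauchy_Schwarz_nn_integral) auto
  also have "\<dots> = sqint f * sqint g"
    by (simp add: sqint_def ennreal_power)
  also have "\<dots> = ennreal ((L2_norm f * L2_norm g)\<^sup>2)"
    using assms by (simp add: sqint_eq_L2_norm ennreal_mult power_mult_distrib)
  finally have *: "(\<integral>\<^sup>+x. ennreal (cmod (f x * g x)) \<partial>lborel)\<^sup>2 \<le> ennreal ((L2_norm f * L2_norm g)\<^sup>2)" .
  then have "(\<integral>\<^sup>+x. ennreal (cmod (f x * g x)) \<partial>lborel)\<^sup>2 < \<infinity>"
    by (auto simp: less_top[symmetric] top_unique)
  then have "(\<integral>\<^sup>+x. ennreal (cmod (f x * g x)) \<partial>lborel) < \<infinity>"
    by (auto simp: power2_eq_square ennreal_mult_less_top)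
  then show int: "integrable lborel (\<lambda>x. f x * g x)"
    by (intro integrableI_bounded) auto
  have "(LINT x|lborel. cmod (f x * g x))\<^sup>2 \<le> (L2_norm f * L2_norm g)\<^sup>2"
    using * by (subst (asm) nn_integral_eq_integral) (use int in \<open>auto simp: ennreal_power\<close>)
  then have "(LINT x|lborel. cmod (f x * g x)) \<le> L2_norm f * L2_norm g"
    by (rule power2_le_imp_le) (simp add: L2_norm_nonneg)
  then show "cmod (LINT x|lborel. f x * g x) \<le> L2_norm f * L2_norm g"
    using integral_norm_bound[of lborel "\<lambda>x. f x * g x"] by (rule order_trans[rotated])
qed

lemma sqint_zero_AE:
  assumes [measurable]: "f \<in> borel_measurable borel" and "sqint f = 0"
  shows "AE x in lborel. f x = 0"
  using assms(2) unfolding sqint_def by (subst (asm) nn_integral_0_iff_AE) auto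

lemma sqint_limit_unique:
  assumes [measurable]: "\<And>n. F n \<in> borel_measurable borel" "f \<in> borel_measurable borel" "g \<in> borel_measurable borel"
    and "(\<lambda>n. sqint (\<lambda>x. F n x - f x)) \<longlonglongrightarrow> 0" "(\<lambda>n. sqint (\<lambda>x. F n x - g x)) \<longlonglongrightarrow> 0"
  shows "AE x in lborel. f x = g x"
proof -
  have "sqint (\<lambda>x. f x - g x) \<le> 2 * sqint (\<lambda>x. F n x - f x) + 2 * sqint (\<lambda>x. F n x - g x)" for n
    using sqint_diff_le[of "\<lambda>x. F n x - g x" "\<lambda>x. F n x - f x"] by (simp add: add.commute)
  moreover have "(\<lambda>n. 2 * sqint (\<lambda>x. F n x - f x) + 2 * sqint (\<lambda>x. F n x - g x)) \<longlonglongrightarrow> 2 * 0 + 2 * 0"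
    using assms(4,5) by (intro tendsto_intros ennreal_tendsto_cmult) auto
  ultimately have "sqint (\<lambda>x. f x - g x) \<le> 2 * 0 + 2 * 0"
    by (intro LIMSEQ_le_const) auto
  then have "sqint (\<lambda>x. f x - g x) = 0" by simp
  then have "AE x in lborel. f x - g x = 0" by (intro sqint_zero_AE) auto
  then show ?thesis by simp
qed

lemma sqint_Fatou:
  assumes [measurable]: "\<And>n. F n \<in> borel_measurable borel" "f \<in> borel_measurable borel"
    and lim: "AE x in lborel. (\<lambda>n. F n x) \<longlonglongrightarrow> f x"
    and le: "eventually (\<lambda>n. sqint (F n) \<le> e) sequentially"
  shows "sqint f \<le> e"
proof -
  have "sqint f = (\<integral>\<^sup>+ x. liminf (\<lambda>n. ennreal ((cmod (F n x))\<^sup>2)) \<partial>lborel)"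
    unfolding sqint_def
  proof (rule nn_integral_cong_AE)
    show "AE x in lborel. ennreal ((cmod (f x))\<^sup>2) = liminf (\<lambda>n. ennreal ((cmod (F n x))\<^sup>2))"
      using lim
    proof eventually_elim
      case (elim x)
      then have "(\<lambda>n. ennreal ((cmod (F n x))\<^sup>2)) \<longlonglongrightarrow> ennreal ((cmod (f x))\<^sup>2)"
        by (intro tendsto_intros)
      from lim_imp_Liminf[OF _ this] show ?case by simp
    qed
  qed
  also have "\<dots> \<le> liminf (\<lambda>n. sqint (F n))"
    unfolding sqint_def by (intro nn_integral_liminf) auto
  also have "\<dots> \<le> limsup (\<lambda>n. sqint (F n))"
    by (intro Liminf_le_Limsup) auto
  also have "\<dots> \<le> e"
    using le by (rule Limsup_bounded)
  finally show ?thesis .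
qed

lemma ennreal_tendsto_0I:
  fixes F :: "nat \<Rightarrow> ennreal"
  assumes "\<And>e. e > 0 \<Longrightarrow> \<forall>\<^sub>F n in sequentially. F n \<le> ennreal e"
  shows "F \<longlonglongrightarrow> 0"
proof (rule order_tendstoI)
  fix a :: ennreal assume "0 < a"
  then obtain e where e: "0 < e" "ennreal e < a"
  proof (cases a)
    case (real r)
    with \<open>0 < a\<close> show ?thesis by (intro that[of "r / 2"]) (auto simp: ennreal_less_iff)
  next
    case top
    then show ?thesis by (intro that[of 1]) auto
  qed
  show "\<forall>\<^sub>F n in sequentially. F n < a"
    using assms[OF e(1)] by eventually_elim (use e in auto)
qed auto

text \<open>
  The Riesz-Fischer argument. Along a subsequence \<open>s\<close> whose increments \<open>d j\<close> satisfy
  \<open>sqint (d j) \<le> 4\<^sup>-\<^sup>j\<close>, the function \<open>\<Sum>j. 2\<^sup>j |d j|\<^sup>2\<close> is integrable, hence finite almost everywhere, so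
  \<open>|d j|\<close> is bounded by a geometric sequence and the subsequence converges pointwise. Fatou's lemma shows
  that its pointwise limit is also the limit in the mean.
\<close>
lemma sqint_complete:
  assumes [measurable]: "\<And>n. F n \<in> borel_measurable borel"
    and Cauchy: "\<And>e. 0 < e \<Longrightarrow> \<exists>N. \<forall>m\<ge>N. \<forall>k\<ge>N. sqint (\<lambda>x. F m x - F k x) \<le> ennreal e"
  obtains f where "f \<in> borel_measurable borel" "(\<lambda>n. sqint (\<lambda>x. F n x - f x)) \<longlonglongrightarrow> 0"
proof -
  have "\<exists>N. \<forall>m\<ge>N. \<forall>k\<ge>N. sqint (\<lambda>x. F m x - F k x) \<le> ennreal ((1/4)^j)" for j
    by (rule Cauchy) auto
  then obtain N where N: "\<And>j m k. m \<ge> N j \<Longrightarrow> k \<ge> N j \<Longrightarrow> sqint (\<lambda>x. F m x - F k x) \<le> ennreal ((1/4)^j)"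
    by metis
  \<comment> \<open>Strictly increasing, and beyond the threshold \<open>N j\<close>.\<close>
  define s where "s j = (\<Sum>i\<le>j. N i) + j" for j
  have sN: "N j \<le> s j" for j
    unfolding s_def using member_le_sum[of j "{..j}" N] by auto
  have s_le: "s j \<le> s (Suc j)" for j by (simp add: s_def)
  have "strict_mono s" unfolding strict_mono_Suc_iff by (simp add: s_def)
  define d where "d j x = F (s (Suc j)) x - F (s j) x" for j x
  have [measurable]: "d j \<in> borel_measurable borel" for j unfolding d_def by measurable
  have dle: "sqint (d j) \<le> ennreal ((1/4)^j)" for j
    unfolding d_def by (intro N) (use sN[of j] s_le[of j] in linarith)+
  define S where "S x = (\<Sum>j. ennreal (2^j) * ennreal ((cmod (d j x))\<^sup>2))" for x
  have [measurable]: "S \<in> borel_measurable borel" unfolding S_def by measurable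
  have "(\<integral>\<^sup>+ x. S x \<partial>lborel) = (\<Sum>j. ennreal (2^j) * sqint (d j))"
    unfolding S_def sqint_def by (subst nn_integral_suminf) (auto simp: nn_integral_cmult)
  also have "\<dots> \<le> (\<Sum>j. ennreal ((1/2)^j))"
  proof (intro suminf_le)
    fix j
    have "ennreal (2^j) * sqint (d j) \<le> ennreal (2^j) * ennreal ((1/4)^j)"
      by (intro mult_left_mono dle) auto
    also have "\<dots> = ennreal (2^j * (1/4)^j)" by (simp add: ennreal_mult)
    also have "(2::real)^j * (1/4)^j = (1/2)^j" by (simp flip: power_mult_distrib)
    finally show "ennreal (2^j) * sqint (d j) \<le> ennreal ((1/2)^j)" .
  qed auto
  also have "\<dots> < \<infinity>"
    by (subst suminf_ennreal2) (auto intro!: summable_geometric)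
  finally have "AE x in lborel. S x \<noteq> \<infinity>"
    by (intro nn_integral_PInf_AE) auto
  then have conv: "AE x in lborel. convergent (\<lambda>j. F (s j) x)"
  proof eventually_elim
    case (elim x)
    have sum: "summable (\<lambda>j. 2^j * (cmod (d j x))\<^sup>2)"
    proof (rule summable_suminf_not_top)
      show "(\<Sum>j. ennreal (2^j * (cmod (d j x))\<^sup>2)) \<noteq> top"
        using elim by (simp add: S_def ennreal_mult)
    qed auto
    then obtain B where B: "\<And>j. norm (2^j * (cmod (d j x))\<^sup>2) \<le> B"
      using sum summable_imp_Bseq unfolding Bseq_def by blast
    define q where "q = sqrt (1/2::real)"
    have q: "0 \<le> q" "q < 1" "sqrt ((1/2)^j) = q^j" for j
      unfolding q_def by (simp_all add: real_sqrt_power real_sqrt_lt_1_iff del: power_divide)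
    have "cmod (d j x) \<le> sqrt B * q^j" for j
    proof -
      have "(cmod (d j x))\<^sup>2 \<le> B * (1/2)^j"
        using B[of j] by (simp add: field_simps)
      then have "sqrt ((cmod (d j x))\<^sup>2) \<le> sqrt (B * (1/2)^j)" by (rule real_sqrt_le_mono)
      then show ?thesis by (simp add: real_sqrt_mult q(3) del: power_divide)
    qed
    moreover have "summable (\<lambda>j. sqrt B * q^j)"
      by (rule summable_mult[OF summable_geometric]) (use q in simp)
    ultimately have "summable (\<lambda>j. d j x)"
      using summable_comparison_test'[of "\<lambda>j. sqrt B * q^j" 0 "\<lambda>j. d j x"] by simp
    then have "convergent (\<lambda>n. (\<Sum>j<n. d j x))"
      by (simp add: summable_iff_convergent)
    then have "convergent (\<lambda>n. F (s n) x - F (s 0) x)"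
      unfolding d_def sum_lessThan_telescope[of "\<lambda>n. F (s n) x"] .
    from convergent_add[OF this convergent_const[of "F (s 0) x"]]
    show "convergent (\<lambda>j. F (s j) x)" by simp
  qed
  define f where "f x = lim (\<lambda>j. F (s j) x)" for x
  have [measurable]: "f \<in> borel_measurable borel" unfolding f_def by measurable
  have lim: "AE x in lborel. (\<lambda>j. F (s j) x) \<longlonglongrightarrow> f x"
    using conv unfolding f_def by eventually_elim (simp add: convergent_LIMSEQ_iff)
  have "(\<lambda>n. sqint (\<lambda>x. F n x - f x)) \<longlonglongrightarrow> 0"
  proof (rule ennreal_tendsto_0I)
    fix e :: real assume "e > 0"
    then obtain M where M: "\<And>m k. m \<ge> M \<Longrightarrow> k \<ge> M \<Longrightarrow> sqint (\<lambda>x. F m x - F k x) \<le> ennreal e"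
      using Cauchy by meson
    have "sqint (\<lambda>x. F n x - f x) \<le> ennreal e" if "n \<ge> M" for n
    proof (rule sqint_Fatou)
      show "AE x in lborel. (\<lambda>j. F n x - F (s j) x) \<longlonglongrightarrow> F n x - f x"
        using lim by eventually_elim (intro tendsto_intros)
      have "sqint (\<lambda>x. F n x - F (s j) x) \<le> ennreal e" if "j \<ge> M" for j
        using that \<open>n \<ge> M\<close> by (intro M) (auto simp: s_def)
      then show "\<forall>\<^sub>F j in sequentially. sqint (\<lambda>x. F n x - F (s j) x) \<le> ennreal e"
        by (auto simp: eventually_sequentially)
    qed auto
    then show "\<forall>\<^sub>F n in sequentially. sqint (\<lambda>x. F n x - f x) \<le> ennreal e"
      by (auto simp: eventually_sequentially)
  qed
  then show thesis by (intro that) auto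
qed

section \<open>Fourier transform of integrable functions\<close>

lemma cmod_kernel: "cmod (exp (- \<i> * complex_of_real y)) = 1"
  by (simp add: norm_exp_eq_Re)

lemma fourier_integrand_integrable:
  "integrable lborel f \<Longrightarrow> integrable lborel (\<lambda>x::'a::euclidean_space. f x * exp (- \<i> * complex_of_real (\<xi> \<bullet> x)))"
  by (rule Bochner_Integration.integrable_bound[of lborel f]) (auto simp: norm_mult cmod_kernel)

lemma fourier_measurable[measurable]:
  fixes f :: "'a::euclidean_space \<Rightarrow> complex"
  assumes [measurable]: "f \<in> borel_measurable borel"
  shows "fourier f \<in> borel_measurable borel"
  unfolding fourier_def by measurable

lemma fourier_norm_le: "cmod (fourier f \<xi>) \<le> (LINT x|lborel. cmod (f x))"
  unfolding fourier_def
  using integral_norm_bound[of lborel "\<lambda>x. f x * exp (- \<i> * complex_of_real (\<xi> \<bullet> x))"]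
  by (simp only: norm_mult cmod_kernel mult_1_right)

lemma fourier_diff:
  "integrable lborel f \<Longrightarrow> integrable lborel g \<Longrightarrow> fourier (\<lambda>x. f x - g x) \<xi> = fourier f \<xi> - fourier g \<xi>"
  using fourier_integrand_integrable[of f \<xi>] fourier_integrand_integrable[of g \<xi>]
  unfolding fourier_def by (simp add: left_diff_distrib Bochner_Integration.integral_diff)

lemma fourier_cmult: "fourier (\<lambda>x. c * f x) \<xi> = c * fourier f \<xi>"
  unfolding fourier_def by (simp add: mult.assoc)

lemma fourier_cong_AE:
  fixes f g :: "'a::euclidean_space \<Rightarrow> complex"
  assumes [measurable]: "f \<in> borel_measurable borel" "g \<in> borel_measurable borel"
    and "AE x in lborel. f x = g x"
  shows "fourier f = fourier g"
  unfolding fourier_def using assms(3) by (intro ext integral_cong_AE) auto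

text \<open>
  Both sides are the same double integral (Fubini).
\<close>
lemma fourier_multiplication_formula:
  fixes f h :: "'a::euclidean_space \<Rightarrow> complex"
  assumes f: "integrable lborel f" and h: "integrable lborel h"
  shows "(LINT \<xi>|lborel. fourier f \<xi> * h \<xi>) = (LINT x|lborel. f x * fourier h x)"
proof -
  have [measurable]: "f \<in> borel_measurable borel" "h \<in> borel_measurable borel"
    using f h by auto
  let ?k = "\<lambda>x \<xi>. f x * h \<xi> * exp (- \<i> * complex_of_real (\<xi> \<bullet> x))"
  have k: "cmod (?k x \<xi>) = cmod (f x) * cmod (h \<xi>)" for x \<xi>
    by (simp only: norm_mult cmod_kernel mult_1_right)
  have "integrable (lborel \<Otimes>\<^sub>M lborel) (case_prod ?k)"
  proof (rule lborel_pair.Fubini_integrable)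
    show "integrable lborel (\<lambda>x. LINT y|lborel. cmod (case_prod ?k (x, y)))"
      unfolding split_conv k using f by simp
    show "AE x in lborel. integrable lborel (\<lambda>y. case_prod ?k (x, y))"
    proof (rule AE_I2)
      fix x
      have "integrable lborel (\<lambda>y. h y * exp (- \<i> * complex_of_real (x \<bullet> y)))"
        using h by (rule fourier_integrand_integrable)
      from integrable_mult_right[OF this, of "f x"]
      show "integrable lborel (\<lambda>y. case_prod ?k (x, y))"
        by (simp add: inner_commute mult.assoc)
    qed
  qed measurable
  from lborel_pair.Fubini_integral[OF this]
  have "(LINT \<xi>|lborel. LINT x|lborel. ?k x \<xi>) = (LINT x|lborel. LINT \<xi>|lborel. ?k x \<xi>)" .
  moreover have "(LINT x|lborel. ?k x \<xi>) = fourier f \<xi> * h \<xi>" for \<xi>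
    unfolding fourier_def by (subst integral_mult_left_zero[symmetric]) (simp add: mult_ac)
  moreover have "(LINT \<xi>|lborel. ?k x \<xi>) = f x * fourier h x" for x
    unfolding fourier_def by (subst integral_mult_right_zero[symmetric]) (simp add: mult_ac inner_commute)
  ultimately show ?thesis by simp
qed

lemma integral_affine:
  fixes f :: "'a::euclidean_space \<Rightarrow> complex"
  assumes [measurable]: "f \<in> borel_measurable borel" and c: "c \<noteq> 0"
  shows "(LINT x|lborel. f x) = complex_of_real (\<bar>c\<bar> ^ DIM('a)) * (LINT x|lborel. f (t + c *\<^sub>R x))"
proof -
  have "(LINT x|lborel. f x) = (LINT x|density (distr lborel borel (\<lambda>x. t + c *\<^sub>R x)) (\<lambda>_. ennreal (\<bar>c\<bar>^DIM('a))). f x)"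
    using lborel_affine[OF c, of t] by (simp add: ennreal_power)
  also have "\<dots> = (LINT x|lborel. \<bar>c\<bar>^DIM('a) *\<^sub>R f (t + c *\<^sub>R x))"
    by (subst integral_density) (auto simp: integral_distr)
  finally show ?thesis by (simp add: scaleR_conv_of_real)
qed

lemma nn_integral_affine:
  fixes f :: "'a::euclidean_space \<Rightarrow> ennreal"
  assumes [measurable]: "f \<in> borel_measurable borel" and c: "c \<noteq> 0"
  shows "(\<integral>\<^sup>+x. f x \<partial>lborel) = ennreal (\<bar>c\<bar> ^ DIM('a)) * (\<integral>\<^sup>+x. f (t + c *\<^sub>R x) \<partial>lborel)"
proof -
  have "(\<integral>\<^sup>+x. f x \<partial>lborel) = (\<integral>\<^sup>+x. f x \<partial>density (distr lborel borel (\<lambda>x. t + c *\<^sub>R x)) (\<lambda>_. ennreal (\<bar>c\<bar>^DIM('a))))"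
    using lborel_affine[OF c, of t] by (simp add: ennreal_power)
  also have "\<dots> = (\<integral>\<^sup>+x. ennreal (\<bar>c\<bar>^DIM('a)) * f (t + c *\<^sub>R x) \<partial>lborel)"
    by (subst nn_integral_density) (auto simp: nn_integral_distr)
  finally show ?thesis by (simp add: nn_integral_cmult)
qed

lemma integrable_affine:
  fixes f :: "'a::euclidean_space \<Rightarrow> complex"
  assumes f: "integrable lborel f" and c: "c \<noteq> 0"
  shows "integrable lborel (\<lambda>x. f (t + c *\<^sub>R x))"
proof (rule integrableI_bounded)
  have [measurable]: "f \<in> borel_measurable borel" using f by auto
  show "(\<lambda>x. f (t + c *\<^sub>R x)) \<in> borel_measurable lborel" by simp
  have "ennreal (\<bar>c\<bar> ^ DIM('a)) * (\<integral>\<^sup>+x. norm (f (t + c *\<^sub>R x)) \<partial>lborel) < \<infinity>"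
    using f c by (subst nn_integral_affine[symmetric]) (auto simp: integrable_iff_bounded)
  then show "(\<integral>\<^sup>+x. norm (f (t + c *\<^sub>R x)) \<partial>lborel) < \<infinity>"
    using c by (auto simp: ennreal_mult_less_top)
qed

text \<open>
  Lebesgue measure on a Euclidean space is the image of the product of Lebesgue measures on the
  coordinate axes, so this is Fubini's theorem for products.
\<close>
lemma tensor_integral:
  fixes f :: "'a::euclidean_space \<Rightarrow> real \<Rightarrow> complex"
  assumes f: "\<And>b. b \<in> Basis \<Longrightarrow> integrable lborel (f b)"
  shows "integrable lborel (\<lambda>x::'a. \<Prod>b\<in>Basis. f b (x \<bullet> b))"
    and "(LINT x|lborel. (\<Prod>b\<in>Basis. f b (x \<bullet> b))) = (\<Prod>b\<in>Basis. LINT s|lborel. f b s)"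
proof -
  interpret P: product_sigma_finite "\<lambda>_::'a. lborel :: real measure" ..
  let ?T = "\<lambda>g::'a \<Rightarrow> real. \<Sum>b\<in>Basis. g b *\<^sub>R b"
  have [measurable]: "f b \<in> borel_measurable borel" if "b \<in> Basis" for b
    using f[OF that] by auto
  have T: "?T g \<bullet> b = g b" if "b \<in> Basis" for g b
    using that by (simp add: inner_sum_left inner_Basis if_distrib[of "\<lambda>x. _ * x"] cong: if_cong)
  have [measurable]: "?T \<in> (\<Pi>\<^sub>M b\<in>Basis. lborel) \<rightarrow>\<^sub>M borel" by measurable
  have eq: "(\<lambda>g. \<Prod>b\<in>Basis. f b (?T g \<bullet> b)) = (\<lambda>g. \<Prod>b\<in>Basis. f b (g b))"
    using T by (auto intro!: prod.cong)
  have l: "lborel = distr (\<Pi>\<^sub>M b\<in>Basis. lborel) borel ?T" by (rule lborel_eq)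
  have "integrable (distr (\<Pi>\<^sub>M b\<in>Basis. lborel) borel ?T) (\<lambda>x::'a. \<Prod>b\<in>Basis. f b (x \<bullet> b))"
    by (subst integrable_distr_eq) (auto simp: eq intro!: P.product_integrable_prod f)
  then show "integrable lborel (\<lambda>x::'a. \<Prod>b\<in>Basis. f b (x \<bullet> b))"
    unfolding l[symmetric] .
  have "(LINT x|distr (\<Pi>\<^sub>M b\<in>Basis. lborel) borel ?T. (\<Prod>b\<in>Basis. f b (x \<bullet> b))) = (\<Prod>b\<in>Basis. LINT s|lborel. f b s)"
    by (subst integral_distr) (auto simp: eq intro!: P.product_integral_prod f)
  then show "(LINT x|lborel. (\<Prod>b\<in>Basis. f b (x \<bullet> b))) = (\<Prod>b\<in>Basis. LINT s|lborel. f b s)"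
    unfolding l[symmetric] .
qed

text \<open>
  Not normalised: this is the eigenfunction of \<open>fourier\<close> with value 1 at the origin.
\<close>
definition gauss :: "'a::euclidean_space \<Rightarrow> real" where
  "gauss x = exp (- (norm x)\<^sup>2 / 2)"

lemma gauss_pos: "0 < gauss x" and gauss_le_1: "gauss x \<le> 1" and gauss_0: "gauss 0 = 1"
  by (auto simp: gauss_def)

lemma continuous_gauss: "continuous_on UNIV gauss"
  unfolding gauss_def by (intro continuous_intros) auto

lemma gauss_measurable[measurable]: "gauss \<in> borel_measurable borel"
  by (intro borel_measurable_continuous_onI continuous_gauss)

lemma gauss_tensor:
  fixes x \<xi> :: "'a::euclidean_space"
  shows "complex_of_real (gauss x) * exp (- \<i> * complex_of_real (\<xi> \<bullet> x))
    = (\<Prod>b\<in>Basis. complex_of_real (exp (- (x \<bullet> b)\<^sup>2 / 2)) * exp (- \<i> * complex_of_real ((\<xi> \<bullet> b) * (x \<bullet> b))))"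
proof -
  have "(norm x)\<^sup>2 = (\<Sum>b\<in>Basis. (x \<bullet> b)\<^sup>2)"
    unfolding power2_norm_eq_inner euclidean_inner[of x x] by (simp add: power2_eq_square)
  then have "gauss x = (\<Prod>b\<in>Basis. exp (- (x \<bullet> b)\<^sup>2 / 2))"
    by (simp add: gauss_def exp_sum[symmetric] sum_negf sum_divide_distrib)
  moreover have "exp (- \<i> * complex_of_real (\<xi> \<bullet> x)) = (\<Prod>b\<in>Basis. exp (- \<i> * complex_of_real ((\<xi> \<bullet> b) * (x \<bullet> b))))"
    unfolding euclidean_inner[of \<xi> x] by (simp add: exp_sum[symmetric] sum_negf sum_distrib_left)
  ultimately show ?thesis by (simp add: prod.distrib)
qed

text \<open>
  The characteristic function of the standard normal distribution, without the normalisation.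
\<close>
lemma gauss_1d:
  "integrable lborel (\<lambda>s. complex_of_real (exp (- s\<^sup>2 / 2)) * exp (- \<i> * complex_of_real (t * s)))"
  "(LINT s|lborel. complex_of_real (exp (- s\<^sup>2 / 2)) * exp (- \<i> * complex_of_real (t * s)))
     = complex_of_real (sqrt (2 * pi) * exp (- t\<^sup>2 / 2))"
proof -
  have eq: "complex_of_real (exp (- s\<^sup>2 / 2)) * exp (- \<i> * complex_of_real (t * s))
      = complex_of_real (sqrt (2 * pi)) * (std_normal_density s *\<^sub>R iexp (- t * s))" for s
    by (simp add: std_normal_density_def scaleR_conv_of_real)
  interpret N: real_distribution std_normal_distribution by (rule real_dist_normal_dist)
  have "integrable std_normal_distribution (\<lambda>s. iexp (- t * s))"
    by (intro N.integrable_const_bound[where B = 1]) (auto simp: norm_exp_eq_Re)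
  then have int: "integrable lborel (\<lambda>s. std_normal_density s *\<^sub>R iexp (- t * s))"
    by (subst (asm) integrable_density) auto
  then show "integrable lborel (\<lambda>s. complex_of_real (exp (- s\<^sup>2 / 2)) * exp (- \<i> * complex_of_real (t * s)))"
    unfolding eq by (rule integrable_mult_right)
  have "(LINT s|lborel. std_normal_density s *\<^sub>R iexp (- t * s)) = char std_normal_distribution (- t)"
    unfolding char_def by (subst integral_density) auto
  also have "\<dots> = complex_of_real (exp (- t\<^sup>2 / 2))"
    by (simp add: char_std_normal_distribution)
  finally show "(LINT s|lborel. complex_of_real (exp (- s\<^sup>2 / 2)) * exp (- \<i> * complex_of_real (t * s)))
     = complex_of_real (sqrt (2 * pi) * exp (- t\<^sup>2 / 2))"
    unfolding eq by (simp only: integral_mult_right_zero of_real_mult)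
qed

lemma gauss_integrable_complex: "integrable lborel (\<lambda>x::'a::euclidean_space. complex_of_real (gauss x))"
proof -
  have "integrable lborel (\<lambda>x::'a. complex_of_real (gauss x) * exp (- \<i> * complex_of_real (0 \<bullet> x)))"
    unfolding gauss_tensor by (intro tensor_integral gauss_1d)
  then show ?thesis by simp
qed

lemma gauss_integrable: "integrable lborel (gauss :: 'a::euclidean_space \<Rightarrow> real)"
proof -
  have "integrable lborel (\<lambda>x::'a. cmod (complex_of_real (gauss x)))"
    by (rule integrable_norm[OF gauss_integrable_complex])
  also have "(\<lambda>x::'a. cmod (complex_of_real (gauss x))) = gauss"
    by (simp add: fun_eq_iff gauss_def)
  finally show ?thesis .
qed

lemma fourier_gauss:
  fixes \<xi> :: "'a::euclidean_space"
  shows "fourier (\<lambda>x. complex_of_real (gauss x)) \<xi> = complex_of_real (sqrt (2 * pi) ^ DIM('a) * gauss \<xi>)"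
proof -
  have "fourier (\<lambda>x. complex_of_real (gauss x)) \<xi> = (\<Prod>b\<in>(Basis::'a set). complex_of_real (sqrt (2 * pi) * exp (- (\<xi> \<bullet> b)\<^sup>2 / 2)))"
    unfolding fourier_def gauss_tensor by (subst tensor_integral(2)) (auto simp only: gauss_1d intro!: gauss_1d)
  also have "\<dots> = complex_of_real (sqrt (2 * pi)) ^ DIM('a) * (\<Prod>b\<in>(Basis::'a set). complex_of_real (exp (- (\<xi> \<bullet> b)\<^sup>2 / 2)))"
    by (simp add: prod.distrib)
  also have "(\<Prod>b\<in>(Basis::'a set). complex_of_real (exp (- (\<xi> \<bullet> b)\<^sup>2 / 2))) = complex_of_real (gauss \<xi>)"
    using gauss_tensor[of \<xi> 0] by simp
  finally show ?thesis by simp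
qed

lemma gauss_integral: "(LINT x|lborel. gauss (x::'a::euclidean_space)) = sqrt (2 * pi) ^ DIM('a)"
proof -
  have "complex_of_real (LINT x|lborel. gauss (x::'a)) = fourier (\<lambda>x::'a. complex_of_real (gauss x)) 0"
    unfolding fourier_def by simp
  also have "\<dots> = complex_of_real (sqrt (2 * pi) ^ DIM('a))"
    unfolding fourier_gauss by (simp add: gauss_0)
  finally show ?thesis unfolding of_real_eq_iff .
qed

lemma gauss_nn_integral: "(\<integral>\<^sup>+x. ennreal (gauss (x::'a::euclidean_space)) \<partial>lborel) = ennreal (sqrt (2 * pi) ^ DIM('a))"
  by (subst nn_integral_eq_integral) (auto simp: gauss_integrable gauss_integral gauss_pos less_imp_le)

lemma gauss_scaled_integrable:
  "c \<noteq> 0 \<Longrightarrow> integrable lborel (\<lambda>x::'a::euclidean_space. complex_of_real (gauss (c *\<^sub>R x)))"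
  using integrable_affine[OF gauss_integrable_complex, of c 0] by simp

lemma fourier_gauss_scaled:
  fixes w :: "'a::euclidean_space"
  assumes e: "\<epsilon> > 0"
  shows "complex_of_real (\<epsilon> ^ DIM('a)) * fourier (\<lambda>x. complex_of_real (gauss (\<epsilon> *\<^sub>R x))) w
     = complex_of_real (sqrt (2 * pi) ^ DIM('a) * gauss (w /\<^sub>R \<epsilon>))"
proof -
  have "fourier (\<lambda>x. complex_of_real (gauss x)) (w /\<^sub>R \<epsilon>)
     = complex_of_real (\<bar>\<epsilon>\<bar> ^ DIM('a)) * (LINT x|lborel. complex_of_real (gauss (0 + \<epsilon> *\<^sub>R x)) *
         exp (- \<i> * complex_of_real ((w /\<^sub>R \<epsilon>) \<bullet> (0 + \<epsilon> *\<^sub>R x))))"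
    unfolding fourier_def using e by (intro integral_affine) auto
  also have "\<dots> = complex_of_real (\<epsilon> ^ DIM('a)) * fourier (\<lambda>x. complex_of_real (gauss (\<epsilon> *\<^sub>R x))) w"
  proof -
    have "(w /\<^sub>R \<epsilon>) \<bullet> (0 + \<epsilon> *\<^sub>R x) = w \<bullet> x" for x
      using e by simp
    then show ?thesis unfolding fourier_def using e by (simp only: add_0_left abs_of_pos)
  qed
  finally show ?thesis unfolding fourier_gauss by simp
qed

text \<open>
  Parseval's identity needs integrability of a product of transforms, which is not known for integrable
  functions. With a Gaussian factor everything is absolutely convergent. The product of the conjugate
  transform of \<open>g\<close> with \<open>exp (-i x\<bullet>\<xi>)\<close> is the transform of \<open>\<lambda>w. cnj (g (x - w))\<close>, so two applications of the
  multiplication formula move all transforms onto the Gaussian.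
\<close>
lemma damped_Parseval:
  fixes f g :: "'a::euclidean_space \<Rightarrow> complex"
  assumes f: "integrable lborel f" and g: "integrable lborel g" and e: "\<epsilon> > 0"
  shows "(LINT \<xi>|lborel. fourier f \<xi> * cnj (fourier g \<xi>) * complex_of_real (gauss (\<epsilon> *\<^sub>R \<xi>)))
    = complex_of_real (sqrt (2 * pi) ^ DIM('a)) *
      (LINT x|lborel. f x * (LINT z|lborel. cnj (g (x - \<epsilon> *\<^sub>R z)) * complex_of_real (gauss z)))"
proof -
  have [measurable]: "f \<in> borel_measurable borel" "g \<in> borel_measurable borel"
    using f g by auto
  let ?G = "\<lambda>\<xi>::'a. complex_of_real (gauss (\<epsilon> *\<^sub>R \<xi>))"
  define h where "h \<xi> = cnj (fourier g \<xi>) * ?G \<xi>" for \<xi>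
  have G: "integrable lborel ?G" using e by (intro gauss_scaled_integrable) auto
  have h: "integrable lborel h"
    unfolding h_def
  proof (rule Bochner_Integration.integrable_bound[OF integrable_mult_right[OF G, of "complex_of_real (LINT x|lborel. cmod (g x))"]])
    show "AE x in lborel. norm (cnj (fourier g x) * ?G x) \<le> norm (complex_of_real (LINT x|lborel. cmod (g x)) * ?G x)"
      by (intro AE_I2) (auto simp: norm_mult intro!: mult_right_mono fourier_norm_le)
  qed measurable
  have four: "cnj (fourier g \<xi>) * exp (- \<i> * complex_of_real (x \<bullet> \<xi>)) = fourier (\<lambda>w. cnj (g (x - w))) \<xi>" for x \<xi>
  proof -
    have "(LINT y|lborel. cnj (g y) * exp (- \<i> * complex_of_real (\<xi> \<bullet> (x - y))))
      = complex_of_real (\<bar>- 1\<bar> ^ DIM('a)) * (LINT y|lborel. cnj (g (x + (- 1) *\<^sub>R y)) * exp (- \<i> * complex_of_real (\<xi> \<bullet> (x - (x + (- 1) *\<^sub>R y)))))"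
      by (intro integral_affine) auto
    also have "\<dots> = fourier (\<lambda>w. cnj (g (x - w))) \<xi>"
      unfolding fourier_def by simp
    also have "(LINT y|lborel. cnj (g y) * exp (- \<i> * complex_of_real (\<xi> \<bullet> (x - y))))
      = (LINT y|lborel. cnj (g y * exp (- \<i> * complex_of_real (\<xi> \<bullet> y))) * exp (- \<i> * complex_of_real (x \<bullet> \<xi>)))"
      by (intro Bochner_Integration.integral_cong)
         (auto simp: exp_cnj inner_diff_right inner_commute exp_add[symmetric] algebra_simps)
    also have "\<dots> = cnj (fourier g \<xi>) * exp (- \<i> * complex_of_real (x \<bullet> \<xi>))"
      unfolding fourier_def by (subst integral_mult_left_zero) (simp add: integral_cnj del: complex_cnj_mult)
    finally show ?thesis .
  qed
  have fh: "fourier h x = complex_of_real (sqrt (2 * pi) ^ DIM('a)) *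
      (LINT z|lborel. cnj (g (x - \<epsilon> *\<^sub>R z)) * complex_of_real (gauss z))" for x
  proof -
    have gx: "integrable lborel (\<lambda>w. cnj (g (x - w)))"
      using integrable_affine[OF g, of "-1" x] by simp
    have "fourier h x = (LINT \<xi>|lborel. fourier (\<lambda>w. cnj (g (x - w))) \<xi> * ?G \<xi>)"
      unfolding four[symmetric] h_def by (subst fourier_def) (simp add: mult_ac)
    also have "\<dots> = (LINT w|lborel. cnj (g (x - w)) * fourier ?G w)"
      by (rule fourier_multiplication_formula[OF gx G])
    also have "\<dots> = complex_of_real (\<bar>\<epsilon>\<bar> ^ DIM('a)) * (LINT z|lborel. cnj (g (x - (0 + \<epsilon> *\<^sub>R z))) * fourier ?G (0 + \<epsilon> *\<^sub>R z))"
      using e by (intro integral_affine) auto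
    also have "\<dots> = (LINT z|lborel. cnj (g (x - \<epsilon> *\<^sub>R z)) * (complex_of_real (\<epsilon> ^ DIM('a)) * fourier ?G (\<epsilon> *\<^sub>R z)))"
      using e by (subst integral_mult_right_zero[symmetric]) (simp add: mult_ac)
    also have "\<dots> = (LINT z|lborel. complex_of_real (sqrt (2 * pi) ^ DIM('a)) * (cnj (g (x - \<epsilon> *\<^sub>R z)) * complex_of_real (gauss z)))"
      unfolding fourier_gauss_scaled[OF e] using e by (simp add: mult_ac)
    finally show ?thesis by (simp only: integral_mult_right_zero)
  qed
  have "(LINT \<xi>|lborel. fourier f \<xi> * h \<xi>) = (LINT x|lborel. f x * fourier h x)"
    by (rule fourier_multiplication_formula[OF f h])
  then show ?thesis
    unfolding fh h_def by (simp only: mult.left_commute[of _ "complex_of_real (sqrt (2 * pi) ^ DIM('a))"] integral_mult_right_zero mult.assoc)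
qed

text \<open>
  Without integrability the left-hand side is 0 by convention.
\<close>
lemma norm_integral_le_nn_integral:
  fixes f :: "'a \<Rightarrow> complex"
  shows "ennreal (norm (integral\<^sup>L M f)) \<le> (\<integral>\<^sup>+x. norm (f x) \<partial>M)"
  by (cases "integrable M f") (auto simp: integral_norm_bound_ennreal not_integrable_integral_eq)

lemma sqrt_2pi_power: "sqrt (2 * pi) ^ n * sqrt (2 * pi) ^ n = (2 * pi) ^ n"
proof -
  have "sqrt (2 * pi) * sqrt (2 * pi) = 2 * pi"
    by (subst real_sqrt_mult_self) simp
  then show ?thesis by (metis power_mult_distrib)
qed

text \<open>
  In the damped identity with \<open>g = f\<close> the right-hand side is a Gaussian average over \<open>z\<close> of correlations
  of \<open>f\<close> with its translates, and each correlation is at most \<open>sqint f\<close> by the arithmetic-geometric mean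
  inequality and translation invariance. The bound is uniform in \<open>\<epsilon>\<close>, and the damping is removed with
  Fatou's lemma.
\<close>
lemma fourier_Bessel:
  fixes f :: "'a::euclidean_space \<Rightarrow> complex"
  assumes f: "integrable lborel f"
  shows "sqint (fourier f) \<le> ennreal ((2 * pi) ^ DIM('a)) * sqint f"
proof -
  have [measurable]: "f \<in> borel_measurable borel" using f by auto
  let ?c = "sqrt (2 * pi) ^ DIM('a)"
  have cc: "?c * ?c = (2 * pi) ^ DIM('a)" by (rule sqrt_2pi_power)
  have damped: "(\<integral>\<^sup>+\<xi>. ennreal ((cmod (fourier f \<xi>))\<^sup>2 * gauss (\<epsilon> *\<^sub>R \<xi>)) \<partial>lborel) \<le> ennreal ((2 * pi) ^ DIM('a)) * sqint f"
    if e: "\<epsilon> > 0" for \<epsilon>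
  proof -
    have "integrable lborel (\<lambda>\<xi>. complex_of_real ((LINT x|lborel. cmod (f x))\<^sup>2) * complex_of_real (gauss (\<epsilon> *\<^sub>R (\<xi>::'a))))"
      using e by (intro integrable_mult_right gauss_scaled_integrable) auto
    then have int: "integrable lborel (\<lambda>\<xi>. (cmod (fourier f \<xi>))\<^sup>2 * gauss (\<epsilon> *\<^sub>R \<xi>))"
    proof (rule Bochner_Integration.integrable_bound)
      show "AE x in lborel. norm ((cmod (fourier f x))\<^sup>2 * gauss (\<epsilon> *\<^sub>R x))
         \<le> norm (complex_of_real ((LINT x|lborel. cmod (f x))\<^sup>2) * complex_of_real (gauss (\<epsilon> *\<^sub>R x)))"
        by (intro AE_I2) (auto simp: norm_mult norm_power abs_mult intro!: mult_right_mono power_mono fourier_norm_le)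
    qed measurable
    have sq: "complex_of_real ((cmod (fourier f \<xi>))\<^sup>2 * gauss (\<epsilon> *\<^sub>R \<xi>)) = fourier f \<xi> * cnj (fourier f \<xi>) * complex_of_real (gauss (\<epsilon> *\<^sub>R \<xi>))" for \<xi>
      by (simp only: of_real_mult complex_norm_square)
    have "(\<integral>\<^sup>+\<xi>. ennreal ((cmod (fourier f \<xi>))\<^sup>2 * gauss (\<epsilon> *\<^sub>R \<xi>)) \<partial>lborel)
      = ennreal (LINT \<xi>|lborel. (cmod (fourier f \<xi>))\<^sup>2 * gauss (\<epsilon> *\<^sub>R \<xi>))"
      using int by (intro nn_integral_eq_integral) (auto simp: gauss_pos less_imp_le)
    also have "(LINT \<xi>|lborel. (cmod (fourier f \<xi>))\<^sup>2 * gauss (\<epsilon> *\<^sub>R \<xi>))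
      \<le> cmod (complex_of_real (LINT \<xi>|lborel. (cmod (fourier f \<xi>))\<^sup>2 * gauss (\<epsilon> *\<^sub>R \<xi>)))"
      by simp
    also have "complex_of_real (LINT \<xi>|lborel. (cmod (fourier f \<xi>))\<^sup>2 * gauss (\<epsilon> *\<^sub>R \<xi>))
      = complex_of_real ?c * (LINT x|lborel. f x * (LINT z|lborel. cnj (f (x - \<epsilon> *\<^sub>R z)) * complex_of_real (gauss z)))"
      unfolding integral_complex_of_real[symmetric] sq by (rule damped_Parseval[OF f f e])
    also have "ennreal (cmod \<dots>) = ennreal ?c * ennreal (cmod (LINT x|lborel. f x * (LINT z|lborel. cnj (f (x - \<epsilon> *\<^sub>R z)) * complex_of_real (gauss z))))"
      by (simp add: norm_mult norm_power ennreal_mult)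
    also have "\<dots> \<le> ennreal ?c * (\<integral>\<^sup>+x. ennreal (norm (f x * (LINT z|lborel. cnj (f (x - \<epsilon> *\<^sub>R z)) * complex_of_real (gauss z)))) \<partial>lborel)"
      by (intro mult_left_mono norm_integral_le_nn_integral) auto
    also have "\<dots> \<le> ennreal ?c * (\<integral>\<^sup>+x. (\<integral>\<^sup>+z. ennreal (cmod (f x) * cmod (f (x - \<epsilon> *\<^sub>R z)) * gauss z) \<partial>lborel) \<partial>lborel)"
    proof (intro mult_left_mono nn_integral_mono)
      fix x
      have "ennreal (norm (f x * (LINT z|lborel. cnj (f (x - \<epsilon> *\<^sub>R z)) * complex_of_real (gauss z))))
        \<le> ennreal (cmod (f x)) * (\<integral>\<^sup>+z. ennreal (norm (cnj (f (x - \<epsilon> *\<^sub>R z)) * complex_of_real (gauss z))) \<partial>lborel)"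
        by (simp only: norm_mult[of "f x"] ennreal_mult norm_ge_zero) (intro mult_left_mono norm_integral_le_nn_integral, auto)
      also have "\<dots> = (\<integral>\<^sup>+z. ennreal (cmod (f x) * cmod (f (x - \<epsilon> *\<^sub>R z)) * gauss z) \<partial>lborel)"
        by (subst nn_integral_cmult[symmetric]) (auto simp: norm_mult ennreal_mult gauss_pos less_imp_le mult_ac)
      finally show "ennreal (norm (f x * (LINT z|lborel. cnj (f (x - \<epsilon> *\<^sub>R z)) * complex_of_real (gauss z))))
        \<le> (\<integral>\<^sup>+z. ennreal (cmod (f x) * cmod (f (x - \<epsilon> *\<^sub>R z)) * gauss z) \<partial>lborel)" .
    qed auto
    also have "\<dots> \<le> ennreal ?c * (\<integral>\<^sup>+x. (\<integral>\<^sup>+z. ennreal (gauss z / 2) * (ennreal ((cmod (f x))\<^sup>2) + ennreal ((cmod (f (x - \<epsilon> *\<^sub>R z)))\<^sup>2)) \<partial>lborel) \<partial>lborel)"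
    proof (intro mult_left_mono nn_integral_mono)
      fix x z
      have "cmod (f x) * cmod (f (x - \<epsilon> *\<^sub>R z)) * gauss z \<le> gauss z / 2 * ((cmod (f x))\<^sup>2 + (cmod (f (x - \<epsilon> *\<^sub>R z)))\<^sup>2)"
        using mult_right_mono[OF sum_squares_bound[of "cmod (f x)" "cmod (f (x - \<epsilon> *\<^sub>R z))"], of "gauss z"] gauss_pos[of z]
        by (simp add: field_simps)
      then show "ennreal (cmod (f x) * cmod (f (x - \<epsilon> *\<^sub>R z)) * gauss z)
         \<le> ennreal (gauss z / 2) * (ennreal ((cmod (f x))\<^sup>2) + ennreal ((cmod (f (x - \<epsilon> *\<^sub>R z)))\<^sup>2))"
        by (subst ennreal_plus[symmetric], simp, simp, subst ennreal_mult[symmetric]) (auto simp: gauss_pos less_imp_le intro!: ennreal_leI)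
    qed auto
    also have "\<dots> = ennreal ?c * (\<integral>\<^sup>+z. (\<integral>\<^sup>+x. ennreal (gauss z / 2) * (ennreal ((cmod (f x))\<^sup>2) + ennreal ((cmod (f (x - \<epsilon> *\<^sub>R z)))\<^sup>2)) \<partial>lborel) \<partial>lborel)"
      by (subst lborel_pair.Fubini') auto
    also have "\<dots> = ennreal ?c * (\<integral>\<^sup>+z. ennreal (gauss (z::'a) / 2) * (2 * sqint f) \<partial>lborel)"
    proof (intro arg_cong2[where f = "(*)"] nn_integral_cong refl)
      fix z :: 'a
      have "(\<integral>\<^sup>+x. ennreal ((cmod (f (x - \<epsilon> *\<^sub>R z)))\<^sup>2) \<partial>lborel) = sqint f"
        unfolding sqint_def using nn_integral_affine[of "\<lambda>x. ennreal ((cmod (f x))\<^sup>2)" 1 "- \<epsilon> *\<^sub>R z"]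
        by (simp add: add.commute)
      then show "(\<integral>\<^sup>+x. ennreal (gauss z / 2) * (ennreal ((cmod (f x))\<^sup>2) + ennreal ((cmod (f (x - \<epsilon> *\<^sub>R z)))\<^sup>2)) \<partial>lborel)
         = ennreal (gauss z / 2) * (2 * sqint f)"
        by (subst nn_integral_cmult, simp, subst nn_integral_add) (auto simp: sqint_def mult_2)
    qed
    also have "\<dots> = ennreal ?c * ((\<integral>\<^sup>+z. ennreal (gauss (z::'a)) \<partial>lborel) * sqint f)"
    proof -
      have "ennreal (gauss z / 2) * (2 * sqint f) = ennreal (gauss z) * sqint f" for z :: 'a
      proof -
        have "ennreal (gauss z) = ennreal (gauss z / 2 * 2)" by simp
        also have "\<dots> = ennreal (gauss z / 2) * 2"
          using gauss_pos[of z] by (subst ennreal_mult) auto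
        finally show ?thesis by (simp add: mult.assoc)
      qed
      then show ?thesis by (simp add: nn_integral_multc)
    qed
    also have "\<dots> = ennreal ((2 * pi) ^ DIM('a)) * sqint f"
      unfolding gauss_nn_integral mult.assoc[symmetric] by (simp only: cc ennreal_mult[symmetric] zero_le_power real_sqrt_ge_zero mult_nonneg_nonneg pi_ge_zero zero_le_numeral)
    finally show ?thesis using order_trans by (auto intro: ennreal_leI)
  qed
  define e where "e k = 1 / real (Suc k)" for k
  have e: "e k > 0" for k by (simp add: e_def)
  have e0: "e \<longlonglongrightarrow> 0" unfolding e_def by (rule LIMSEQ_Suc[OF lim_1_over_n])
  show ?thesis
  proof (rule sqint_Fatou[of "\<lambda>k \<xi>. complex_of_real (sqrt (gauss (e k *\<^sub>R \<xi>))) * fourier f \<xi>"])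
    have "(\<lambda>k. complex_of_real (sqrt (gauss (e k *\<^sub>R \<xi>))) * fourier f \<xi>) \<longlonglongrightarrow> complex_of_real (sqrt (gauss ((0::real) *\<^sub>R \<xi>))) * fourier f \<xi>" for \<xi>
      by (intro tendsto_intros e0 continuous_on_tendsto_compose[OF continuous_gauss]) auto
    then show "AE x in lborel. (\<lambda>k. complex_of_real (sqrt (gauss (e k *\<^sub>R x))) * fourier f x) \<longlonglongrightarrow> fourier f x"
      by (simp add: gauss_0)
    have "sqint (\<lambda>\<xi>. complex_of_real (sqrt (gauss (e k *\<^sub>R \<xi>))) * fourier f \<xi>) \<le> ennreal ((2 * pi) ^ DIM('a)) * sqint f" for k
      using damped[OF e[of k]] by (simp add: sqint_def norm_mult power_mult_distrib gauss_pos less_imp_le mult.commute)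
    then show "\<forall>\<^sub>F k in sequentially. sqint (\<lambda>\<xi>. complex_of_real (sqrt (gauss (e k *\<^sub>R \<xi>))) * fourier f \<xi>) \<le> ennreal ((2 * pi) ^ DIM('a)) * sqint f"
      by simp
  qed measurable
qed

text \<open>
  Gaussians of shrinking width are an approximate identity.
\<close>
lemma gaussian_mean_tendsto:
  fixes \<phi> :: "'a::euclidean_space \<Rightarrow> complex"
  assumes cont: "continuous_on UNIV \<phi>" and B: "\<And>x. cmod (\<phi> x) \<le> B" and e0: "e \<longlonglongrightarrow> 0"
  shows "(\<lambda>k. LINT z|lborel. cnj (\<phi> (x - e k *\<^sub>R z)) * complex_of_real (gauss z))
    \<longlonglongrightarrow> complex_of_real (sqrt (2 * pi) ^ DIM('a)) * cnj (\<phi> x)"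
proof -
  have [measurable]: "\<phi> \<in> borel_measurable borel"
    using cont by (rule borel_measurable_continuous_onI)
  have "(\<lambda>k. LINT z|lborel. cnj (\<phi> (x - e k *\<^sub>R z)) * complex_of_real (gauss z))
    \<longlonglongrightarrow> (LINT z|lborel. cnj (\<phi> x) * complex_of_real (gauss (z::'a)))"
  proof (rule integral_dominated_convergence)
    show "integrable lborel (\<lambda>z::'a. B * gauss z)"
      using gauss_integrable by (rule integrable_mult_right)
    have "(\<lambda>k. cnj (\<phi> (x - e k *\<^sub>R z)) * complex_of_real (gauss z))
        \<longlonglongrightarrow> cnj (\<phi> (x - 0 *\<^sub>R z)) * complex_of_real (gauss z)" for z
      by (intro tendsto_intros e0 continuous_on_tendsto_compose[OF cont]) auto
    then show "AE z in lborel. (\<lambda>k. cnj (\<phi> (x - e k *\<^sub>R z)) * complex_of_real (gauss z))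
        \<longlonglongrightarrow> cnj (\<phi> x) * complex_of_real (gauss z)"
      by simp
    show "AE z in lborel. norm (cnj (\<phi> (x - e k *\<^sub>R z)) * complex_of_real (gauss z)) \<le> B * gauss z" for k
      by (intro AE_I2) (auto simp: norm_mult abs_of_pos[OF gauss_pos] less_imp_le[OF gauss_pos] intro!: mult_right_mono B)
  qed measurable
  moreover have "(LINT z|lborel. cnj (\<phi> x) * complex_of_real (gauss (z::'a))) = complex_of_real (sqrt (2 * pi) ^ DIM('a)) * cnj (\<phi> x)"
    by (simp add: gauss_integral)
  ultimately show ?thesis by (simp only:)
qed

lemma damped_Parseval_tendsto:
  fixes f \<phi> :: "'a::euclidean_space \<Rightarrow> complex"
  assumes f: "integrable lborel f" and \<phi>: "integrable lborel \<phi>"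
    and cont: "continuous_on UNIV \<phi>" and B: "\<And>x. cmod (\<phi> x) \<le> B"
    and e: "\<And>k. e k > 0" and e0: "e \<longlonglongrightarrow> 0"
  shows "(\<lambda>k. LINT \<xi>|lborel. fourier f \<xi> * cnj (fourier \<phi> \<xi>) * complex_of_real (gauss (e k *\<^sub>R \<xi>)))
    \<longlonglongrightarrow> complex_of_real ((2 * pi) ^ DIM('a)) * (LINT x|lborel. f x * cnj (\<phi> x))"
proof -
  have [measurable]: "f \<in> borel_measurable borel" "\<phi> \<in> borel_measurable borel"
    using f \<phi> by auto
  let ?c = "sqrt (2 * pi) ^ DIM('a)"
  let ?I = "\<lambda>k x. LINT z|lborel. cnj (\<phi> (x - e k *\<^sub>R z)) * complex_of_real (gauss z)"
  have "(\<lambda>k. LINT x|lborel. f x * ?I k x) \<longlonglongrightarrow> (LINT x|lborel. f x * (complex_of_real ?c * cnj (\<phi> x)))"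
  proof (rule integral_dominated_convergence)
    show "integrable lborel (\<lambda>x. cmod (f x) * (B * ?c))"
      using f by simp
    show "AE x in lborel. (\<lambda>k. f x * ?I k x) \<longlonglongrightarrow> f x * (complex_of_real ?c * cnj (\<phi> x))"
      by (intro AE_I2 tendsto_intros gaussian_mean_tendsto[OF cont B e0])
    have "cmod (?I k x) \<le> B * ?c" for k x
    proof -
      have "cmod (?I k x) \<le> (LINT z|lborel. B * gauss (z::'a))"
      proof (rule Bochner_Integration.integral_norm_bound_integral)
        show "integrable lborel (\<lambda>z::'a. B * gauss z)"
          using gauss_integrable by (rule integrable_mult_right)
        show "norm (cnj (\<phi> (x - e k *\<^sub>R z)) * complex_of_real (gauss z)) \<le> B * gauss z" for z
          by (auto simp: norm_mult abs_of_pos[OF gauss_pos] less_imp_le[OF gauss_pos] intro!: mult_right_mono B)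
        then show "integrable lborel (\<lambda>z. cnj (\<phi> (x - e k *\<^sub>R z)) * complex_of_real (gauss z))"
          by (intro Bochner_Integration.integrable_bound[OF \<open>integrable lborel (\<lambda>z::'a. B * gauss z)\<close>])
             (auto intro!: AE_I2 abs_ge_self[THEN order_trans[rotated]])
      qed
      then show ?thesis by (simp add: gauss_integral)
    qed
    then show "AE x in lborel. norm (f x * ?I k x) \<le> cmod (f x) * (B * ?c)" for k
      by (intro AE_I2) (auto simp: norm_mult intro!: mult_left_mono)
  qed measurable
  from tendsto_mult_left[OF this, of "complex_of_real ?c"]
  have "(\<lambda>k. complex_of_real ?c * (LINT x|lborel. f x * ?I k x)) \<longlonglongrightarrow> complex_of_real ?c * (LINT x|lborel. f x * (complex_of_real ?c * cnj (\<phi> x)))" .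
  also have "(LINT x|lborel. f x * (complex_of_real ?c * cnj (\<phi> x))) = complex_of_real ?c * (LINT x|lborel. f x * cnj (\<phi> x))"
    by (subst integral_mult_right_zero[symmetric]) (simp add: mult_ac)
  also have "complex_of_real ?c * (complex_of_real ?c * (LINT x|lborel. f x * cnj (\<phi> x))) = complex_of_real ((2 * pi) ^ DIM('a)) * (LINT x|lborel. f x * cnj (\<phi> x))"
    unfolding mult.assoc[symmetric] of_real_mult[symmetric] sqrt_2pi_power ..
  finally show ?thesis
    unfolding damped_Parseval[OF f \<phi> e] .
qed

lemma fourier_in_L2: "integrable lborel f \<Longrightarrow> f \<in> L2 \<Longrightarrow> fourier f \<in> L2"
  using fourier_Bessel[of f] by (auto simp: L2_iff_sqint ennreal_mult_less_top intro: order.strict_trans1)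

text \<open>
  The right-hand side of the damped identity converges because one factor is bounded and continuous, the
  left-hand side because both transforms are square integrable by Bessel's inequality.
\<close>
lemma Parseval_L1_L2:
  fixes f \<phi> :: "'a::euclidean_space \<Rightarrow> complex"
  assumes f: "integrable lborel f" "f \<in> L2" and \<phi>: "integrable lborel \<phi>" "\<phi> \<in> L2"
    and cont: "continuous_on UNIV \<phi>" and B: "\<And>x. cmod (\<phi> x) \<le> B"
  shows "(LINT \<xi>|lborel. fourier f \<xi> * cnj (fourier \<phi> \<xi>)) = complex_of_real ((2 * pi) ^ DIM('a)) * (LINT x|lborel. f x * cnj (\<phi> x))"
proof -
  have [measurable]: "f \<in> borel_measurable borel" "\<phi> \<in> borel_measurable borel"
    using f \<phi> by auto
  define e where "e k = 1 / real (Suc k)" for k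
  have e: "e k > 0" for k by (simp add: e_def)
  have e0: "e \<longlonglongrightarrow> 0" unfolding e_def by (rule LIMSEQ_Suc[OF lim_1_over_n])
  have "(\<lambda>\<xi>. cnj (fourier \<phi> \<xi>)) \<in> L2"
    by (intro L2_cnj fourier_in_L2 \<phi>)
  then have int: "integrable lborel (\<lambda>\<xi>. fourier f \<xi> * cnj (fourier \<phi> \<xi>))"
    by (intro L2_mult_integrable fourier_in_L2 f)
  have "(\<lambda>k. LINT \<xi>|lborel. fourier f \<xi> * cnj (fourier \<phi> \<xi>) * complex_of_real (gauss (e k *\<^sub>R \<xi>)))
    \<longlonglongrightarrow> (LINT \<xi>|lborel. fourier f \<xi> * cnj (fourier \<phi> \<xi>))"
  proof (rule integral_dominated_convergence)
    show "integrable lborel (\<lambda>\<xi>. cmod (fourier f \<xi> * cnj (fourier \<phi> \<xi>)))"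
      using int by (rule integrable_norm)
    have "(\<lambda>k. fourier f \<xi> * cnj (fourier \<phi> \<xi>) * complex_of_real (gauss (e k *\<^sub>R \<xi>)))
        \<longlonglongrightarrow> fourier f \<xi> * cnj (fourier \<phi> \<xi>) * complex_of_real (gauss ((0::real) *\<^sub>R \<xi>))" for \<xi>
      by (intro tendsto_intros e0 continuous_on_tendsto_compose[OF continuous_gauss]) auto
    then show "AE \<xi> in lborel. (\<lambda>k. fourier f \<xi> * cnj (fourier \<phi> \<xi>) * complex_of_real (gauss (e k *\<^sub>R \<xi>)))
        \<longlonglongrightarrow> fourier f \<xi> * cnj (fourier \<phi> \<xi>)"
      by (simp add: gauss_0)
    show "AE \<xi> in lborel. norm (fourier f \<xi> * cnj (fourier \<phi> \<xi>) * complex_of_real (gauss (e k *\<^sub>R \<xi>)))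
        \<le> cmod (fourier f \<xi> * cnj (fourier \<phi> \<xi>))" for k
      by (intro AE_I2) (simp add: norm_mult abs_of_pos[OF gauss_pos] gauss_le_1 mult_left_le)
  qed measurable
  from LIMSEQ_unique[OF this damped_Parseval_tendsto[OF f(1) \<phi>(1) cont B e e0]] show ?thesis .
qed

text \<open>
  Boxes form an intersection-stable generator of the Borel sets, so the integral vanishes over every
  Borel set (Dynkin).
\<close>
lemma box_integrals_zero_AE:
  fixes f :: "'a::euclidean_space \<Rightarrow> complex"
  assumes f: "integrable lborel f" and box: "\<And>a b. (LINT x:box a b|lborel. f x) = 0"
    and UNIV: "(LINT x|lborel. f x) = 0"
  shows "AE x in lborel. f x = 0"
proof (rule sigma_finite_measure.density_zero[OF sigma_finite_lborel f])
  fix A :: "'a set" assume "A \<in> sets lborel"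
  have si: "set_integrable lborel A f" if "A \<in> sets borel" for A
    unfolding set_integrable_def using f that by (intro integrable_mult_indicator) auto
  have "Int_stable (range (\<lambda>(a, b). box a b :: 'a set))"
    by (auto simp: Int_stable_def box_Int_box)
  moreover have "range (\<lambda>(a, b). box a b :: 'a set) \<subseteq> Pow UNIV" by auto
  moreover have "A \<in> sigma_sets UNIV (range (\<lambda>(a, b). box a b))"
    using \<open>A \<in> sets lborel\<close> by (simp add: borel_eq_box)
  ultimately show "set_lebesgue_integral lborel A f = 0"
  proof (induction rule: sigma_sets_induct_disjoint)
    case (basic A) then show ?case by (auto simp: box)
  next
    case empty then show ?case by (simp add: set_lebesgue_integral_def)
  next
    case (compl A)
    then have A[measurable]: "A \<in> sets borel" by (simp add: borel_eq_box)
    have "(LINT x:A \<union> (UNIV - A)|lborel. f x) = (LINT x:A|lborel. f x) + (LINT x:(UNIV - A)|lborel. f x)"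
      by (intro set_integral_Un si) auto
    then show ?case using compl.IH UNIV by (simp add: set_lebesgue_integral_def)
  next
    case (union A)
    then have A: "A i \<in> sets borel" for i by (auto simp: borel_eq_box)
    have "(LINT x:(\<Union>i. A i)|lborel. f x) = (\<Sum>i. (LINT x:(A i)|lborel. f x))"
      using A union by (intro lebesgue_integral_countable_add si) (auto simp: disjoint_family_on_def)
    then show ?case by (simp add: union.IH)
  qed
qed

text \<open>
  By the damped Parseval identity such a function integrates to 0 against every bounded continuous
  integrable function; truncated multiples of the distance to the complement of a box approximate the
  indicator of the box from below.
\<close>
lemma fourier_injective:
  fixes f :: "'a::euclidean_space \<Rightarrow> complex"
  assumes f: "integrable lborel f" and zero: "\<And>\<xi>. fourier f \<xi> = 0"
  shows "AE x in lborel. f x = 0"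
proof (rule box_integrals_zero_AE[OF f])
  have [measurable]: "f \<in> borel_measurable borel" using f by auto
  show "(LINT x|lborel. f x) = 0"
    using zero[of 0] by (simp add: fourier_def)
  define e where "e k = 1 / real (Suc k)" for k
  have e: "e k > 0" for k by (simp add: e_def)
  have e0: "e \<longlonglongrightarrow> 0" unfolding e_def by (rule LIMSEQ_Suc[OF lim_1_over_n])
  have test: "(LINT x|lborel. f x * cnj (\<phi> x)) = 0"
    if "integrable lborel \<phi>" "continuous_on UNIV \<phi>" "\<And>x. cmod (\<phi> x) \<le> 1" for \<phi>
    using damped_Parseval_tendsto[OF f that e e0] by (simp add: zero LIMSEQ_const_iff)
  fix a b :: 'a
  show "(LINT x:box a b|lborel. f x) = 0"
  proof (cases "box a b = {}")
    case False
    define \<psi> where "\<psi> k x = min 1 (real k * infdist x (- box a b))" for k x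
    have cont: "continuous_on UNIV (\<psi> k)" for k
      unfolding \<psi>_def by (intro continuous_intros)
    then have [measurable]: "\<psi> k \<in> borel_measurable borel" for k
      by (rule borel_measurable_continuous_onI)
    have \<psi>: "0 \<le> \<psi> k x" "\<psi> k x \<le> 1" for k x by (auto simp: \<psi>_def infdist_nonneg)
    have ne: "- box a b \<noteq> {}" using bounded_box[of a b] not_bounded_UNIV by (metis Compl_empty_eq double_complement)
    have \<psi>0: "\<psi> k x = 0" if "x \<notin> box a b" for k x
      using that by (simp add: \<psi>_def)
    have \<psi>1: "(\<lambda>k. \<psi> k x) \<longlonglongrightarrow> 1" if "x \<in> box a b" for x
    proof -
      have "infdist x (- box a b) > 0"
        using that ne by (intro infdist_pos_not_in_closed) auto
      then obtain N where "real N * infdist x (- box a b) \<ge> 1"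
        using reals_Archimedean3 by (metis less_imp_le)
      then have "\<psi> k x = 1" if "k \<ge> N" for k
        using that mult_right_mono[of "real N" "real k" "infdist x (- box a b)"]
        by (auto simp: \<psi>_def min_def infdist_nonneg)
      then show ?thesis by (intro tendsto_eventually) (auto simp: eventually_sequentially)
    qed
    have "(\<lambda>k. LINT x|lborel. f x * cnj (complex_of_real (\<psi> k x))) \<longlonglongrightarrow> (LINT x|lborel. indicator (box a b) x *\<^sub>R f x)"
    proof (rule integral_dominated_convergence)
      show "integrable lborel (\<lambda>x. cmod (f x))" using f by simp
      have "(\<lambda>k. f x * cnj (complex_of_real (\<psi> k x))) \<longlonglongrightarrow> indicator (box a b) x *\<^sub>R f x" for x
      proof (cases "x \<in> box a b")
        case True
        have "(\<lambda>k. f x * cnj (complex_of_real (\<psi> k x))) \<longlonglongrightarrow> f x * cnj (complex_of_real 1)"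
          by (intro tendsto_intros \<psi>1 True)
        with True show ?thesis by simp
      qed (simp add: \<psi>0)
      then show "AE x in lborel. (\<lambda>k. f x * cnj (complex_of_real (\<psi> k x))) \<longlonglongrightarrow> indicator (box a b) x *\<^sub>R f x"
        by simp
      show "AE x in lborel. norm (f x * cnj (complex_of_real (\<psi> k x))) \<le> cmod (f x)" for k
        by (intro AE_I2) (use \<psi> in \<open>auto simp: norm_mult mult_left_le\<close>)
    qed measurable
    moreover have "(LINT x|lborel. f x * cnj (complex_of_real (\<psi> k x))) = 0" for k
    proof (rule test)
      have "integrable lborel (indicat_real (box a b))"
        by (intro integrable_real_indicator) (use emeasure_lborel_box_finite in \<open>auto simp del: infinity_ennreal_def\<close>)
      then show "integrable lborel (\<lambda>x. complex_of_real (\<psi> k x))"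
        by (rule Bochner_Integration.integrable_bound)
           (auto intro!: AE_I2 simp: indicator_def \<psi>0 \<psi>(2) abs_of_nonneg[OF \<psi>(1)])
      show "continuous_on UNIV (\<lambda>x. complex_of_real (\<psi> k x))"
        by (intro continuous_intros cont)
      show "cmod (complex_of_real (\<psi> k x)) \<le> 1" for x using \<psi>[of k x] by simp
    qed
    ultimately show ?thesis by (simp add: set_lebesgue_integral_def LIMSEQ_const_iff)
  qed (simp add: set_lebesgue_integral_def)
qed

section \<open>Fourier transform on L2\<close>

text \<open>
  The truncations in the definition of \<open>fourier_L2\<close>.
\<close>
definition truncate :: "nat \<Rightarrow> ('a::euclidean_space \<Rightarrow> complex) \<Rightarrow> 'a \<Rightarrow> complex" where
  "truncate R f x = indicat_real (cball 0 (real R)) x *\<^sub>R f x"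

lemma truncate_measurable[measurable]:
  fixes f :: "'a::euclidean_space \<Rightarrow> complex"
  shows "f \<in> borel_measurable borel \<Longrightarrow> truncate R f \<in> borel_measurable borel"
proof -
  have [measurable]: "cball (0::'a) (real R) \<in> sets borel" by auto
  show "f \<in> borel_measurable borel \<Longrightarrow> truncate R f \<in> borel_measurable borel"
    unfolding truncate_def[abs_def] by measurable
qed

lemma truncate_L2: "f \<in> L2 \<Longrightarrow> truncate R f \<in> L2"
  by (rule L2_bound[of f]) (auto simp: truncate_def indicator_def)

lemma truncate_integrable:
  fixes f :: "'a::euclidean_space \<Rightarrow> complex"
  assumes f: "f \<in> L2"
  shows "integrable lborel (truncate R f)"
  using L2_mult_integrable(1)[OF cball_indicator_L2 f]
  by (simp add: truncate_def[abs_def] scaleR_conv_of_real)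

lemma truncate_tendsto:
  fixes f :: "'a::euclidean_space \<Rightarrow> complex"
  assumes f: "f \<in> L2"
  shows "(\<lambda>R. sqint (\<lambda>x. truncate R f x - f x)) \<longlonglongrightarrow> 0"
proof -
  have [measurable]: "f \<in> borel_measurable borel" using f by auto
  have "(\<lambda>R. \<integral>\<^sup>+x. ennreal ((cmod (truncate R f x - f x))\<^sup>2) \<partial>lborel) \<longlonglongrightarrow> (\<integral>\<^sup>+(x::'a). 0 \<partial>lborel)"
  proof (rule nn_integral_dominated_convergence)
    show "(\<integral>\<^sup>+x. ennreal ((cmod (f x))\<^sup>2) \<partial>lborel) < \<infinity>"
      using f by (simp add: L2_iff_sqint sqint_def)
    show "AE x in lborel. ennreal ((cmod (truncate R f x - f x))\<^sup>2) \<le> ennreal ((cmod (f x))\<^sup>2)" for R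
      by (intro AE_I2) (auto simp: truncate_def indicator_def)
    have "(\<lambda>R. ennreal ((cmod (truncate R f x - f x))\<^sup>2)) \<longlonglongrightarrow> 0" for x
    proof (rule tendsto_eventually)
      obtain N :: nat where N: "norm x \<le> real N" using real_arch_simple by blast
      have "truncate R f x = f x" if "R \<ge> N" for R
        using that N by (auto simp: truncate_def)
      then show "\<forall>\<^sub>F R in sequentially. ennreal ((cmod (truncate R f x - f x))\<^sup>2) = 0"
        by (auto simp: eventually_sequentially intro!: exI[of _ N])
    qed
    then show "AE x in lborel. (\<lambda>R. ennreal ((cmod (truncate R f x - f x))\<^sup>2)) \<longlonglongrightarrow> 0" by simp
  qed measurable
  then show ?thesis by (simp add: sqint_def)
qed

text \<open>
  The truncations converge in \<open>L2\<close>; by Bessel's inequality their transforms form a Cauchy sequence there,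
  which converges by completeness.
\<close>
lemma fourier_L2_limit_exists:
  fixes f :: "'a::euclidean_space \<Rightarrow> complex"
  assumes f: "f \<in> L2"
  shows "\<exists>g. g \<in> L2 \<and> (\<lambda>R. sqint (\<lambda>\<xi>. fourier (truncate R f) \<xi> - g \<xi>)) \<longlonglongrightarrow> 0"
proof -
  have [measurable]: "f \<in> borel_measurable borel" using f by auto
  let ?C = "ennreal ((2 * pi) ^ DIM('a))"
  let ?d = "\<lambda>R. sqint (\<lambda>x. truncate R f x - f x)"
  have le: "sqint (\<lambda>\<xi>. fourier (truncate m f) \<xi> - fourier (truncate k f) \<xi>) \<le> ?C * (2 * ?d m + 2 * ?d k)" for m k
  proof -
    have "sqint (\<lambda>\<xi>. fourier (truncate m f) \<xi> - fourier (truncate k f) \<xi>)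
      = sqint (fourier (\<lambda>x. truncate m f x - truncate k f x))"
      by (intro arg_cong[where f = sqint] ext) (simp add: fourier_diff truncate_integrable f)
    also have "\<dots> \<le> ?C * sqint (\<lambda>x. truncate m f x - truncate k f x)"
      using f by (intro fourier_Bessel Bochner_Integration.integrable_diff truncate_integrable)
    also have "\<dots> \<le> ?C * (2 * ?d m + 2 * ?d k)"
      using sqint_diff_le[of "\<lambda>x. truncate m f x - f x" "\<lambda>x. truncate k f x - f x"]
      by (intro mult_left_mono) auto
    finally show ?thesis .
  qed
  obtain g where g[measurable]: "g \<in> borel_measurable borel"
    and lim: "(\<lambda>R. sqint (\<lambda>\<xi>. fourier (truncate R f) \<xi> - g \<xi>)) \<longlonglongrightarrow> 0"
  proof (rule sqint_complete[of "\<lambda>R. fourier (truncate R f)"])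
    fix e :: real assume "0 < e"
    have "(\<lambda>R. ?C * (2 * ?d R)) \<longlonglongrightarrow> ?C * (2 * 0)"
      using truncate_tendsto[OF f] by (intro ennreal_tendsto_cmult) auto
    then have "\<forall>\<^sub>F R in sequentially. ?C * (2 * ?d R) < ennreal (e / 2)"
      using \<open>0 < e\<close> by (intro order_tendstoD(2)) auto
    then obtain N where N: "\<And>R. R \<ge> N \<Longrightarrow> ?C * (2 * ?d R) < ennreal (e / 2)"
      by (auto simp: eventually_sequentially)
    have "sqint (\<lambda>\<xi>. fourier (truncate m f) \<xi> - fourier (truncate k f) \<xi>) \<le> ennreal e" if "m \<ge> N" "k \<ge> N" for m k
    proof -
      have "?C * (2 * ?d m + 2 * ?d k) \<le> ennreal (e / 2) + ennreal (e / 2)"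
        unfolding distrib_left using that by (intro add_mono less_imp_le[OF N])
      also have "\<dots> = ennreal e" using \<open>0 < e\<close> by (subst ennreal_plus[symmetric]) auto
      finally show ?thesis using le[of m k] by (rule order_trans[rotated])
    qed
    then show "\<exists>N. \<forall>m\<ge>N. \<forall>k\<ge>N. sqint (\<lambda>\<xi>. fourier (truncate m f) \<xi> - fourier (truncate k f) \<xi>) \<le> ennreal e"
      by blast
  qed measurable
  have "\<forall>\<^sub>F R in sequentially. sqint (\<lambda>\<xi>. fourier (truncate R f) \<xi> - g \<xi>) < 1"
    using lim by (rule order_tendstoD) auto
  then obtain R where R: "sqint (\<lambda>\<xi>. fourier (truncate R f) \<xi> - g \<xi>) < 1"
    by (auto simp: eventually_sequentially)
  have "(\<lambda>\<xi>. fourier (truncate R f) \<xi> - g \<xi>) \<in> L2"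
    using R by (auto simp: L2_iff_sqint intro: order.strict_trans)
  from L2_diff[OF fourier_in_L2[OF truncate_integrable[OF f, of R] truncate_L2[OF f]] this]
  have "g \<in> L2" by simp
  with lim show ?thesis by blast
qed

lemma fourier_L2_limit:
  fixes f :: "'a::euclidean_space \<Rightarrow> complex"
  assumes f: "f \<in> L2"
  shows "fourier_L2 f \<in> L2" "(\<lambda>R. sqint (\<lambda>\<xi>. fourier (truncate R f) \<xi> - fourier_L2 f \<xi>)) \<longlonglongrightarrow> 0"
  using someI_ex[OF fourier_L2_limit_exists[OF f]]
  unfolding fourier_L2_def sqint_def truncate_def[abs_def] by auto

lemma fourier_L2_unique:
  assumes "f \<in> L2" "g \<in> borel_measurable borel"
    and "(\<lambda>R. sqint (\<lambda>\<xi>. fourier (truncate R f) \<xi> - g \<xi>)) \<longlonglongrightarrow> 0"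
  shows "AE \<xi> in lborel. fourier_L2 f \<xi> = g \<xi>"
  by (rule sqint_limit_unique[OF _ _ _ fourier_L2_limit(2)[OF assms(1)] assms(3)])
     (use assms fourier_L2_limit(1)[OF assms(1)] in measurable)

lemma fourier_L2_diff:
  fixes f g :: "'a::euclidean_space \<Rightarrow> complex"
  assumes f: "f \<in> L2" and g: "g \<in> L2"
  shows "AE \<xi> in lborel. fourier_L2 (\<lambda>x. f x - g x) \<xi> = fourier_L2 f \<xi> - fourier_L2 g \<xi>"
proof (rule fourier_L2_unique[OF L2_diff[OF f g]])
  have [measurable]: "f \<in> borel_measurable borel" "g \<in> borel_measurable borel"
    "fourier_L2 f \<in> borel_measurable borel" "fourier_L2 g \<in> borel_measurable borel"
    by (simp_all add: f g fourier_L2_limit(1) L2_measurable)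
  show "(\<lambda>\<xi>. fourier_L2 f \<xi> - fourier_L2 g \<xi>) \<in> borel_measurable borel" by measurable
  have tr: "fourier (truncate R (\<lambda>x. f x - g x)) \<xi> = fourier (truncate R f) \<xi> - fourier (truncate R g) \<xi>" for R \<xi>
    using fourier_diff[OF truncate_integrable[OF f] truncate_integrable[OF g], of R R \<xi>]
    by (simp add: truncate_def[abs_def] scaleR_diff_right)
  have "(\<lambda>R. 2 * sqint (\<lambda>\<xi>. fourier (truncate R f) \<xi> - fourier_L2 f \<xi>)
     + 2 * sqint (\<lambda>\<xi>. fourier (truncate R g) \<xi> - fourier_L2 g \<xi>)) \<longlonglongrightarrow> 2 * 0 + 2 * 0"
    using fourier_L2_limit(2)[OF f] fourier_L2_limit(2)[OF g] by (intro tendsto_add ennreal_tendsto_cmult) auto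
  then have lim: "(\<lambda>R. 2 * sqint (\<lambda>\<xi>. fourier (truncate R f) \<xi> - fourier_L2 f \<xi>)
     + 2 * sqint (\<lambda>\<xi>. fourier (truncate R g) \<xi> - fourier_L2 g \<xi>)) \<longlonglongrightarrow> 0" by simp
  show "(\<lambda>R. sqint (\<lambda>\<xi>. fourier (truncate R (\<lambda>x. f x - g x)) \<xi> - (fourier_L2 f \<xi> - fourier_L2 g \<xi>))) \<longlonglongrightarrow> 0"
  proof (rule tendsto_sandwich[OF _ _ tendsto_const lim])
    show "\<forall>\<^sub>F R in sequentially. sqint (\<lambda>\<xi>. fourier (truncate R (\<lambda>x. f x - g x)) \<xi> - (fourier_L2 f \<xi> - fourier_L2 g \<xi>))
      \<le> 2 * sqint (\<lambda>\<xi>. fourier (truncate R f) \<xi> - fourier_L2 f \<xi>)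
     + 2 * sqint (\<lambda>\<xi>. fourier (truncate R g) \<xi> - fourier_L2 g \<xi>)"
    proof (intro always_eventually allI)
      fix R
      show "sqint (\<lambda>\<xi>. fourier (truncate R (\<lambda>x. f x - g x)) \<xi> - (fourier_L2 f \<xi> - fourier_L2 g \<xi>))
      \<le> 2 * sqint (\<lambda>\<xi>. fourier (truncate R f) \<xi> - fourier_L2 f \<xi>)
     + 2 * sqint (\<lambda>\<xi>. fourier (truncate R g) \<xi> - fourier_L2 g \<xi>)"
        using sqint_diff_le[of "\<lambda>\<xi>. fourier (truncate R f) \<xi> - fourier_L2 f \<xi>" "\<lambda>\<xi>. fourier (truncate R g) \<xi> - fourier_L2 g \<xi>"]
        unfolding tr by (simp add: algebra_simps)
    qed
  qed simp
qed

lemma fourier_L2_cmult: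
  fixes f :: "'a::euclidean_space \<Rightarrow> complex"
  assumes f: "f \<in> L2"
  shows "AE \<xi> in lborel. fourier_L2 (\<lambda>x. c * f x) \<xi> = c * fourier_L2 f \<xi>"
proof (rule fourier_L2_unique[OF L2_cmult[OF f]])
  have [measurable]: "f \<in> borel_measurable borel" "fourier_L2 f \<in> borel_measurable borel"
    by (simp_all add: f fourier_L2_limit(1) L2_measurable)
  show "(\<lambda>\<xi>. c * fourier_L2 f \<xi>) \<in> borel_measurable borel" by measurable
  have tr: "fourier (truncate R (\<lambda>x. c * f x)) \<xi> = c * fourier (truncate R f) \<xi>" for R \<xi>
    using fourier_cmult[of c "truncate R f" \<xi>] by (simp add: truncate_def[abs_def])
  have "(\<lambda>R. ennreal ((cmod c)\<^sup>2) * sqint (\<lambda>\<xi>. fourier (truncate R f) \<xi> - fourier_L2 f \<xi>)) \<longlonglongrightarrow> ennreal ((cmod c)\<^sup>2) * 0"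
    using fourier_L2_limit(2)[OF f] by (intro ennreal_tendsto_cmult) auto
  then show "(\<lambda>R. sqint (\<lambda>\<xi>. fourier (truncate R (\<lambda>x. c * f x)) \<xi> - c * fourier_L2 f \<xi>)) \<longlonglongrightarrow> 0"
    unfolding tr right_diff_distrib[symmetric] by (simp add: sqint_cmult)
qed

lemma fourier_L2_cong_AE:
  fixes f g :: "'a::euclidean_space \<Rightarrow> complex"
  assumes [measurable]: "f \<in> borel_measurable borel" "g \<in> borel_measurable borel" and "AE x in lborel. f x = g x"
  shows "fourier_L2 f = fourier_L2 g"
proof -
  have "fourier (truncate R f) = fourier (truncate R g)" for R
    using assms(3) by (intro fourier_cong_AE) (auto simp: truncate_def)
  then show ?thesis unfolding fourier_L2_def truncate_def[abs_def] by simp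
qed

lemma fourier_L2_eq_fourier:
  fixes f :: "'a::euclidean_space \<Rightarrow> complex"
  assumes int: "integrable lborel f" and f: "f \<in> L2"
  shows "AE \<xi> in lborel. fourier_L2 f \<xi> = fourier f \<xi>"
proof (rule fourier_L2_unique[OF f])
  have [measurable]: "f \<in> borel_measurable borel" using f by auto
  show "fourier f \<in> borel_measurable borel" by measurable
  have "(\<lambda>R. ennreal ((2 * pi) ^ DIM('a)) * sqint (\<lambda>x. truncate R f x - f x)) \<longlonglongrightarrow> ennreal ((2 * pi) ^ DIM('a)) * 0"
    using truncate_tendsto[OF f] by (intro ennreal_tendsto_cmult) auto
  then have lim: "(\<lambda>R. ennreal ((2 * pi) ^ DIM('a)) * sqint (\<lambda>x. truncate R f x - f x)) \<longlonglongrightarrow> 0" by simp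
  show "(\<lambda>R. sqint (\<lambda>\<xi>. fourier (truncate R f) \<xi> - fourier f \<xi>)) \<longlonglongrightarrow> 0"
  proof (rule tendsto_sandwich[OF _ _ tendsto_const lim])
    show "\<forall>\<^sub>F R in sequentially. sqint (\<lambda>\<xi>. fourier (truncate R f) \<xi> - fourier f \<xi>)
      \<le> ennreal ((2 * pi) ^ DIM('a)) * sqint (\<lambda>x. truncate R f x - f x)"
      using fourier_Bessel[OF Bochner_Integration.integrable_diff[OF truncate_integrable[OF f] int]]
      unfolding fourier_diff[OF truncate_integrable[OF f] int, abs_def]
      by (intro always_eventually allI)
  qed simp
qed

lemma tendsto_L2_pairing:
  fixes F :: "nat \<Rightarrow> 'a::euclidean_space \<Rightarrow> complex"
  assumes F: "\<And>k. F k \<in> L2" and f: "f \<in> L2" and h: "h \<in> L2"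
    and lim: "(\<lambda>k. sqint (\<lambda>x. F k x - f x)) \<longlonglongrightarrow> 0"
  shows "(\<lambda>k. LINT x|lborel. F k x * h x) \<longlonglongrightarrow> (LINT x|lborel. f x * h x)"
proof -
  have d: "(\<lambda>x. F k x - f x) \<in> L2" for k by (intro L2_diff F f)
  have "(\<lambda>k. ennreal ((L2_norm (\<lambda>x. F k x - f x))\<^sup>2)) \<longlonglongrightarrow> ennreal 0"
    using lim unfolding sqint_eq_L2_norm[OF d] by simp
  then have "(\<lambda>k. (L2_norm (\<lambda>x. F k x - f x))\<^sup>2) \<longlonglongrightarrow> 0"
    by (subst (asm) tendsto_ennreal_iff) auto
  from tendsto_real_sqrt[OF this] have "(\<lambda>k. L2_norm (\<lambda>x. F k x - f x)) \<longlonglongrightarrow> 0"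
    by (simp add: L2_norm_nonneg)
  from tendsto_mult_left_zero[OF this] have lim0: "(\<lambda>k. L2_norm (\<lambda>x. F k x - f x) * L2_norm h) \<longlonglongrightarrow> 0" .
  have "(\<lambda>k. (LINT x|lborel. F k x * h x) - (LINT x|lborel. f x * h x)) \<longlonglongrightarrow> 0"
  proof (rule Lim_null_comparison[OF always_eventually lim0], intro allI)
    fix k
    have "(LINT x|lborel. F k x * h x) - (LINT x|lborel. f x * h x) = (LINT x|lborel. (F k x - f x) * h x)"
      by (simp add: left_diff_distrib Bochner_Integration.integral_diff L2_mult_integrable F f h)
    then show "norm ((LINT x|lborel. F k x * h x) - (LINT x|lborel. f x * h x)) \<le> L2_norm (\<lambda>x. F k x - f x) * L2_norm h"
      using L2_mult_integrable(2)[OF d[of k] h] by simp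
  qed
  then show ?thesis by (simp add: LIM_zero_iff)
qed

lemma Parseval_fourier_L2:
  fixes f \<phi> :: "'a::euclidean_space \<Rightarrow> complex"
  assumes f: "f \<in> L2" and \<phi>: "integrable lborel \<phi>" "\<phi> \<in> L2"
    and cont: "continuous_on UNIV \<phi>" and B: "\<And>x. cmod (\<phi> x) \<le> B"
  shows "(LINT \<xi>|lborel. fourier_L2 f \<xi> * cnj (fourier \<phi> \<xi>)) = complex_of_real ((2 * pi) ^ DIM('a)) * (LINT x|lborel. f x * cnj (\<phi> x))"
proof -
  have "(\<lambda>R. LINT \<xi>|lborel. fourier (truncate R f) \<xi> * cnj (fourier \<phi> \<xi>)) \<longlonglongrightarrow> (LINT \<xi>|lborel. fourier_L2 f \<xi> * cnj (fourier \<phi> \<xi>))"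
    by (intro tendsto_L2_pairing fourier_in_L2 truncate_integrable truncate_L2 fourier_L2_limit f L2_cnj \<phi>)
  moreover have "(\<lambda>R. LINT \<xi>|lborel. fourier (truncate R f) \<xi> * cnj (fourier \<phi> \<xi>))
     \<longlonglongrightarrow> complex_of_real ((2 * pi) ^ DIM('a)) * (LINT x|lborel. f x * cnj (\<phi> x))"
    unfolding Parseval_L1_L2[OF truncate_integrable[OF f] truncate_L2[OF f] \<phi> cont B]
    by (intro tendsto_mult_left tendsto_L2_pairing truncate_L2 truncate_tendsto f L2_cnj \<phi>)
  ultimately show ?thesis by (rule LIMSEQ_unique)
qed

section \<open>Test functions\<close>

lemma partial_eq: "(f has_derivative f') (at x) \<Longrightarrow> partial b f x = f' b"
  unfolding partial_def by (metis frechet_derivative_at)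

lemma C_fun_Suc_imp: "C_fun (Suc k) f \<Longrightarrow> C_fun k f"
proof (induction k arbitrary: f)
  case 0
  then show ?case by (auto intro!: differentiable_imp_continuous_on simp: differentiable_on_def)
next
  case (Suc k)
  then show ?case by (metis C_fun.simps(2))
qed

lemma C_fun_const: "C_fun k (\<lambda>x. c)"
proof (induction k arbitrary: c)
  case (Suc k)
  have "partial b (\<lambda>x. c) = (\<lambda>x. 0)" for b :: 'a
    by (rule ext) (rule partial_eq[OF has_derivative_const])
  with Suc show ?case by simp
qed simp

lemma partial_add:
  assumes "f differentiable (at x)" "g differentiable (at x)"
  shows "partial b (\<lambda>x. f x + g x) x = partial b f x + partial b g x"
  using has_derivative_add[OF frechet_derivative_works[THEN iffD1, OF assms(1)] frechet_derivative_works[THEN iffD1, OF assms(2)]]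
  by (subst partial_eq) (auto simp: partial_def)

lemma C_fun_add: "C_fun k f \<Longrightarrow> C_fun k g \<Longrightarrow> C_fun k (\<lambda>x. f x + g x)"
proof (induction k arbitrary: f g)
  case (Suc k)
  then have "partial b (\<lambda>x. f x + g x) = (\<lambda>x. partial b f x + partial b g x)" for b
    by (intro ext partial_add) auto
  with Suc show ?case by auto
qed (auto intro: continuous_intros)

lemma partial_mult:
  assumes "f differentiable (at x)" "g differentiable (at x)"
  shows "partial b (\<lambda>x. f x * g x) x = f x * partial b g x + partial b f x * g x"
  using has_derivative_mult[OF frechet_derivative_works[THEN iffD1, OF assms(1)] frechet_derivative_works[THEN iffD1, OF assms(2)]]
  by (subst partial_eq) (auto simp: partial_def)

lemma C_fun_mult: "C_fun k f \<Longrightarrow> C_fun k g \<Longrightarrow> C_fun k (\<lambda>x. f x * g x)"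
proof (induction k arbitrary: f g)
  case (Suc k)
  then have "partial b (\<lambda>x. f x * g x) = (\<lambda>x. f x * partial b g x + partial b f x * g x)" for b
    by (intro ext partial_mult) auto
  moreover have "C_fun k f" "C_fun k g" using Suc.prems by (auto intro: C_fun_Suc_imp)
  ultimately show ?case using Suc by (auto intro!: C_fun_add)
qed (auto intro: continuous_intros)

lemma C_fun_inner: "C_fun k (\<lambda>x. complex_of_real (x \<bullet> v))"
proof (cases k)
  case (Suc j)
  have d: "((\<lambda>x. complex_of_real (x \<bullet> v)) has_derivative (\<lambda>h. complex_of_real (h \<bullet> v))) (at x)" for x
    by (auto intro!: derivative_eq_intros)
  have "partial b (\<lambda>x. complex_of_real (x \<bullet> v)) = (\<lambda>x. complex_of_real (b \<bullet> v))" for b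
    by (rule ext) (rule partial_eq[OF d])
  with Suc d show ?thesis by (auto simp: C_fun_const differentiable_def)
qed (auto intro!: continuous_intros)

text \<open>
  The partial derivatives of the composition are multiples of compositions with the same affine map.
\<close>
lemma C_fun_affine: "C_fun k f \<Longrightarrow> C_fun k (\<lambda>x. f (t + c *\<^sub>R x))"
proof (induction k arbitrary: f)
  case 0
  then show ?case by (auto intro!: continuous_on_compose2[of UNIV f] continuous_intros)
next
  case (Suc k)
  have d: "((\<lambda>x. f (t + c *\<^sub>R x)) has_derivative (\<lambda>h. frechet_derivative f (at (t + c *\<^sub>R x)) (c *\<^sub>R h))) (at x)" for x
  proof (rule has_derivative_compose[of "\<lambda>x. t + c *\<^sub>R x" "\<lambda>h. c *\<^sub>R h"])
    show "((\<lambda>x. t + c *\<^sub>R x) has_derivative (*\<^sub>R) c) (at x)"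
      by (auto intro!: derivative_eq_intros)
    show "(f has_derivative frechet_derivative f (at (t + c *\<^sub>R x))) (at (t + c *\<^sub>R x))"
      using Suc.prems by (auto simp: frechet_derivative_works[symmetric])
  qed
  have "partial b (\<lambda>x. f (t + c *\<^sub>R x)) = (\<lambda>x. complex_of_real c * partial b f (t + c *\<^sub>R x))" for b
  proof
    fix x
    have "linear (frechet_derivative f (at (t + c *\<^sub>R x)))"
      using Suc.prems by (auto intro: linear_frechet_derivative)
    then show "partial b (\<lambda>x. f (t + c *\<^sub>R x)) x = complex_of_real c * partial b f (t + c *\<^sub>R x)"
      unfolding partial_eq[OF d] by (simp add: partial_def linear_scale scaleR_conv_of_real)
  qed
  moreover have "C_fun k (\<lambda>x. complex_of_real c * partial b f (t + c *\<^sub>R x))" if "b \<in> Basis" for b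
    using that Suc by (intro C_fun_mult C_fun_const) auto
  ultimately show ?case using d by (auto simp: differentiable_def)
qed

lemma test_support:
  assumes "\<phi> \<in> test_functions"
  obtains R where "R > 0" "\<And>x. norm x > R \<Longrightarrow> \<phi> x = 0"
proof -
  have "bounded {x. \<phi> x \<noteq> 0}"
    using assms by (auto simp: test_functions_def compact_closure)
  then obtain B where B: "B > 0" "\<And>x. \<phi> x \<noteq> 0 \<Longrightarrow> norm x \<le> B"
    unfolding bounded_pos by auto
  then show thesis using that by force
qed

lemma test_functionsI:
  assumes "\<And>k. C_fun k \<phi>" "\<And>x. norm x > R \<Longrightarrow> \<phi> x = 0"
  shows "\<phi> \<in> test_functions"
proof -
  have "{x. \<phi> x \<noteq> 0} \<subseteq> cball 0 R" using assms(2) by (force simp: not_less)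
  then have "bounded {x. \<phi> x \<noteq> 0}" using bounded_cball bounded_subset by blast
  with assms(1) show ?thesis by (simp add: test_functions_def compact_closure)
qed

lemma test_C_fun: "\<phi> \<in> test_functions \<Longrightarrow> C_fun k \<phi>"
  by (simp add: test_functions_def)

lemma test_continuous: "\<phi> \<in> test_functions \<Longrightarrow> continuous_on UNIV \<phi>"
  using test_C_fun[of \<phi> 0] by simp

lemma test_differentiable: "\<phi> \<in> test_functions \<Longrightarrow> \<phi> differentiable (at x)"
  using test_C_fun[of \<phi> 1] by simp

lemma test_measurable: "\<phi> \<in> test_functions \<Longrightarrow> \<phi> \<in> borel_measurable borel"
  by (intro borel_measurable_continuous_onI test_continuous)

lemma test_bounded:
  assumes \<phi>: "\<phi> \<in> test_functions"
  obtains B where "B \<ge> 0" "\<And>x. cmod (\<phi> x) \<le> B"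
proof -
  obtain R where R: "R > 0" "\<And>x. norm x > R \<Longrightarrow> \<phi> x = 0" using test_support[OF \<phi>] by blast
  have "compact (\<phi> ` cball 0 R)"
    by (intro compact_continuous_image continuous_on_subset[OF test_continuous[OF \<phi>]]) auto
  then obtain B where B: "B > 0" "\<And>x. x \<in> cball 0 R \<Longrightarrow> cmod (\<phi> x) \<le> B"
    using compact_imp_bounded[of "\<phi> ` cball 0 R"] unfolding bounded_pos by auto
  have "cmod (\<phi> x) \<le> B" for x
    using B(2)[of x] R(2)[of x] B(1) by (cases "norm x > R") auto
  with B(1) show thesis by (intro that[of B]) auto
qed

lemma test_integrable_mult:
  fixes \<phi> :: "'a::euclidean_space \<Rightarrow> complex" and m :: "'a \<Rightarrow> real"
  assumes \<phi>: "\<phi> \<in> test_functions" and m: "continuous_on UNIV m"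
  shows "integrable lborel (\<lambda>x. m x *\<^sub>R \<phi> x)"
proof -
  have [measurable]: "\<phi> \<in> borel_measurable borel" "m \<in> borel_measurable borel"
    using \<phi> m by (auto intro: test_measurable borel_measurable_continuous_onI)
  obtain R where R: "R > 0" "\<And>x. norm x > R \<Longrightarrow> \<phi> x = 0" using test_support[OF \<phi>] by blast
  have "compact ((\<lambda>x. m x *\<^sub>R \<phi> x) ` cball 0 R)"
    by (intro compact_continuous_image continuous_intros continuous_on_subset[OF test_continuous[OF \<phi>]] continuous_on_subset[OF m]) auto
  then obtain B where B: "B > 0" "\<And>x. x \<in> cball 0 R \<Longrightarrow> cmod (m x *\<^sub>R \<phi> x) \<le> B"
    using compact_imp_bounded[of "(\<lambda>x. m x *\<^sub>R \<phi> x) ` cball 0 R"] unfolding bounded_pos by auto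
  have "integrable lborel (\<lambda>x. B * indicat_real (cball (0::'a) R) x)"
    by (intro integrable_mult_right integrable_cball_indicator)
  then show ?thesis
  proof (rule Bochner_Integration.integrable_bound)
    show "AE x in lborel. norm (m x *\<^sub>R \<phi> x) \<le> norm (B * indicat_real (cball 0 R) x)"
      using B R by (intro AE_I2) (auto simp: indicator_def not_le)
  qed measurable
qed

lemma test_integrable: "\<phi> \<in> test_functions \<Longrightarrow> integrable lborel \<phi>"
  using test_integrable_mult[of \<phi> "\<lambda>_. 1"] by simp

lemma test_L2:
  assumes \<phi>: "\<phi> \<in> test_functions" shows "\<phi> \<in> L2"
proof -
  have [measurable]: "\<phi> \<in> borel_measurable borel" using \<phi> by (rule test_measurable)
  obtain B where B: "B \<ge> 0" "\<And>x. cmod (\<phi> x) \<le> B" using test_bounded[OF \<phi>] by blast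
  have "integrable lborel (\<lambda>x. B * cmod (\<phi> x))"
    using test_integrable[OF \<phi>] by simp
  then have "integrable lborel (\<lambda>x. (cmod (\<phi> x))\<^sup>2)"
    by (rule Bochner_Integration.integrable_bound) (use B in \<open>auto intro!: AE_I2 mult_right_mono simp: power2_eq_square\<close>)
  then show ?thesis by (simp add: L2_def)
qed

text \<open>
  The function vanishes on the open set of points with norm above \<open>R\<close>, and so do its derivatives there.
\<close>
lemma partial_support:
  assumes R: "\<And>x. norm x > R \<Longrightarrow> \<phi> x = 0" and x: "norm x > R"
  shows "partial b \<phi> x = 0"
proof -
  have "open (- cball (0::'a) R)" by (simp add: open_Compl)
  moreover have "x \<in> - cball 0 R" using x by simp
  ultimately have "(\<phi> has_derivative (\<lambda>h. 0)) (at x)"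
    by (rule has_derivative_transform_within_open[OF has_derivative_const[of 0]]) (auto simp: R)
  then show ?thesis by (simp add: partial_eq)
qed

lemma test_partial:
  assumes \<phi>: "\<phi> \<in> test_functions" and b: "b \<in> Basis"
  shows "partial b \<phi> \<in> test_functions"
proof -
  obtain R where R: "\<And>x. norm x > R \<Longrightarrow> \<phi> x = 0" using test_support[OF \<phi>] by blast
  show ?thesis
    using test_C_fun[OF \<phi>, of "Suc _"] b by (intro test_functionsI[of _ R] partial_support R) auto
qed

lemma test_zero: "(\<lambda>x. 0) \<in> test_functions"
  by (rule test_functionsI[of _ 0]) (auto simp: C_fun_const)

lemma test_add:
  assumes f: "f \<in> test_functions" and g: "g \<in> test_functions"
  shows "(\<lambda>x. f x + g x) \<in> test_functions"
proof -
  obtain R where R: "\<And>x. norm x > R \<Longrightarrow> f x = 0" using test_support[OF f] by blast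
  obtain S where S: "\<And>x. norm x > S \<Longrightarrow> g x = 0" using test_support[OF g] by blast
  show ?thesis
    by (rule test_functionsI[OF C_fun_add[OF test_C_fun[OF f] test_C_fun[OF g]], of "max R S"]) (use R S in auto)
qed

lemma test_sum: "finite I \<Longrightarrow> (\<And>i. i \<in> I \<Longrightarrow> f i \<in> test_functions) \<Longrightarrow> (\<lambda>x. \<Sum>i\<in>I. f i x) \<in> test_functions"
  by (induction I rule: finite_induct) (auto simp: test_zero intro!: test_add)

lemma test_laplacian: "\<phi> \<in> test_functions \<Longrightarrow> laplacian \<phi> \<in> test_functions"
  unfolding laplacian_def[abs_def] by (intro test_sum test_partial finite_Basis)

lemma test_affine:
  fixes \<phi> :: "'a::euclidean_space \<Rightarrow> complex"
  assumes \<phi>: "\<phi> \<in> test_functions" and c: "c > 0"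
  shows "(\<lambda>x. \<phi> (t + c *\<^sub>R x)) \<in> test_functions"
proof -
  obtain R where R: "R > 0" "\<And>x. norm x > R \<Longrightarrow> \<phi> x = 0" using test_support[OF \<phi>] by blast
  have "norm (t + c *\<^sub>R x) > R" if "norm x > (R + norm t) / c" for x
  proof -
    have "c * norm x > R + norm t" using that c by (simp add: field_simps)
    moreover have "norm (c *\<^sub>R x) \<le> norm (t + c *\<^sub>R x) + norm t"
      using norm_triangle_ineq4[of "t + c *\<^sub>R x" t] by simp
    ultimately show ?thesis using c by simp
  qed
  then show ?thesis
    using R by (intro test_functionsI[OF C_fun_affine[OF test_C_fun[OF \<phi>]], of "(R + norm t) / c"]) blast
qed

lemma fourier_affine:
  fixes \<phi> :: "'a::euclidean_space \<Rightarrow> complex"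
  assumes [measurable]: "\<phi> \<in> borel_measurable borel" and c: "c > 0"
  shows "complex_of_real (c ^ DIM('a)) * fourier (\<lambda>x. \<phi> (t + c *\<^sub>R x)) \<xi>
    = exp (\<i> * complex_of_real (\<xi> \<bullet> t) / complex_of_real c) * fourier \<phi> (\<xi> /\<^sub>R c)"
proof -
  have arg: "(\<xi> /\<^sub>R c) \<bullet> (t + c *\<^sub>R x) = (\<xi> \<bullet> t) / c + \<xi> \<bullet> x" for x
    using c by (simp add: inner_right_distrib field_simps)
  have "fourier \<phi> (\<xi> /\<^sub>R c) = complex_of_real (\<bar>c\<bar> ^ DIM('a)) *
     (LINT x|lborel. \<phi> (t + c *\<^sub>R x) * exp (- \<i> * complex_of_real ((\<xi> /\<^sub>R c) \<bullet> (t + c *\<^sub>R x))))"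
    unfolding fourier_def using c by (intro integral_affine) auto
  also have "(LINT x|lborel. \<phi> (t + c *\<^sub>R x) * exp (- \<i> * complex_of_real ((\<xi> /\<^sub>R c) \<bullet> (t + c *\<^sub>R x))))
    = (LINT x|lborel. exp (- (\<i> * complex_of_real (\<xi> \<bullet> t) / complex_of_real c)) * (\<phi> (t + c *\<^sub>R x) * exp (- \<i> * complex_of_real (\<xi> \<bullet> x))))"
  proof (intro Bochner_Integration.integral_cong refl)
    fix x
    have "- \<i> * complex_of_real ((\<xi> /\<^sub>R c) \<bullet> (t + c *\<^sub>R x)) = - (\<i> * complex_of_real (\<xi> \<bullet> t) / complex_of_real c) + - \<i> * complex_of_real (\<xi> \<bullet> x)"
      unfolding arg by (simp add: distrib_left)
    then show "\<phi> (t + c *\<^sub>R x) * exp (- \<i> * complex_of_real ((\<xi> /\<^sub>R c) \<bullet> (t + c *\<^sub>R x)))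
      = exp (- (\<i> * complex_of_real (\<xi> \<bullet> t) / complex_of_real c)) * (\<phi> (t + c *\<^sub>R x) * exp (- \<i> * complex_of_real (\<xi> \<bullet> x)))"
      by (simp only: exp_add mult_ac)
  qed
  also have "\<dots> = exp (- (\<i> * complex_of_real (\<xi> \<bullet> t) / complex_of_real c)) * fourier (\<lambda>x. \<phi> (t + c *\<^sub>R x)) \<xi>"
    unfolding fourier_def by (rule integral_mult_right_zero)
  finally show ?thesis using c by (simp add: exp_minus field_simps)
qed

lemma line_difference_bound:
  fixes \<phi> :: "'a::euclidean_space \<Rightarrow> complex"
  assumes d: "\<And>x. \<phi> differentiable (at x)" and B: "\<And>x. cmod (partial b \<phi> x) \<le> B" and h: "h > 0"
  shows "cmod (\<phi> (x + h *\<^sub>R b) - \<phi> x) \<le> B * h"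
proof -
  have der: "((\<lambda>s. \<phi> (x + s *\<^sub>R b)) has_derivative (\<lambda>r. frechet_derivative \<phi> (at (x + s *\<^sub>R b)) (r *\<^sub>R b))) (at s)" for s
  proof (rule has_derivative_compose[of "\<lambda>s. x + s *\<^sub>R b" "\<lambda>r. r *\<^sub>R b"])
    show "((\<lambda>s. x + s *\<^sub>R b) has_derivative (\<lambda>r. r *\<^sub>R b)) (at s)"
      by (auto intro!: derivative_eq_intros)
    show "(\<phi> has_derivative frechet_derivative \<phi> (at (x + s *\<^sub>R b))) (at (x + s *\<^sub>R b))"
      using d by (simp add: frechet_derivative_works[symmetric])
  qed
  have "\<exists>s\<in>{0<..<h}. norm (\<phi> (x + h *\<^sub>R b) - \<phi> (x + 0 *\<^sub>R b)) \<le> norm (frechet_derivative \<phi> (at (x + s *\<^sub>R b)) ((h - 0) *\<^sub>R b))"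
    using h der by (intro mvt_general[where f = "\<lambda>s. \<phi> (x + s *\<^sub>R b)"])
      (auto intro!: continuous_at_imp_continuous_on has_derivative_continuous)
  then obtain s where "cmod (\<phi> (x + h *\<^sub>R b) - \<phi> x) \<le> cmod (frechet_derivative \<phi> (at (x + s *\<^sub>R b)) (h *\<^sub>R b))"
    by auto
  also have "\<dots> = h * cmod (partial b \<phi> (x + s *\<^sub>R b))"
    using linear_scale[OF linear_frechet_derivative[OF d]] h by (simp add: partial_def)
  also have "\<dots> \<le> h * B" using h B by (intro mult_left_mono) auto
  finally show ?thesis by (simp add: mult.commute)
qed

lemma partial_tendsto:
  fixes \<phi> :: "'a::euclidean_space \<Rightarrow> complex"
  assumes d: "\<phi> differentiable (at x)" and h: "\<And>k. h k > 0" "h \<longlonglongrightarrow> 0"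
  shows "(\<lambda>k. (\<phi> (x + h k *\<^sub>R b) - \<phi> x) /\<^sub>R h k) \<longlonglongrightarrow> partial b \<phi> x"
proof -
  have der: "((\<lambda>s. \<phi> (x + s *\<^sub>R b)) has_derivative (\<lambda>r. frechet_derivative \<phi> (at (x + 0 *\<^sub>R b)) (r *\<^sub>R b))) (at 0)"
  proof (rule has_derivative_compose[of "\<lambda>s. x + s *\<^sub>R b" "\<lambda>r. r *\<^sub>R b"])
    show "((\<lambda>s. x + s *\<^sub>R b) has_derivative (\<lambda>r. r *\<^sub>R b)) (at 0)"
      by (auto intro!: derivative_eq_intros)
    show "(\<phi> has_derivative frechet_derivative \<phi> (at (x + 0 *\<^sub>R b))) (at (x + 0 *\<^sub>R b))"
      using d by (simp add: frechet_derivative_works[symmetric])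
  qed
  then have "((\<lambda>s. \<phi> (x + s *\<^sub>R b)) has_derivative (\<lambda>r. r *\<^sub>R partial b \<phi> x)) (at 0)"
    using linear_scale[OF linear_frechet_derivative[OF d]] by (simp add: partial_def)
  then have lim: "((\<lambda>s. norm (\<phi> (x + s *\<^sub>R b) - \<phi> x - s *\<^sub>R partial b \<phi> x) / norm s) \<longlongrightarrow> 0) (at 0)"
    by (simp add: has_derivative_at)
  have "((\<lambda>s. norm ((\<phi> (x + s *\<^sub>R b) - \<phi> x) /\<^sub>R s - partial b \<phi> x)) \<longlongrightarrow> 0) (at 0)"
  proof (rule Lim_transform_eventually[OF lim])
    have "norm (\<phi> (x + s *\<^sub>R b) - \<phi> x - s *\<^sub>R partial b \<phi> x) / norm s
       = norm ((\<phi> (x + s *\<^sub>R b) - \<phi> x) /\<^sub>R s - partial b \<phi> x)" if "s \<noteq> 0" for s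
    proof -
      have "(\<phi> (x + s *\<^sub>R b) - \<phi> x) /\<^sub>R s - partial b \<phi> x = (\<phi> (x + s *\<^sub>R b) - \<phi> x - s *\<^sub>R partial b \<phi> x) /\<^sub>R s"
        using that by (simp add: scaleR_diff_right)
      then show ?thesis by (simp add: divide_inverse mult.commute)
    qed
    then show "\<forall>\<^sub>F s in at 0. norm (\<phi> (x + s *\<^sub>R b) - \<phi> x - s *\<^sub>R partial b \<phi> x) / norm s
       = norm ((\<phi> (x + s *\<^sub>R b) - \<phi> x) /\<^sub>R s - partial b \<phi> x)"
      by (auto simp: eventually_at_filter)
  qed
  then have "((\<lambda>s. (\<phi> (x + s *\<^sub>R b) - \<phi> x) /\<^sub>R s) \<longlongrightarrow> partial b \<phi> x) (at 0)"
    by (simp only: tendsto_norm_zero_iff LIM_zero_iff)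
  moreover have "filterlim h (at 0) sequentially"
    using h by (auto simp: filterlim_at intro!: always_eventually less_imp_neq[symmetric])
  ultimately show ?thesis by (rule filterlim_compose)
qed

text \<open>
  Integration by parts in the form of translation invariance: the transform of the difference quotient
  in direction \<open>b\<close> is exactly \<open>(exp (i h \<xi>\<bullet>b) - 1) / h\<close> times the transform of \<open>\<phi>\<close>, and the quotients
  converge dominatedly because \<open>\<phi>\<close> is Lipschitz in direction \<open>b\<close> and has bounded support.
\<close>
lemma fourier_partial:
  fixes \<phi> :: "'a::euclidean_space \<Rightarrow> complex"
  assumes \<phi>: "\<phi> \<in> test_functions" and b: "b \<in> Basis"
  shows "fourier (partial b \<phi>) \<xi> = \<i> * complex_of_real (\<xi> \<bullet> b) * fourier \<phi> \<xi>"
proof -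
  have [measurable]: "\<phi> \<in> borel_measurable borel" "partial b \<phi> \<in> borel_measurable borel"
    using \<phi> b by (auto intro: test_measurable test_partial)
  obtain R where R: "R > 0" "\<And>x. norm x > R \<Longrightarrow> \<phi> x = 0" using test_support[OF \<phi>] by blast
  obtain B where B: "B \<ge> 0" "\<And>x. cmod (partial b \<phi> x) \<le> B" using test_bounded[OF test_partial[OF \<phi> b]] by blast
  define h where "h k = 1 / real (Suc k)" for k
  have h: "h k > 0" "h k \<le> 1" for k by (auto simp: h_def)
  have h0: "h \<longlonglongrightarrow> 0" unfolding h_def by (rule LIMSEQ_Suc[OF lim_1_over_n])
  let ?D = "\<lambda>k x. (\<phi> (x + h k *\<^sub>R b) - \<phi> x) /\<^sub>R h k"
  let ?E = "\<lambda>x. exp (- \<i> * complex_of_real (\<xi> \<bullet> x))"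
  have "(\<lambda>k. LINT x|lborel. ?D k x * ?E x) \<longlonglongrightarrow> (LINT x|lborel. partial b \<phi> x * ?E x)"
  proof (rule integral_dominated_convergence)
    show "integrable lborel (\<lambda>x. B * indicat_real (cball (0::'a) (R + 1)) x)"
      by (intro integrable_mult_right integrable_cball_indicator)
    show "AE x in lborel. (\<lambda>k. ?D k x * ?E x) \<longlonglongrightarrow> partial b \<phi> x * ?E x"
      by (intro AE_I2 tendsto_mult_right partial_tendsto test_differentiable \<phi> h h0)
    have "cmod (?D k x) \<le> B * indicat_real (cball (0::'a) (R + 1)) x" for k x
    proof (cases "norm x \<le> R + 1")
      case True
      have "cmod (?D k x) = cmod (\<phi> (x + h k *\<^sub>R b) - \<phi> x) / h k"
        using h(1)[of k] by (simp add: norm_divide divide_inverse mult.commute)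
      also have "\<dots> \<le> B" using line_difference_bound[OF test_differentiable[OF \<phi>] B(2) h(1)] h(1)[of k]
        by (simp add: divide_le_eq)
      finally show ?thesis using True by simp
    next
      case False
      have "norm (h k *\<^sub>R b) \<le> 1" using h[of k] b by simp
      then have "norm (x + h k *\<^sub>R b) > R" using False norm_triangle_ineq4[of "x + h k *\<^sub>R b" "h k *\<^sub>R b"] by simp
      then show ?thesis using False R by simp
    qed
    then show "AE x in lborel. norm (?D k x * ?E x) \<le> B * indicat_real (cball (0::'a) (R + 1)) x" for k
      by (simp only: norm_mult cmod_kernel mult_1_right) simp
  qed measurable
  moreover have eq: "(LINT x|lborel. ?D k x * ?E x) = (exp (\<i> * complex_of_real (\<xi> \<bullet> b) * complex_of_real (h k)) - 1) / complex_of_real (h k) * fourier \<phi> \<xi>" for k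
  proof -
    have \<phi>h: "(\<lambda>x. \<phi> (x + h k *\<^sub>R b)) \<in> test_functions"
      using test_affine[OF \<phi>, of 1 "h k *\<^sub>R b"] by (simp add: add.commute)
    have "(LINT x|lborel. ?D k x * ?E x) = (LINT x|lborel. inverse (complex_of_real (h k)) * (\<phi> (x + h k *\<^sub>R b) * ?E x - \<phi> x * ?E x))"
      by (intro Bochner_Integration.integral_cong) (auto simp: scaleR_conv_of_real algebra_simps)
    also have "\<dots> = inverse (complex_of_real (h k)) * (fourier (\<lambda>x. \<phi> (x + h k *\<^sub>R b)) \<xi> - fourier \<phi> \<xi>)"
      unfolding fourier_def integral_mult_right_zero
      by (subst Bochner_Integration.integral_diff) (intro fourier_integrand_integrable test_integrable \<phi>h \<phi> refl)+
    also have "fourier (\<lambda>x. \<phi> (x + h k *\<^sub>R b)) \<xi> = exp (\<i> * complex_of_real (\<xi> \<bullet> b) * complex_of_real (h k)) * fourier \<phi> \<xi>"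
      using fourier_affine[of \<phi> 1 "h k *\<^sub>R b" \<xi>] by (simp add: add.commute mult_ac)
    finally show ?thesis by (simp add: field_simps)
  qed
  moreover have "(\<lambda>k. (exp (\<i> * complex_of_real (\<xi> \<bullet> b) * complex_of_real (h k)) - 1) / complex_of_real (h k) * fourier \<phi> \<xi>)
     \<longlonglongrightarrow> \<i> * complex_of_real (\<xi> \<bullet> b) * fourier \<phi> \<xi>"
  proof (intro tendsto_mult_right)
    let ?z = "\<i> * complex_of_real (\<xi> \<bullet> b)"
    have "((\<lambda>w. exp (?z * w)) has_field_derivative ?z * exp (?z * 0)) (at 0)"
      by (auto intro!: derivative_eq_intros)
    then have "((\<lambda>w. (exp (?z * w) - 1) / w) \<longlongrightarrow> ?z) (at 0)"
      by (simp add: has_field_derivative_iff)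
    moreover have "filterlim (\<lambda>k. complex_of_real (h k)) (at 0) sequentially"
      unfolding filterlim_at
      by (intro conjI always_eventually allI) (use h(1) h0 in \<open>auto simp: less_imp_neq[symmetric] intro!: tendsto_of_real_iff[where c = 0, THEN iffD2, simplified]\<close>)
    ultimately show "(\<lambda>k. (exp (?z * complex_of_real (h k)) - 1) / complex_of_real (h k)) \<longlonglongrightarrow> ?z"
      by (rule filterlim_compose)
  qed
  ultimately have "(LINT x|lborel. partial b \<phi> x * ?E x) = \<i> * complex_of_real (\<xi> \<bullet> b) * fourier \<phi> \<xi>"
    unfolding eq by (intro LIMSEQ_unique)
  then show ?thesis unfolding fourier_def[of "partial b \<phi>"] .
qed

lemma fourier_laplacian:
  fixes \<phi> :: "'a::euclidean_space \<Rightarrow> complex"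
  assumes \<phi>: "\<phi> \<in> test_functions"
  shows "fourier (laplacian \<phi>) \<xi> = - complex_of_real ((norm \<xi>)\<^sup>2) * fourier \<phi> \<xi>"
proof -
  have int: "integrable lborel (partial b (partial b \<phi>))" if "b \<in> Basis" for b
    using that \<phi> by (intro test_integrable test_partial)
  have "fourier (laplacian \<phi>) \<xi> = (\<Sum>b\<in>Basis. fourier (partial b (partial b \<phi>)) \<xi>)"
    unfolding fourier_def laplacian_def sum_distrib_right
    by (rule Bochner_Integration.integral_sum) (intro fourier_integrand_integrable int)
  also have "\<dots> = (\<Sum>b\<in>Basis. - complex_of_real ((\<xi> \<bullet> b)\<^sup>2) * fourier \<phi> \<xi>)"
    by (intro sum.cong refl) (simp add: fourier_partial test_partial \<phi> power2_eq_square mult_ac)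
  also have "\<dots> = - complex_of_real (\<Sum>b\<in>Basis. (\<xi> \<bullet> b)\<^sup>2) * fourier \<phi> \<xi>"
    by (simp add: sum_distrib_right sum_negf)
  also have "(\<Sum>b\<in>Basis. (\<xi> \<bullet> b)\<^sup>2) = (norm \<xi>)\<^sup>2"
    unfolding power2_norm_eq_inner euclidean_inner[of \<xi> \<xi>] by (simp add: power2_eq_square)
  finally show ?thesis .
qed

section \<open>A bump function\<close>

text \<open>
  All derivatives of the function \<open>exp (-1/x)\<close>, continued by 0 to \<open>x \<le> 0\<close>, are of this form. As the
  family is closed under differentiation, all its members are smooth.
\<close>
definition flat :: "real poly \<Rightarrow> real \<Rightarrow> real" where
  "flat p x = (if x > 0 then poly p (1 / x) * exp (- 1 / x) else 0)"

lemma poly_exp_tendsto: "((\<lambda>y::real. poly p y * exp (- y)) \<longlongrightarrow> 0) at_top"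
proof -
  have "((\<lambda>y. \<Sum>i\<le>degree p. coeff p i * (y ^ i / exp y)) \<longlongrightarrow> (\<Sum>i\<le>degree p. coeff p i * 0)) at_top"
    by (intro tendsto_intros tendsto_power_div_exp_0)
  moreover have "poly p y * exp (- y) = (\<Sum>i\<le>degree p. coeff p i * (y ^ i / exp y))" for y
    by (simp add: poly_altdef sum_distrib_right exp_minus divide_inverse mult.assoc)
  ultimately show ?thesis by simp
qed

text \<open>
  The only delicate point is the origin, where \<open>flat p h / h\<close> tends to 0 because \<open>y p(y) exp (-y)\<close> tends
  to 0 at infinity.
\<close>
lemma flat_DERIV: "(flat p has_field_derivative flat ([:0, 0, 1:] * (p - pderiv p)) x) (at x)"
proof -
  consider "x > 0" | "x < 0" | "x = 0" by linarith
  then show ?thesis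
  proof cases
    case 1
    have "((\<lambda>x. poly p (1 / x) * exp (- 1 / x)) has_field_derivative
        poly (pderiv p) (1 / x) * (- 1 / x\<^sup>2) * exp (- 1 / x) + poly p (1 / x) * (exp (- 1 / x) * (1 / x\<^sup>2))) (at x)"
      using 1 by (auto intro!: derivative_eq_intros simp: field_simps power2_eq_square)
    then have "((\<lambda>x. poly p (1 / x) * exp (- 1 / x)) has_field_derivative
        flat ([:0, 0, 1:] * (p - pderiv p)) x) (at x)"
      by (rule DERIV_cong) (use 1 in \<open>simp add: flat_def field_simps power2_eq_square\<close>)
    then show ?thesis
      by (rule has_field_derivative_transform_within_open[where S = "{0<..}"]) (use 1 in \<open>auto simp: flat_def\<close>)
  next
    case 2
    have "((\<lambda>x. 0) has_field_derivative flat ([:0, 0, 1:] * (p - pderiv p)) x) (at x)"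
      using 2 by (simp add: flat_def)
    then show ?thesis
      by (rule has_field_derivative_transform_within_open[where S = "{..<0}"]) (use 2 in \<open>auto simp: flat_def\<close>)
  next
    case 3
    have "((\<lambda>h. flat p h / h) \<longlongrightarrow> 0) (at_left 0)"
      by (rule tendsto_eventually) (auto simp: flat_def eventually_at_filter)
    moreover have "((\<lambda>h. flat p h / h) \<longlongrightarrow> 0) (at_right 0)"
    proof -
      have "((\<lambda>h. poly (pCons 0 p) (inverse h) * exp (- inverse h)) \<longlongrightarrow> 0) (at_right (0::real))"
        by (rule filterlim_compose[OF poly_exp_tendsto filterlim_inverse_at_top_right])
      then show ?thesis
        by (rule filterlim_cong[THEN iffD1, rotated -1])
           (auto simp: flat_def eventually_at_filter field_simps)
    qed
    ultimately have "((\<lambda>h. flat p h / h) \<longlongrightarrow> 0) (at 0)" by (rule filterlim_split_at)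
    then show ?thesis using 3 by (simp add: has_field_derivative_iff flat_def)
  qed
qed

lemma C_fun_flat: "C_fun k (\<lambda>x::'a::euclidean_space. complex_of_real (flat p (1 - x \<bullet> x)))"
proof (induction k arbitrary: p)
  case 0
  have "continuous_on UNIV (flat p)"
    using flat_DERIV by (auto intro!: continuous_at_imp_continuous_on DERIV_isCont)
  then show ?case by (auto intro!: continuous_intros continuous_on_compose2[of UNIV "flat p"])
next
  case (Suc k)
  let ?q = "[:0, 0, 1:] * (p - pderiv p)"
  have d: "((\<lambda>x::'a. complex_of_real (flat p (1 - x \<bullet> x))) has_derivative
     (\<lambda>h. complex_of_real (flat ?q (1 - x \<bullet> x) * (- 2 * (x \<bullet> h))))) (at x)" for x
  proof -
    have "((\<lambda>x::'a. 1 - x \<bullet> x) has_derivative (\<lambda>h. - 2 * (x \<bullet> h))) (at x)"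
      by (auto intro!: derivative_eq_intros simp: inner_commute)
    from has_derivative_compose[OF this flat_DERIV[of p "1 - x \<bullet> x", unfolded has_field_derivative_def]]
    show ?thesis by (intro has_derivative_of_real)
  qed
  have "partial b (\<lambda>x::'a. complex_of_real (flat p (1 - x \<bullet> x))) = (\<lambda>x. complex_of_real (flat ?q (1 - x \<bullet> x)) * (- 2 * complex_of_real (x \<bullet> b)))" for b
    by (rule ext) (simp add: partial_eq[OF d])
  moreover have "C_fun k (\<lambda>x. complex_of_real (flat ?q (1 - x \<bullet> x)) * (- 2 * complex_of_real (x \<bullet> b)))" for b :: 'a
    by (intro C_fun_mult C_fun_const C_fun_inner Suc.IH)
  ultimately show ?case using d by (auto simp: differentiable_def)
qed

text \<open>
  The function \<open>exp (-1 / (1 - |x|\<^sup>2))\<close> on the unit ball, continued by 0.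
\<close>
lemma bump_exists:
  "\<exists>\<phi> \<in> test_functions. (LINT x|lborel. \<phi> (x::'a::euclidean_space)) \<noteq> 0"
proof
  let ?\<phi> = "\<lambda>x::'a. complex_of_real (flat 1 (1 - x \<bullet> x))"
  show t: "?\<phi> \<in> test_functions"
  proof (rule test_functionsI[of _ 1])
    fix x :: 'a assume "norm x > 1"
    then have "(norm x)\<^sup>2 > 1" by (simp add: one_less_power)
    then show "?\<phi> x = 0" by (simp add: flat_def power2_norm_eq_inner)
  qed (rule C_fun_flat)
  show "(LINT x|lborel. ?\<phi> x) \<noteq> 0"
  proof
    assume "(LINT x|lborel. ?\<phi> x) = 0"
    then have 0: "(LINT x|lborel. flat 1 (1 - x \<bullet> (x::'a))) = 0" by simp
    have int: "integrable lborel (\<lambda>x::'a. flat 1 (1 - x \<bullet> x))"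
      using integrable_Re[OF test_integrable[OF t]] by simp
    have "AE x in lborel. flat 1 (1 - x \<bullet> (x::'a)) = 0"
      using integral_nonneg_eq_0_iff_AE[OF int] 0 by (auto simp: flat_def)
    then have "AE x in lborel. x \<notin> ball (0::'a) 1"
    proof eventually_elim
      case (elim x)
      show ?case
      proof
        assume "x \<in> ball 0 1"
        then have "(norm x)\<^sup>2 < 1" by (simp add: power_less_one_iff)
        with elim show False by (simp add: flat_def power2_norm_eq_inner)
      qed
    qed
    then have "emeasure lborel (ball (0::'a) 1) = 0"
      by (subst (asm) AE_iff_measurable[of "ball 0 1"]) auto
    then have "ball (0::'a) 1 \<in> null_sets lborel" by (auto simp: null_sets_def)
    then have "negligible (ball (0::'a) 1)"
      by (simp add: negligible_iff_null_sets null_sets_completionI)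
    moreover have "\<not> negligible (ball (0::'a) 1)" by (intro open_not_negligible) auto
    ultimately show False by simp
  qed
qed

section \<open>The equation on the Fourier side\<close>

text \<open>
  The mean is the transform at the origin, and \<open>|exp (-i \<xi>\<bullet>x) - 1| \<le> |\<xi>| |x|\<close>.
\<close>
lemma fourier_minus_mean:
  fixes f :: "'a::euclidean_space \<Rightarrow> complex"
  assumes f: "f \<in> L11"
  shows "cmod (fourier f \<xi> - mean f) \<le> norm \<xi> * L11_norm f"
proof -
  have int: "integrable lborel f" and w: "integrable lborel (\<lambda>x. (1 + norm x) * cmod (f x))"
    using f by (auto simp: L11_def L1_def)
  have "fourier f \<xi> - mean f = (LINT x|lborel. f x * (exp (- \<i> * complex_of_real (\<xi> \<bullet> x)) - 1))"
    unfolding fourier_def mean_def right_diff_distrib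
    using Bochner_Integration.integral_diff[OF fourier_integrand_integrable[OF int, of \<xi>] int] by simp
  also have "cmod \<dots> \<le> (LINT x|lborel. norm \<xi> * ((1 + norm x) * cmod (f x)))"
  proof (rule Bochner_Integration.integral_norm_bound_integral)
    show "integrable lborel (\<lambda>x. f x * (exp (- \<i> * complex_of_real (\<xi> \<bullet> x)) - 1))"
      unfolding right_diff_distrib
      by (intro Bochner_Integration.integrable_diff fourier_integrand_integrable) (auto intro: int)
    show "integrable lborel (\<lambda>x. norm \<xi> * ((1 + norm x) * cmod (f x)))"
      using w by simp
    fix x :: 'a
    have "cmod (iexp (- (\<xi> \<bullet> x)) - 1) \<le> \<bar>\<xi> \<bullet> x\<bar>"
      using iexp_approx1[of "- (\<xi> \<bullet> x)" 0] by simp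
    also have "\<dots> \<le> norm \<xi> * norm x" by (rule Cauchy_Schwarz_ineq2)
    finally have "cmod (exp (- \<i> * complex_of_real (\<xi> \<bullet> x)) - 1) \<le> norm \<xi> * (1 + norm x)"
      by (simp add: distrib_left add_increasing)
    from mult_left_mono[OF this norm_ge_zero[of "f x"]]
    show "norm (f x * (exp (- \<i> * complex_of_real (\<xi> \<bullet> x)) - 1)) \<le> norm \<xi> * ((1 + norm x) * cmod (f x))"
      unfolding norm_mult[of "f x"] by (simp add: mult_ac del: mult_minus_left)
  qed
  also have "\<dots> = norm \<xi> * L11_norm f" by (simp add: L11_norm_def)
  finally show ?thesis .
qed

lemma test_L11:
  assumes "\<phi> \<in> test_functions" shows "\<phi> \<in> L11"
proof -
  have "integrable lborel (\<lambda>x. (1 + norm x) *\<^sub>R \<phi> x)"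
    using assms by (intro test_integrable_mult continuous_intros)
  from integrable_norm[OF this] have "integrable lborel (\<lambda>x. (1 + norm x) * cmod (\<phi> x))"
    by (simp add: abs_of_nonneg)
  then show ?thesis using test_integrable[OF assms] by (simp add: L11_def L1_def)
qed

text \<open>
  Parseval's identity for the conjugate of \<open>\<psi>\<close>, which turns the sesquilinear pairing into the bilinear one
  of distributions.
\<close>
lemma Parseval_test:
  fixes f \<psi> :: "'a::euclidean_space \<Rightarrow> complex"
  assumes f: "f \<in> L2" and \<psi>: "\<psi> \<in> test_functions"
  shows "(LINT \<xi>|lborel. fourier_L2 f \<xi> * fourier \<psi> (- \<xi>)) = complex_of_real ((2 * pi) ^ DIM('a)) * dist_of f \<psi>"
    and "integrable lborel (\<lambda>\<xi>. fourier_L2 f \<xi> * fourier \<psi> (- \<xi>))"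
proof -
  let ?\<phi> = "\<lambda>x. cnj (\<psi> x)"
  obtain B where B: "\<And>x. cmod (\<psi> x) \<le> B" using test_bounded[OF \<psi>] by blast
  have eq: "cnj (fourier ?\<phi> \<xi>) = fourier \<psi> (- \<xi>)" for \<xi>
    unfolding fourier_def by (subst Bochner_Integration.integral_cnj[symmetric]) (simp add: exp_cnj del: Bochner_Integration.integral_cnj)
  have int: "integrable lborel ?\<phi>" using test_integrable[OF \<psi>] by simp
  have L2: "?\<phi> \<in> L2" by (intro L2_cnj test_L2 \<psi>)
  have "continuous_on UNIV ?\<phi>" by (intro continuous_intros test_continuous \<psi>)
  from Parseval_fourier_L2[OF f int L2 this, of B] B
  show "(LINT \<xi>|lborel. fourier_L2 f \<xi> * fourier \<psi> (- \<xi>)) = complex_of_real ((2 * pi) ^ DIM('a)) * dist_of f \<psi>"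
    by (simp add: eq dist_of_def)
  have "(\<lambda>\<xi>. cnj (fourier ?\<phi> \<xi>)) \<in> L2"
    by (intro L2_cnj fourier_in_L2 int L2)
  then show "integrable lborel (\<lambda>\<xi>. fourier_L2 f \<xi> * fourier \<psi> (- \<xi>))"
    unfolding eq by (intro L2_mult_integrable fourier_L2_limit f)
qed

text \<open>
  By Parseval's identity the equation says that \<open>G\<close>, the left-hand side multiplied by \<open>1 + |\<xi>|\<^sup>2\<close>, integrates
  to 0 against the reflected transform of every test function. Translating a test function multiplies its
  transform by a character, so using all translates shows that \<open>G\<close> times the transform has vanishing
  Fourier transform and hence is 0 almost everywhere. The transform of a bump function with nonzero mean
  does not vanish near the origin; dilating the bump makes this neighbourhood as large as desired.
\<close>
lemma distributional_equation_fourier: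
  fixes u ut utt :: "'a::euclidean_space \<Rightarrow> complex"
  assumes L2: "u \<in> L2" "ut \<in> L2" "utt \<in> L2"
    and eq: "\<And>\<phi>. \<phi> \<in> test_functions \<Longrightarrow>
       dist_of utt \<phi> - dist_laplacian (dist_of utt) \<phi>
           + dist_laplacian (dist_laplacian (dist_of u)) \<phi>
           - dist_laplacian (dist_of u) \<phi> + dist_of ut \<phi> = 0"
  shows "AE \<xi> in lborel. fourier_L2 utt \<xi> + complex_of_real (1 / (1 + (norm \<xi>)\<^sup>2)) * fourier_L2 ut \<xi>
      + complex_of_real ((norm \<xi>)\<^sup>2) * fourier_L2 u \<xi> = 0"
proof -
  define G where "G \<xi> = complex_of_real (1 + (norm \<xi>)\<^sup>2) * fourier_L2 utt \<xi> + fourier_L2 ut \<xi>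
      + complex_of_real ((norm \<xi>)\<^sup>2 * (1 + (norm \<xi>)\<^sup>2)) * fourier_L2 u \<xi>" for \<xi> :: 'a
  have [measurable]: "fourier_L2 u \<in> borel_measurable borel" "fourier_L2 ut \<in> borel_measurable borel"
    "fourier_L2 utt \<in> borel_measurable borel"
    by (simp_all add: L2 fourier_L2_limit(1) L2_measurable)
  have [measurable]: "G \<in> borel_measurable borel" unfolding G_def by measurable
  have pair: "integrable lborel (\<lambda>\<xi>. G \<xi> * fourier \<phi> (- \<xi>))" "(LINT \<xi>|lborel. G \<xi> * fourier \<phi> (- \<xi>)) = 0"
    if \<phi>: "\<phi> \<in> test_functions" for \<phi>
  proof -
    note P = Parseval_test(1)[OF L2(3) \<phi>] Parseval_test(1)[OF L2(3) test_laplacian[OF \<phi>]]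
       Parseval_test(1)[OF L2(1) test_laplacian[OF test_laplacian[OF \<phi>]]]
       Parseval_test(1)[OF L2(1) test_laplacian[OF \<phi>]] Parseval_test(1)[OF L2(2) \<phi>]
    note I = Parseval_test(2)[OF L2(3) \<phi>] Parseval_test(2)[OF L2(3) test_laplacian[OF \<phi>]]
       Parseval_test(2)[OF L2(1) test_laplacian[OF test_laplacian[OF \<phi>]]]
       Parseval_test(2)[OF L2(1) test_laplacian[OF \<phi>]] Parseval_test(2)[OF L2(2) \<phi>]
    have Geq: "G \<xi> * fourier \<phi> (- \<xi>) = fourier_L2 utt \<xi> * fourier \<phi> (- \<xi>) - fourier_L2 utt \<xi> * fourier (laplacian \<phi>) (- \<xi>)
       + fourier_L2 u \<xi> * fourier (laplacian (laplacian \<phi>)) (- \<xi>) - fourier_L2 u \<xi> * fourier (laplacian \<phi>) (- \<xi>)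
       + fourier_L2 ut \<xi> * fourier \<phi> (- \<xi>)" for \<xi>
      unfolding G_def fourier_laplacian[OF test_laplacian[OF \<phi>]] fourier_laplacian[OF \<phi>]
      by (simp add: algebra_simps)
    show "integrable lborel (\<lambda>\<xi>. G \<xi> * fourier \<phi> (- \<xi>))"
      unfolding Geq by (intro Bochner_Integration.integrable_add Bochner_Integration.integrable_diff I)
    have "(LINT \<xi>|lborel. G \<xi> * fourier \<phi> (- \<xi>)) = complex_of_real ((2 * pi) ^ DIM('a)) *
       (dist_of utt \<phi> - dist_of utt (laplacian \<phi>) + dist_of u (laplacian (laplacian \<phi>))
           - dist_of u (laplacian \<phi>) + dist_of ut \<phi>)"
      unfolding Geq using I
      by (simp add: P Bochner_Integration.integral_add Bochner_Integration.integral_diff algebra_simps del: of_real_power of_real_mult)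
    also have "\<dots> = 0" using eq[OF \<phi>] by (simp add: dist_laplacian_def)
    finally show "(LINT \<xi>|lborel. G \<xi> * fourier \<phi> (- \<xi>)) = 0" .
  qed
  obtain \<phi> :: "'a \<Rightarrow> complex" where \<phi>: "\<phi> \<in> test_functions" and mean: "mean \<phi> \<noteq> 0"
    using bump_exists unfolding mean_def by blast
  note [measurable] = test_measurable[OF \<phi>]
  \<comment> \<open>The transform differs from the mean by at most \<open>|\<xi>|\<close> times the \<open>L11\<close> norm.\<close>
  define \<eta> where "\<eta> = cmod (mean \<phi>) / (1 + L11_norm \<phi>)"
  have L11: "0 \<le> L11_norm \<phi>" unfolding L11_norm_def by (intro Bochner_Integration.integral_nonneg) auto
  have \<eta>: "\<eta> > 0" using mean L11 by (auto simp: \<eta>_def)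
  have nz: "fourier \<phi> \<xi> \<noteq> 0" if "norm \<xi> < \<eta>" for \<xi>
  proof
    assume "fourier \<phi> \<xi> = 0"
    then have "cmod (mean \<phi>) \<le> norm \<xi> * L11_norm \<phi>"
      using fourier_minus_mean[OF test_L11[OF \<phi>], of \<xi>] by (simp add: norm_minus_commute)
    also have "\<dots> \<le> \<eta> * L11_norm \<phi>" using that L11 by (intro mult_right_mono) auto
    also have "\<dots> < \<eta> * (1 + L11_norm \<phi>)" using \<eta> by simp
    also have "\<dots> = cmod (mean \<phi>)" using L11 by (simp add: \<eta>_def)
    finally show False by simp
  qed
  have "AE \<xi> in lborel. norm \<xi> < real N \<longrightarrow> G \<xi> = 0" for N :: nat
  proof -
    \<comment> \<open>Dilating by \<open>c\<close> makes the transform nonzero for frequencies up to \<open>N\<close>.\<close>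
    define c where "c = (real N + 1) / \<eta>"
    have c: "c > 0" using \<eta> by (simp add: c_def)
    let ?\<Phi> = "\<lambda>\<xi>. fourier \<phi> ((- \<xi>) /\<^sub>R c)"
    have tst: "(\<lambda>x. \<phi> (t + c *\<^sub>R x)) \<in> test_functions" for t
      by (rule test_affine[OF \<phi> c])
    have four: "fourier (\<lambda>x. \<phi> (t + c *\<^sub>R x)) (- \<xi>) = complex_of_real (inverse (c ^ DIM('a))) * (exp (- \<i> * complex_of_real ((t /\<^sub>R c) \<bullet> \<xi>)) * ?\<Phi> \<xi>)" for t \<xi>
    proof -
      have "complex_of_real (c ^ DIM('a)) * fourier (\<lambda>x. \<phi> (t + c *\<^sub>R x)) (- \<xi>)
          = exp (- \<i> * complex_of_real ((t /\<^sub>R c) \<bullet> \<xi>)) * ?\<Phi> \<xi>"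
        using fourier_affine[OF test_measurable[OF \<phi>] c, of t "- \<xi>"]
        by (simp add: inner_commute divide_inverse mult_ac)
      then show ?thesis using c by (simp add: field_simps)
    qed
    have int: "integrable lborel (\<lambda>\<xi>. G \<xi> * ?\<Phi> \<xi>)"
    proof -
      have "integrable lborel (\<lambda>\<xi>. complex_of_real (c ^ DIM('a)) * (G \<xi> * fourier (\<lambda>x. \<phi> (0 + c *\<^sub>R x)) (- \<xi>)))"
        by (intro integrable_mult_right pair tst)
      moreover have "complex_of_real (c ^ DIM('a)) * (G \<xi> * fourier (\<lambda>x. \<phi> (0 + c *\<^sub>R x)) (- \<xi>)) = G \<xi> * ?\<Phi> \<xi>" for \<xi>
        unfolding four using c by (simp add: field_simps)
      ultimately show ?thesis by (simp only:)
    qed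
    have "fourier (\<lambda>\<xi>. G \<xi> * ?\<Phi> \<xi>) y = 0" for y
    proof -
      have "0 = (LINT \<xi>|lborel. G \<xi> * fourier (\<lambda>x. \<phi> (c *\<^sub>R y + c *\<^sub>R x)) (- \<xi>))"
        by (rule pair(2)[OF tst, symmetric])
      also have "\<dots> = (LINT \<xi>|lborel. complex_of_real (inverse (c ^ DIM('a))) * (G \<xi> * ?\<Phi> \<xi> * exp (- \<i> * complex_of_real (y \<bullet> \<xi>))))"
        unfolding four using c by (intro Bochner_Integration.integral_cong refl) (simp add: mult_ac)
      also have "\<dots> = complex_of_real (inverse (c ^ DIM('a))) * fourier (\<lambda>\<xi>. G \<xi> * ?\<Phi> \<xi>) y"
        unfolding fourier_def by (rule integral_mult_right_zero)
      finally show ?thesis using c by simp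
    qed
    from fourier_injective[OF int this] show ?thesis
    proof eventually_elim
      case (elim \<xi>)
      show ?case
      proof
        assume N: "norm \<xi> < real N"
        have "norm ((- \<xi>) /\<^sub>R c) = norm \<xi> / c" using c by (simp add: divide_inverse mult.commute)
        also have "\<dots> < \<eta>" proof -
          have "\<eta> * c = real N + 1" using \<eta> by (simp add: c_def)
          then show ?thesis using N by (simp add: pos_divide_less_eq[OF c])
        qed
        finally have "?\<Phi> \<xi> \<noteq> 0" by (rule nz)
        with elim show "G \<xi> = 0" by simp
      qed
    qed
  qed
  then have "AE \<xi> in lborel. \<forall>N::nat. norm \<xi> < real N \<longrightarrow> G \<xi> = 0"
    by (intro AE_all_countable[THEN iffD2] allI)
  then show ?thesis
  proof eventually_elim
    case (elim \<xi>)
    obtain N :: nat where "norm \<xi> < real N" using reals_Archimedean2 by blast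
    with elim have "G \<xi> = 0" by blast
    moreover have "1 + (norm \<xi>)\<^sup>2 \<noteq> 0" by (metis add_pos_nonneg less_irrefl zero_le_power2 zero_less_one)
    then have ne: "complex_of_real (1 + (norm \<xi>)\<^sup>2) \<noteq> 0" by (simp only: of_real_eq_0_iff not_False_eq_True)
    have "G \<xi> = complex_of_real (1 + (norm \<xi>)\<^sup>2) * (fourier_L2 utt \<xi> + complex_of_real (1 / (1 + (norm \<xi>)\<^sup>2)) * fourier_L2 ut \<xi>
      + complex_of_real ((norm \<xi>)\<^sup>2) * fourier_L2 u \<xi>)"
    proof -
      have "complex_of_real (1 + (norm \<xi>)\<^sup>2) * complex_of_real (1 / (1 + (norm \<xi>)\<^sup>2)) = 1"
        unfolding of_real_mult[symmetric] using \<open>1 + (norm \<xi>)\<^sup>2 \<noteq> 0\<close> by simp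
      then show ?thesis
        unfolding G_def of_real_mult by algebra
    qed
    ultimately show ?case using ne by (metis mult_eq_0_iff)
  qed
qed

section \<open>The scalar oscillator\<close>

text \<open>
  The solution of \<open>y'' = D y\<close> with \<open>y(0) = 0\<close> and \<open>y'(0) = 1\<close>. The case distinction keeps it real for
  both signs of the discriminant.
\<close>
definition ysin :: "real \<Rightarrow> real \<Rightarrow> real" where
  "ysin D t = (if D > 0 then sinh (sqrt D * t) / sqrt D else if D < 0 then sin (sqrt (- D) * t) / sqrt (- D) else t)"

text \<open>
  The solution of \<open>y'' = D y\<close> with \<open>y(0) = 1\<close> and \<open>y'(0) = 0\<close>.
\<close>
definition ycos :: "real \<Rightarrow> real \<Rightarrow> real" where
  "ycos D t = (if D > 0 then cosh (sqrt D * t) else if D < 0 then cos (sqrt (- D) * t) else 1)"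

lemma ysin_DERIV: "(ysin D has_field_derivative ycos D t) (at t)"
proof -
  consider "D > 0" | "D < 0" | "D = 0" by linarith
  then show ?thesis
  proof cases
    case 1
    define s where "s = sqrt D"
    have s: "s > 0" using 1 by (simp add: s_def)
    have "ysin D = (\<lambda>t. sinh (s * t) / s)" "ycos D t = cosh (s * t)" using 1 by (auto simp: ysin_def ycos_def s_def)
    with s show ?thesis by (auto intro!: derivative_eq_intros)
  next
    case 2
    define s where "s = sqrt (- D)"
    have s: "s > 0" using 2 by (simp add: s_def)
    have "ysin D = (\<lambda>t. sin (s * t) / s)" "ycos D t = cos (s * t)" using 2 by (auto simp: ysin_def ycos_def s_def)
    with s show ?thesis by (auto intro!: derivative_eq_intros)
  next
    case 3
    then have "ysin D = (\<lambda>t. t)" by (auto simp: ysin_def)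
    with 3 show ?thesis by (auto intro!: derivative_eq_intros simp: ycos_def)
  qed
qed

lemma ycos_DERIV: "(ycos D has_field_derivative D * ysin D t) (at t)"
proof -
  consider "D > 0" | "D < 0" | "D = 0" by linarith
  then show ?thesis
  proof cases
    case 1
    define s where "s = sqrt D"
    have s: "s > 0" "D = s * s" using 1 by (auto simp: s_def)
    have "ycos D = (\<lambda>t. cosh (s * t))" "ysin D t = sinh (s * t) / s" using 1 by (auto simp: ysin_def ycos_def s_def)
    with s show ?thesis by (auto intro!: derivative_eq_intros)
  next
    case 2
    define s where "s = sqrt (- D)"
    have s: "s > 0" "D = - (s * s)" using 2 by (auto simp: s_def)
    have "ycos D = (\<lambda>t. cos (s * t))" "ysin D t = sin (s * t) / s" using 2 by (auto simp: ysin_def ycos_def s_def)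
    with s show ?thesis by (auto intro!: derivative_eq_intros)
  next
    case 3
    then have "ycos D = (\<lambda>t. 1)" by (auto simp: ycos_def)
    with 3 show ?thesis by auto
  qed
qed

lemma ysin_0[simp]: "ysin D 0 = 0" and ycos_0[simp]: "ycos D 0 = 1"
  by (auto simp: ysin_def ycos_def)

lemma sinh_le: "x \<ge> 0 \<Longrightarrow> sinh x \<le> x * exp (x::real)"
proof -
  assume "x \<ge> 0"
  have "1 - 2 * x \<le> exp (- 2 * x)" using exp_ge_add_one_self[of "- 2 * x"] by simp
  then have "(1 - 2 * x) * exp x \<le> exp (- 2 * x) * exp x" by (intro mult_right_mono) auto
  also have "\<dots> = exp (- x)" by (simp add: exp_add[symmetric])
  finally show ?thesis by (simp add: sinh_def field_simps)
qed

lemma ysin_bound: "t \<ge> 0 \<Longrightarrow> \<bar>ysin D t\<bar> \<le> t * exp (sqrt (max D 0) * t)"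
proof -
  assume t: "t \<ge> 0"
  consider "D > 0" | "D < 0" | "D = 0" by linarith
  then show ?thesis
  proof cases
    case 1
    then have "\<bar>ysin D t\<bar> = sinh (sqrt D * t) / sqrt D" using t by (simp add: ysin_def abs_of_nonneg)
    also have "\<dots> \<le> (sqrt D * t * exp (sqrt D * t)) / sqrt D"
      using 1 t by (intro divide_right_mono sinh_le) auto
    finally show ?thesis using 1 by (simp add: max_def)
  next
    case 2
    have "\<bar>ysin D t\<bar> = \<bar>sin (sqrt (- D) * t)\<bar> / sqrt (- D)" using 2 by (simp add: ysin_def)
    also have "\<dots> \<le> \<bar>sqrt (- D) * t\<bar> / sqrt (- D)" using 2 by (intro divide_right_mono abs_sin_x_le_abs_x) auto
    finally show ?thesis using 2 t by (simp add: max_def abs_mult)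
  next
    case 3
    then show ?thesis using t by (simp add: ysin_def)
  qed
qed

lemma ycos_bound: "t \<ge> 0 \<Longrightarrow> \<bar>ycos D t\<bar> \<le> exp (sqrt (max D 0) * t)"
proof -
  assume t: "t \<ge> 0"
  consider "D > 0" | "D \<le> 0" by linarith
  then show ?thesis
  proof cases
    case 1
    then have "0 \<le> sqrt D * t" using t by simp
    then have "cosh (sqrt D * t) \<le> exp (sqrt D * t)" by (simp add: cosh_def)
    with 1 show ?thesis by (simp add: ycos_def max_def abs_of_pos)
  next
    case 2
    then show ?thesis by (auto simp: ycos_def max_def)
  qed
qed

text \<open>
  With \<open>\<rho> = |\<xi>|\<close>, the equation for the transform at \<open>\<xi>\<close> is \<open>y'' + damping \<rho> y' + \<rho>\<^sup>2 y = 0\<close>.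
\<close>
definition damping :: "real \<Rightarrow> real" where "damping \<rho> = 1 / (1 + \<rho>\<^sup>2)"

definition discr :: "real \<Rightarrow> real" where "discr \<rho> = (damping \<rho>)\<^sup>2 / 4 - \<rho>\<^sup>2"

text \<open>
  The solution of the oscillator equation with initial value 0 and initial velocity 1.
\<close>
definition prop1 :: "real \<Rightarrow> real \<Rightarrow> real" where
  "prop1 t \<rho> = exp (- damping \<rho> / 2 * t) * ysin (discr \<rho>) t"

text \<open>
  The solution of the oscillator equation with initial value 1 and initial velocity 0.
\<close>
definition prop0 :: "real \<Rightarrow> real \<Rightarrow> real" where
  "prop0 t \<rho> = exp (- damping \<rho> / 2 * t) * (ycos (discr \<rho>) t + damping \<rho> / 2 * ysin (discr \<rho>) t)"

lemma damping_bounds: "0 < damping \<rho>" "damping \<rho> \<le> 1"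
  by (auto simp: damping_def add_pos_nonneg)

text \<open>
  Both derivatives are combinations of the propagators themselves; this is the adjoint first-order
  system that makes the pairing in \<open>oscillator_solution\<close> constant.
\<close>
lemma prop1_DERIV: "((\<lambda>t. prop1 t \<rho>) has_field_derivative prop0 t \<rho> - damping \<rho> * prop1 t \<rho>) (at t)"
  unfolding prop1_def prop0_def
  by (auto intro!: derivative_eq_intros ysin_DERIV simp: algebra_simps)

lemma prop0_DERIV: "((\<lambda>t. prop0 t \<rho>) has_field_derivative - (\<rho>\<^sup>2 * prop1 t \<rho>)) (at t)"
proof -
  have *: "\<rho>\<^sup>2 = damping \<rho> * damping \<rho> / 4 - discr \<rho>"
    by (simp add: discr_def power2_eq_square)
  show ?thesis
    unfolding prop1_def prop0_def *
    by (auto intro!: derivative_eq_intros ysin_DERIV ycos_DERIV simp: field_simps)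
qed

lemma prop_0[simp]: "prop1 0 \<rho> = 0" "prop0 0 \<rho> = 1"
  by (auto simp: prop1_def prop0_def)

lemma discr_le: "sqrt (max (discr \<rho>) 0) \<le> damping \<rho> / 2"
proof -
  have "max (discr \<rho>) 0 \<le> (damping \<rho> / 2)\<^sup>2"
    by (intro max.boundedI) (auto simp: discr_def power_divide)
  then have "sqrt (max (discr \<rho>) 0) \<le> sqrt ((damping \<rho> / 2)\<^sup>2)" by (rule real_sqrt_le_mono)
  then show ?thesis using damping_bounds(1)[of \<rho>] by simp
qed

text \<open>
  The distance of the characteristic roots from the imaginary axis.
\<close>
definition decay :: "real \<Rightarrow> real" where
  "decay \<rho> = damping \<rho> / 2 - sqrt (max (discr \<rho>) 0)"

lemma decay_nonneg: "0 \<le> decay \<rho>" using discr_le by (simp add: decay_def)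

lemma prop1_bound: "t \<ge> 0 \<Longrightarrow> \<bar>prop1 t \<rho>\<bar> \<le> t * exp (- decay \<rho> * t)"
proof -
  assume t: "t \<ge> 0"
  have "\<bar>prop1 t \<rho>\<bar> \<le> exp (- damping \<rho> / 2 * t) * (t * exp (sqrt (max (discr \<rho>) 0) * t))"
    unfolding prop1_def abs_mult using ysin_bound[OF t] by (simp add: mult_left_mono)
  also have "\<dots> = t * exp (- decay \<rho> * t)"
    by (simp add: decay_def exp_add[symmetric] algebra_simps exp_diff exp_minus field_simps)
  finally show ?thesis .
qed

lemma prop0_bound: "t \<ge> 0 \<Longrightarrow> \<bar>prop0 t \<rho>\<bar> \<le> (1 + t) * exp (- decay \<rho> * t)"
proof -
  assume t: "t \<ge> 0"
  let ?e = "exp (sqrt (max (discr \<rho>) 0) * t)"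
  have "\<bar>ycos (discr \<rho>) t + damping \<rho> / 2 * ysin (discr \<rho>) t\<bar> \<le> \<bar>ycos (discr \<rho>) t\<bar> + damping \<rho> / 2 * \<bar>ysin (discr \<rho>) t\<bar>"
    using damping_bounds(1)[of \<rho>] by (intro order_trans[OF abs_triangle_ineq]) (simp add: abs_mult)
  also have "\<dots> \<le> ?e + 1 * (t * ?e)"
    using ysin_bound[OF t] ycos_bound[OF t] damping_bounds[of \<rho>] t
    by (intro add_mono mult_mono) auto
  finally have "\<bar>prop0 t \<rho>\<bar> \<le> exp (- damping \<rho> / 2 * t) * (?e + 1 * (t * ?e))"
    unfolding prop0_def abs_mult by (simp add: mult_left_mono)
  also have "\<dots> = (1 + t) * (exp (- damping \<rho> / 2 * t) * ?e)" by (simp add: algebra_simps)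
  also have "exp (- damping \<rho> / 2 * t) * ?e = exp (- decay \<rho> * t)"
    unfolding exp_add[symmetric] by (simp add: decay_def algebra_simps)
  finally show ?thesis .
qed

section \<open>Solving the equation in L2\<close>

text \<open>
  The derivative as a limit of difference quotients, the form in which \<open>Sobolev_deriv\<close> states it.
\<close>
lemma has_vector_derivative_quotientI:
  fixes f :: "real \<Rightarrow> complex"
  assumes lim: "((\<lambda>r. (f r - f s) /\<^sub>R (r - s)) \<longlongrightarrow> L) (at s within S)"
  shows "(f has_vector_derivative L) (at s within S)"
  unfolding has_vector_derivative_def has_derivative_iff_norm
proof (intro conjI bounded_linear_scaleR_left)
  have "((\<lambda>r. norm ((f r - f s) /\<^sub>R (r - s) - L)) \<longlongrightarrow> 0) (at s within S)"
    using lim by (simp only: tendsto_norm_zero_iff LIM_zero_iff)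
  then show "((\<lambda>r. norm (f r - f s - (r - s) *\<^sub>R L) / norm (r - s)) \<longlongrightarrow> 0) (at s within S)"
  proof (rule Lim_transform_eventually)
    have "norm ((f r - f s) /\<^sub>R (r - s) - L) = norm (f r - f s - (r - s) *\<^sub>R L) / norm (r - s)" if "r \<noteq> s" for r
    proof -
      have "(f r - f s) /\<^sub>R (r - s) - L = (f r - f s - (r - s) *\<^sub>R L) /\<^sub>R (r - s)"
        using that by (simp add: scaleR_diff_right)
      then show ?thesis by (simp add: divide_inverse mult.commute)
    qed
    then show "\<forall>\<^sub>F r in at s within S. norm ((f r - f s) /\<^sub>R (r - s) - L) = norm (f r - f s - (r - s) *\<^sub>R L) / norm (r - s)"
      by (auto simp: eventually_at_filter)
  qed
qed

text \<open>
  The product rule for a weakly paired product of a multiplier \<open>m\<close> and a curve \<open>F\<close> that is differentiable in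
  \<open>L2\<close>. The increment of the product splits into the error of \<open>F\<close>, the error of \<open>m\<close> and a mixed term, and
  the Taylor and Lipschitz bounds on \<open>m\<close> are needed only where \<open>g\<close> does not vanish. This is what allows
  multipliers that are well behaved on bounded sets of frequencies only.
\<close>
lemma pairing_derivative:
  fixes F :: "real \<Rightarrow> 'a::euclidean_space \<Rightarrow> complex" and m :: "real \<Rightarrow> 'a \<Rightarrow> complex"
  assumes g: "g \<in> L2" and F: "\<And>r. r \<in> S \<Longrightarrow> F r \<in> L2" and F': "F' \<in> L2" and s: "s \<in> S"
    and lim: "((\<lambda>r. L2_norm (\<lambda>\<xi>. (F r \<xi> - F s \<xi>) / complex_of_real (r - s) - F' \<xi>)) \<longlongrightarrow> 0) (at s within S)"
    and [measurable]: "\<And>r. m r \<in> borel_measurable borel" "m' \<in> borel_measurable borel"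
    and bnd: "\<And>r \<xi>. r \<in> S \<Longrightarrow> g \<xi> \<noteq> 0 \<Longrightarrow> cmod (m r \<xi>) \<le> M"
    and bnd': "\<And>\<xi>. g \<xi> \<noteq> 0 \<Longrightarrow> cmod (m' \<xi>) \<le> M"
    and Taylor: "\<And>r \<xi>. r \<in> S \<Longrightarrow> g \<xi> \<noteq> 0 \<Longrightarrow> cmod (m r \<xi> - m s \<xi> - complex_of_real (r - s) * m' \<xi>) \<le> M * (r - s)\<^sup>2"
    and Lip: "\<And>r \<xi>. r \<in> S \<Longrightarrow> g \<xi> \<noteq> 0 \<Longrightarrow> cmod (m r \<xi> - m s \<xi>) \<le> M * \<bar>r - s\<bar>" and M: "M \<ge> 0"
  shows "((\<lambda>r. LINT \<xi>|lborel. m r \<xi> * g \<xi> * F r \<xi>) has_vector_derivative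
      ((LINT \<xi>|lborel. m' \<xi> * g \<xi> * F s \<xi>) + (LINT \<xi>|lborel. m s \<xi> * g \<xi> * F' \<xi>))) (at s within S)"
proof -
  let ?h = "\<lambda>r. LINT \<xi>|lborel. m r \<xi> * g \<xi> * F r \<xi>"
  let ?L = "(LINT \<xi>|lborel. m' \<xi> * g \<xi> * F s \<xi>) + (LINT \<xi>|lborel. m s \<xi> * g \<xi> * F' \<xi>)"
  let ?e = "\<lambda>r \<xi>. (F r \<xi> - F s \<xi>) / complex_of_real (r - s) - F' \<xi>"
  let ?N = "L2_norm g"
  have [measurable]: "g \<in> borel_measurable borel" "F' \<in> borel_measurable borel" "F s \<in> borel_measurable borel"
    using g F' F[OF s] by (auto intro: L2_measurable)
  have mg: "(\<lambda>\<xi>. k \<xi> * g \<xi>) \<in> L2" "L2_norm (\<lambda>\<xi>. k \<xi> * g \<xi>) \<le> K * ?N"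
    if [measurable]: "k \<in> borel_measurable borel" and k: "\<And>\<xi>. g \<xi> \<noteq> 0 \<Longrightarrow> cmod (k \<xi>) \<le> K" and "K \<ge> 0" for k K
  proof -
    have "cmod (k \<xi> * g \<xi>) \<le> K * cmod (g \<xi>)" for \<xi>
      using k[of \<xi>] by (cases "g \<xi> = 0") (auto simp: norm_mult intro: mult_right_mono)
    then show "(\<lambda>\<xi>. k \<xi> * g \<xi>) \<in> L2" "L2_norm (\<lambda>\<xi>. k \<xi> * g \<xi>) \<le> K * ?N"
      using L2_scaled_bound[OF g, of "\<lambda>\<xi>. k \<xi> * g \<xi>" K] \<open>K \<ge> 0\<close> by auto
  qed
  have pair: "cmod (LINT \<xi>|lborel. k \<xi> * g \<xi> * G \<xi>) \<le> K * ?N * L2_norm G" "integrable lborel (\<lambda>\<xi>. k \<xi> * g \<xi> * G \<xi>)"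
    if "k \<in> borel_measurable borel" "\<And>\<xi>. g \<xi> \<noteq> 0 \<Longrightarrow> cmod (k \<xi>) \<le> K" "K \<ge> 0" "G \<in> L2" for k K G
    using L2_mult_integrable[OF mg(1)[OF that(1-3)] that(4)] mult_right_mono[OF mg(2)[OF that(1-3)] L2_norm_nonneg[of G]]
    by auto
  define b where "b r = M * ?N * L2_norm (?e r) + M * \<bar>r - s\<bar> * ?N * L2_norm (F s) + M * \<bar>r - s\<bar> * ?N * L2_norm F'" for r
  have est: "cmod ((?h r - ?h s) /\<^sub>R (r - s) - ?L) \<le> b r" if r: "r \<in> S" "r \<noteq> s" for r
  proof -
    let ?c = "complex_of_real (r - s)"
    have c: "?c \<noteq> 0" using r by simp
    have [measurable]: "F r \<in> borel_measurable borel" using F[OF r(1)] by (rule L2_measurable)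
    have eL2: "?e r \<in> L2"
      using L2_diff[OF L2_cmult[OF L2_diff[OF F[OF r(1)] F[OF s]], of "inverse ?c"] F'] by (simp add: divide_inverse mult.commute)
    define k where "k \<xi> = (m r \<xi> - m s \<xi> - ?c * m' \<xi>) / ?c" for \<xi>
    have kb: "cmod (k \<xi>) \<le> M * \<bar>r - s\<bar>" if "g \<xi> \<noteq> 0" for \<xi>
    proof -
      have "cmod (k \<xi>) = cmod (m r \<xi> - m s \<xi> - ?c * m' \<xi>) / \<bar>r - s\<bar>"
        unfolding k_def norm_divide norm_of_real ..
      also have "\<dots> \<le> M * (r - s)\<^sup>2 / \<bar>r - s\<bar>"
        by (intro divide_right_mono Taylor r that) auto
      also have "\<dots> = M * \<bar>r - s\<bar>" using r by (simp add: power2_eq_square abs_if field_simps)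
      finally show ?thesis .
    qed
    have [measurable]: "k \<in> borel_measurable borel" unfolding k_def by measurable
    note I1 = pair[OF _ bnd[OF r(1)] M eL2, simplified]
    note I2 = pair[of k "M * \<bar>r - s\<bar>", OF _ kb _ F[OF s]]
    note I3 = pair[of "\<lambda>\<xi>. m r \<xi> - m s \<xi>" "M * \<bar>r - s\<bar>", OF _ Lip[OF r(1)] _ F']
    \<comment> \<open>The three terms: error of \<open>F\<close>, error of \<open>m\<close>, and the increment of \<open>m\<close> against \<open>F'\<close>.\<close>
    have split: "inverse ?c * (m r \<xi> * g \<xi> * F r \<xi> - m s \<xi> * g \<xi> * F s \<xi>) - (m' \<xi> * g \<xi> * F s \<xi> + m s \<xi> * g \<xi> * F' \<xi>)
       = m r \<xi> * g \<xi> * ?e r \<xi> + k \<xi> * g \<xi> * F s \<xi> + (m r \<xi> - m s \<xi>) * g \<xi> * F' \<xi>" for \<xi>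
    proof -
      have "F r \<xi> = F s \<xi> + ?c * (?e r \<xi> + F' \<xi>)" using c by simp
      moreover have "m r \<xi> = m s \<xi> + ?c * (m' \<xi> + k \<xi>)" using c by (simp add: k_def field_simps)
      moreover have "inverse ?c * ?c = 1" using c by simp
      ultimately show ?thesis by algebra
    qed
    have i1: "integrable lborel (\<lambda>\<xi>. m r \<xi> * g \<xi> * F r \<xi>)" by (rule pair(2)[OF _ bnd[OF r(1)] M F[OF r(1)]]) simp
    have i2: "integrable lborel (\<lambda>\<xi>. m s \<xi> * g \<xi> * F s \<xi>)" by (rule pair(2)[OF _ bnd[OF s] M F[OF s]]) simp
    have i3: "integrable lborel (\<lambda>\<xi>. m' \<xi> * g \<xi> * F s \<xi>)" by (rule pair(2)[OF _ bnd' M F[OF s]]) simp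
    have i4: "integrable lborel (\<lambda>\<xi>. m s \<xi> * g \<xi> * F' \<xi>)" by (rule pair(2)[OF _ bnd[OF s] M F']) simp
    have "(?h r - ?h s) /\<^sub>R (r - s) - ?L = inverse ?c * (?h r - ?h s) - ?L"
      by (simp add: scaleR_conv_of_real)
    also have "\<dots> = (LINT \<xi>|lborel. inverse ?c * (m r \<xi> * g \<xi> * F r \<xi> - m s \<xi> * g \<xi> * F s \<xi>) - (m' \<xi> * g \<xi> * F s \<xi> + m s \<xi> * g \<xi> * F' \<xi>))"
      using i1 i2 i3 i4 by (simp add: Bochner_Integration.integral_diff Bochner_Integration.integral_add)
    also have "\<dots> = (LINT \<xi>|lborel. m r \<xi> * g \<xi> * ?e r \<xi>) + (LINT \<xi>|lborel. k \<xi> * g \<xi> * F s \<xi>)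
         + (LINT \<xi>|lborel. (m r \<xi> - m s \<xi>) * g \<xi> * F' \<xi>)"
      unfolding split using I1(2) I2(2) I3(2) M
      by (subst Bochner_Integration.integral_add, simp, simp, subst Bochner_Integration.integral_add) auto
    also have "cmod \<dots> \<le> b r"
      unfolding b_def using I1(1) I2(1) I3(1) M by (intro norm_triangle_le add_mono) auto
    finally show ?thesis .
  qed
  have "(b \<longlongrightarrow> M * ?N * 0 + M * \<bar>s - s\<bar> * ?N * L2_norm (F s) + M * \<bar>s - s\<bar> * ?N * L2_norm F') (at s within S)"
    unfolding b_def by (intro tendsto_intros lim)
  then have b0: "(b \<longlongrightarrow> 0) (at s within S)" by simp
  have "((\<lambda>r. (?h r - ?h s) /\<^sub>R (r - s) - ?L) \<longlongrightarrow> 0) (at s within S)"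
    by (rule Lim_null_comparison[OF _ b0]) (use est in \<open>auto simp: eventually_at_filter\<close>)
  then have "((\<lambda>r. (?h r - ?h s) /\<^sub>R (r - s)) \<longlongrightarrow> ?L) (at s within S)"
    by (simp add: LIM_zero_iff)
  then show ?thesis by (rule has_vector_derivative_quotientI)
qed

lemma Taylor_bounds:
  fixes m :: "real \<Rightarrow> real"
  assumes m: "\<And>r. (m has_field_derivative m1 r) (at r)" and m1: "\<And>r. (m1 has_field_derivative m2 r) (at r)"
    and b1: "\<And>r. r \<in> {a..b} \<Longrightarrow> \<bar>m1 r\<bar> \<le> K" and b2: "\<And>r. r \<in> {a..b} \<Longrightarrow> \<bar>m2 r\<bar> \<le> K"
    and rs: "r \<in> {a..b}" "s \<in> {a..b}"
  shows "\<bar>m r - m s\<bar> \<le> K * \<bar>r - s\<bar>" "\<bar>m r - m s - (r - s) * m1 s\<bar> \<le> K * (r - s)\<^sup>2"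
proof -
  show "\<bar>m r - m s\<bar> \<le> K * \<bar>r - s\<bar>"
    using field_differentiable_bound[of "{a..b}" m m1 K r s] m b1 rs by (auto intro: has_field_derivative_at_within)
  let ?J = "closed_segment s r"
  have J: "?J \<subseteq> {a..b}" using rs by (simp add: closed_segment_subset)
  have seg: "\<bar>x - s\<bar> \<le> \<bar>r - s\<bar>" if "x \<in> ?J" for x
    using that by (auto simp: closed_segment_eq_real_ivl split: if_splits)
  have "\<bar>m1 x - m1 s\<bar> \<le> K * \<bar>r - s\<bar>" if x: "x \<in> ?J" for x
  proof -
    have "\<bar>m1 x - m1 s\<bar> \<le> K * \<bar>x - s\<bar>"
      using field_differentiable_bound[of "{a..b}" m1 m2 K x s] m1 b2 rs subsetD[OF J x] by (auto intro: has_field_derivative_at_within)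
    also have "\<dots> \<le> K * \<bar>r - s\<bar>" using seg[OF x] b1[OF rs(1)] by (intro mult_left_mono) auto
    finally show ?thesis .
  qed
  moreover have "((\<lambda>x. m x - x * m1 s) has_field_derivative m1 x - m1 s) (at x within ?J)" for x
    by (auto intro!: derivative_eq_intros has_field_derivative_at_within[OF m])
  ultimately have "norm ((m r - r * m1 s) - (m s - s * m1 s)) \<le> K * \<bar>r - s\<bar> * norm (r - s)"
    by (intro field_differentiable_bound[of ?J _ "\<lambda>x. m1 x - m1 s"]) auto
  then show "\<bar>m r - m s - (r - s) * m1 s\<bar> \<le> K * (r - s)\<^sup>2"
    by (simp add: algebra_simps power2_eq_square abs_mult_self_eq)
qed

lemma prop_bounded_in_time:
  assumes "0 \<le> t" "t \<le> T" "0 \<le> T"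
  shows "\<bar>prop1 t \<rho>\<bar> \<le> T" "\<bar>prop0 t \<rho>\<bar> \<le> 1 + T"
proof -
  have e: "exp (- decay \<rho> * t) \<le> 1" using decay_nonneg[of \<rho>] assms by simp
  show "\<bar>prop1 t \<rho>\<bar> \<le> T"
    using prop1_bound[OF assms(1), of \<rho>] mult_left_mono[OF e assms(1)] assms(2) by linarith
  show "\<bar>prop0 t \<rho>\<bar> \<le> 1 + T"
  proof -
    have "(1 + t) * exp (- decay \<rho> * t) \<le> (1 + t) * 1"
      using assms(1) by (intro mult_left_mono e) auto
    then show ?thesis using prop0_bound[OF assms(1), of \<rho>] assms(2) unfolding mult_1_right by linarith
  qed
qed

lemma prop_measurable[measurable]:
  "(\<lambda>\<rho>. prop1 t \<rho>) \<in> borel_measurable borel" "(\<lambda>\<rho>. prop0 t \<rho>) \<in> borel_measurable borel"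
  unfolding prop1_def prop0_def ysin_def ycos_def discr_def damping_def sinh_def cosh_def by measurable

text \<open>
  The hypotheses of \<open>pairing_derivative\<close> for the propagators running backwards from time \<open>T\<close>, uniformly
  in \<open>\<rho> \<le> R\<close>: their first two time derivatives are combinations of the propagators with coefficients bounded
  in terms of \<open>R\<close>.
\<close>
lemma prop_Taylor:
  fixes \<rho> R T :: real
  assumes \<rho>: "0 \<le> \<rho>" "\<rho> \<le> R" and T: "0 \<le> T" and rs: "r \<in> {0..T}" "s \<in> {0..T}"
  defines "K \<equiv> (1 + R\<^sup>2) * (2 + 3 * T)"
  shows "\<bar>prop1 (T - r) \<rho>\<bar> \<le> K" "\<bar>prop0 (T - r) \<rho>\<bar> \<le> K"
    "\<bar>damping \<rho> * prop1 (T - s) \<rho> - prop0 (T - s) \<rho>\<bar> \<le> K" "\<bar>\<rho>\<^sup>2 * prop1 (T - s) \<rho>\<bar> \<le> K"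
    "\<bar>prop1 (T - r) \<rho> - prop1 (T - s) \<rho>\<bar> \<le> K * \<bar>r - s\<bar>"
    "\<bar>prop0 (T - r) \<rho> - prop0 (T - s) \<rho>\<bar> \<le> K * \<bar>r - s\<bar>"
    "\<bar>prop1 (T - r) \<rho> - prop1 (T - s) \<rho> - (r - s) * (damping \<rho> * prop1 (T - s) \<rho> - prop0 (T - s) \<rho>)\<bar> \<le> K * (r - s)\<^sup>2"
    "\<bar>prop0 (T - r) \<rho> - prop0 (T - s) \<rho> - (r - s) * (\<rho>\<^sup>2 * prop1 (T - s) \<rho>)\<bar> \<le> K * (r - s)\<^sup>2"
proof -
  let ?a = "damping \<rho>"
  let ?q = "\<lambda>x. prop1 (T - x) \<rho>" let ?p = "\<lambda>x. prop0 (T - x) \<rho>"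
  have R2: "\<rho>\<^sup>2 \<le> R\<^sup>2" using \<rho> by (intro power_mono) auto
  have q: "\<bar>?q x\<bar> \<le> T" and p: "\<bar>?p x\<bar> \<le> 1 + T" if "x \<in> {0..T}" for x
    using prop_bounded_in_time[of "T - x" T \<rho>] that T by auto
  have a: "\<bar>?a * x\<bar> \<le> \<bar>x\<bar>" for x
    using damping_bounds[of \<rho>] by (simp add: abs_mult mult_left_le_one_le)
  have q1: "\<bar>?a * ?q x - ?p x\<bar> \<le> 1 + 2 * T" if "x \<in> {0..T}" for x
    using a[of "?q x"] q[OF that] p[OF that] by linarith
  have rho: "\<bar>\<rho>\<^sup>2 * y\<bar> \<le> R\<^sup>2 * Y" if "\<bar>y\<bar> \<le> Y" for y Y
    unfolding abs_mult using R2 that by (intro mult_mono) auto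
  have big: "R\<^sup>2 * (1 + 2 * T) + (2 + 3 * T) \<le> K"
    using T by (simp add: K_def algebra_simps)
  have K1: "x \<le> K" if "x \<le> 2 + 3 * T" for x
    using that big T zero_le_power2[of R] mult_nonneg_nonneg[of "R\<^sup>2" "1 + 2 * T"] by linarith
  have K2: "x \<le> K" if "x \<le> R\<^sup>2 * (1 + 2 * T)" for x
    using that big T by linarith
  have RT: "R\<^sup>2 * T \<le> R\<^sup>2 * (1 + 2 * T)" using T by (intro mult_left_mono) auto
  have d1: "(?q has_field_derivative (?a * ?q x - ?p x)) (at x)" for x
    by (rule DERIV_cong[OF DERIV_chain2[OF prop1_DERIV]]) (auto intro!: derivative_eq_intros)
  have d0: "(?p has_field_derivative (\<rho>\<^sup>2 * ?q x)) (at x)" for x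
    by (rule DERIV_cong[OF DERIV_chain2[OF prop0_DERIV]]) (auto intro!: derivative_eq_intros)
  have d11: "((\<lambda>x. ?a * ?q x - ?p x) has_field_derivative (?a * (?a * ?q x - ?p x) - \<rho>\<^sup>2 * ?q x)) (at x)" for x
    by (auto intro!: derivative_eq_intros d0 d1)
  have d00: "((\<lambda>x. \<rho>\<^sup>2 * ?q x) has_field_derivative (\<rho>\<^sup>2 * (?a * ?q x - ?p x))) (at x)" for x
    by (auto intro!: derivative_eq_intros d1)
  have b1: "\<bar>?a * ?q x - ?p x\<bar> \<le> K" and b0: "\<bar>\<rho>\<^sup>2 * ?q x\<bar> \<le> K"
    and b11: "\<bar>?a * (?a * ?q x - ?p x) - \<rho>\<^sup>2 * ?q x\<bar> \<le> K" and b00: "\<bar>\<rho>\<^sup>2 * (?a * ?q x - ?p x)\<bar> \<le> K" if x: "x \<in> {0..T}" for x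
  proof -
    show "\<bar>?a * ?q x - ?p x\<bar> \<le> K" using q1[OF x] T by (intro K1) auto
    show "\<bar>\<rho>\<^sup>2 * ?q x\<bar> \<le> K" using rho[OF q[OF x]] RT by (intro K2) auto
    show "\<bar>\<rho>\<^sup>2 * (?a * ?q x - ?p x)\<bar> \<le> K" using rho[OF q1[OF x]] by (intro K2) auto
    have "\<bar>?a * (?a * ?q x - ?p x) - \<rho>\<^sup>2 * ?q x\<bar> \<le> (1 + 2 * T) + R\<^sup>2 * T"
      using a[of "?a * ?q x - ?p x"] q1[OF x] rho[OF q[OF x]] by linarith
    also have "\<dots> \<le> K" using big RT T by linarith
    finally show "\<bar>?a * (?a * ?q x - ?p x) - \<rho>\<^sup>2 * ?q x\<bar> \<le> K" .
  qed
  show "\<bar>?q r\<bar> \<le> K" "\<bar>?p r\<bar> \<le> K" using q[OF rs(1)] p[OF rs(1)] T by (auto intro!: K1)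
  show "\<bar>?a * ?q s - ?p s\<bar> \<le> K" "\<bar>\<rho>\<^sup>2 * ?q s\<bar> \<le> K" using b1 b0 rs by auto
  show "\<bar>?q r - ?q s\<bar> \<le> K * \<bar>r - s\<bar>" "\<bar>?q r - ?q s - (r - s) * (?a * ?q s - ?p s)\<bar> \<le> K * (r - s)\<^sup>2"
    using Taylor_bounds[OF d1 d11 b1 b11 rs] by auto
  show "\<bar>?p r - ?p s\<bar> \<le> K * \<bar>r - s\<bar>" "\<bar>?p r - ?p s - (r - s) * (\<rho>\<^sup>2 * ?q s)\<bar> \<le> K * (r - s)\<^sup>2"
    using Taylor_bounds[OF d0 d00 b0 b00 rs] by auto
qed

text \<open>
  Duhamel's argument without sources. For fixed \<open>T\<close> and \<open>g\<close> supported in a ball, the pairing of \<open>g\<close> with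
  \<open>prop1 (T - s) V(s) + prop0 (T - s) U(s)\<close> has derivative 0 in \<open>s\<close>: the two propagators solve the adjoint
  system. Its values at \<open>s = T\<close> and \<open>s = 0\<close> are the pairings with the two sides of the claim, so choosing for
  \<open>g\<close> the conjugate of their difference \<open>Z\<close> on the ball shows that \<open>Z\<close> vanishes there. The equation
  is assumed for positive times only, so at \<open>s = 0\<close> continuity is used instead of the derivative.
\<close>
lemma oscillator_solution:
  fixes U V W :: "real \<Rightarrow> 'a::euclidean_space \<Rightarrow> complex"
  assumes L2: "\<And>t. t \<ge> 0 \<Longrightarrow> U t \<in> L2" "\<And>t. t \<ge> 0 \<Longrightarrow> V t \<in> L2" "\<And>t. t \<ge> 0 \<Longrightarrow> W t \<in> L2"
    and dU: "\<And>t. t \<ge> 0 \<Longrightarrow> ((\<lambda>r. L2_norm (\<lambda>\<xi>. (U r \<xi> - U t \<xi>) / complex_of_real (r - t) - V t \<xi>)) \<longlongrightarrow> 0) (at t within {0..})"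
    and dV: "\<And>t. t \<ge> 0 \<Longrightarrow> ((\<lambda>r. L2_norm (\<lambda>\<xi>. (V r \<xi> - V t \<xi>) / complex_of_real (r - t) - W t \<xi>)) \<longlongrightarrow> 0) (at t within {0..})"
    and eq: "\<And>t. t > 0 \<Longrightarrow> AE \<xi> in lborel. W t \<xi> + complex_of_real (damping (norm \<xi>)) * V t \<xi> + complex_of_real ((norm \<xi>)\<^sup>2) * U t \<xi> = 0"
    and T: "T > 0"
  shows "AE \<xi> in lborel. U T \<xi> = complex_of_real (prop0 T (norm \<xi>)) * U 0 \<xi> + complex_of_real (prop1 T (norm \<xi>)) * V 0 \<xi>"
proof -
  have [measurable]: "U t \<in> borel_measurable borel" "V t \<in> borel_measurable borel" "W t \<in> borel_measurable borel" if "t \<ge> 0" for t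
    using L2 that by (auto intro: L2_measurable)
  have [measurable]: "U 0 \<in> borel_measurable borel" "V 0 \<in> borel_measurable borel" "U T \<in> borel_measurable borel"
    using T by auto
  define q where "q s \<xi> = complex_of_real (prop1 (T - s) (norm \<xi>))" for s and \<xi> :: 'a
  define p where "p s \<xi> = complex_of_real (prop0 (T - s) (norm \<xi>))" for s and \<xi> :: 'a
  define q' where "q' s \<xi> = complex_of_real (damping (norm \<xi>) * prop1 (T - s) (norm \<xi>) - prop0 (T - s) (norm \<xi>))" for s and \<xi> :: 'a
  define p' where "p' s \<xi> = complex_of_real ((norm \<xi>)\<^sup>2 * prop1 (T - s) (norm \<xi>))" for s and \<xi> :: 'a
  have [measurable]: "q s \<in> borel_measurable borel" "p s \<in> borel_measurable borel" "q' s \<in> borel_measurable borel" "p' s \<in> borel_measurable borel" for s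
    unfolding q_def p_def q'_def p'_def damping_def by measurable
  define Z where "Z \<xi> = U T \<xi> - (p 0 \<xi> * U 0 \<xi> + q 0 \<xi> * V 0 \<xi>)" for \<xi>
  have "AE \<xi> in lborel. norm \<xi> \<le> real N \<longrightarrow> Z \<xi> = 0" for N :: nat
  proof -
    define R where "R = real N"
    define K where "K = (1 + R\<^sup>2) * (2 + 3 * T)"
    have K: "K \<ge> 0" using T by (simp add: K_def)
    define B where "B = cball (0::'a) R"
    have [measurable]: "B \<in> sets borel" by (simp add: B_def)
    have inB: "norm \<xi> \<le> R" if "indicat_real B \<xi> *\<^sub>R z \<noteq> 0" for \<xi> and z :: complex
      using that by (auto simp: B_def indicator_def split: if_splits)
    note PT = prop_Taylor[OF norm_ge_zero _ less_imp_le[OF T], of _ R, folded K_def]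
    \<comment> \<open>With this \<open>g\<close> the pairing of \<open>Z\<close> with \<open>g\<close> is the squared \<open>L2\<close> norm of \<open>g\<close>.\<close>
    define g where "g \<xi> = indicat_real B \<xi> *\<^sub>R cnj (Z \<xi>)" for \<xi>
    have gR: "norm \<xi> \<le> R" if "g \<xi> \<noteq> 0" for \<xi>
      using that unfolding g_def by (rule inB)
    have [measurable]: "Z \<in> borel_measurable borel" unfolding Z_def by measurable
    have [measurable]: "g \<in> borel_measurable borel" unfolding g_def by measurable
    have BL2: "(\<lambda>\<xi>. indicat_real B \<xi> *\<^sub>R f \<xi>) \<in> L2" if "f \<in> L2" for f :: "'a \<Rightarrow> complex"
      using that by (intro L2_bound[OF that]) (auto simp: indicator_def dest!: L2_measurable)
    have gL2: "g \<in> L2"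
    proof -
      have "(\<lambda>\<xi>. U T \<xi> - (p 0 \<xi> * (indicat_real B \<xi> *\<^sub>R U 0 \<xi>) + q 0 \<xi> * (indicat_real B \<xi> *\<^sub>R V 0 \<xi>))) \<in> L2"
      proof (intro L2_diff L2_add)
        show "(\<lambda>\<xi>. p 0 \<xi> * (indicat_real B \<xi> *\<^sub>R U 0 \<xi>)) \<in> L2"
          by (rule L2_bounded_mult[OF BL2[OF L2(1)], where M = K]) (use PT(2)[OF inB, of _ _ 0 0] T in \<open>auto simp: p_def\<close>)
        show "(\<lambda>\<xi>. q 0 \<xi> * (indicat_real B \<xi> *\<^sub>R V 0 \<xi>)) \<in> L2"
          by (rule L2_bounded_mult[OF BL2[OF L2(2)], where M = K]) (use PT(1)[OF inB, of _ _ 0 0] T in \<open>auto simp: q_def\<close>)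
      qed (use L2 T in auto)
      then show ?thesis
      proof (rule L2_bound)
        have "cmod (g \<xi>) \<le> cmod (U T \<xi> - (p 0 \<xi> * (indicat_real B \<xi> *\<^sub>R U 0 \<xi>) + q 0 \<xi> * (indicat_real B \<xi> *\<^sub>R V 0 \<xi>)))" for \<xi>
        proof -
          have "cmod (g \<xi>) = indicat_real B \<xi> * cmod (Z \<xi>)" by (simp add: g_def)
          then show ?thesis by (cases "\<xi> \<in> B") (auto simp: Z_def)
        qed
        then show "AE \<xi> in lborel. cmod (g \<xi>) \<le> cmod (U T \<xi> - (p 0 \<xi> * (indicat_real B \<xi> *\<^sub>R U 0 \<xi>) + q 0 \<xi> * (indicat_real B \<xi> *\<^sub>R V 0 \<xi>)))"
          by simp
      qed simp
    qed
    define h where "h s = (LINT \<xi>|lborel. q s \<xi> * g \<xi> * V s \<xi>) + (LINT \<xi>|lborel. p s \<xi> * g \<xi> * U s \<xi>)" for s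
    define h' where "h' s = ((LINT \<xi>|lborel. q' s \<xi> * g \<xi> * V s \<xi>) + (LINT \<xi>|lborel. q s \<xi> * g \<xi> * W s \<xi>))
        + ((LINT \<xi>|lborel. p' s \<xi> * g \<xi> * U s \<xi>) + (LINT \<xi>|lborel. p s \<xi> * g \<xi> * V s \<xi>))" for s
    have der: "(h has_vector_derivative h' s) (at s within {0..T})" if s: "s \<in> {0..T}" for s
    proof -
      have sub: "at s within {0..T} \<le> at s within {0..}" by (intro at_le) auto
      show ?thesis
        unfolding h_def[abs_def] h'_def
      proof (intro has_vector_derivative_add pairing_derivative[where M = K])
        show "((\<lambda>r. L2_norm (\<lambda>\<xi>. (V r \<xi> - V s \<xi>) / complex_of_real (r - s) - W s \<xi>)) \<longlongrightarrow> 0) (at s within {0..T})"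
          using s by (intro tendsto_mono[OF sub dV]) auto
        show "((\<lambda>r. L2_norm (\<lambda>\<xi>. (U r \<xi> - U s \<xi>) / complex_of_real (r - s) - V s \<xi>)) \<longlongrightarrow> 0) (at s within {0..T})"
          using s by (intro tendsto_mono[OF sub dU]) auto
        fix r \<xi> assume r: "r \<in> {0..T}" and g: "g \<xi> \<noteq> 0"
        note P = PT[OF gR[OF g] r s]
        show "cmod (q r \<xi>) \<le> K" unfolding q_def norm_of_real by (rule P(1))
        show "cmod (p r \<xi>) \<le> K" unfolding p_def norm_of_real by (rule P(2))
        show "cmod (q r \<xi> - q s \<xi>) \<le> K * \<bar>r - s\<bar>"
          unfolding q_def of_real_diff[symmetric] norm_of_real by (rule P(5))
        show "cmod (p r \<xi> - p s \<xi>) \<le> K * \<bar>r - s\<bar>"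
          unfolding p_def of_real_diff[symmetric] norm_of_real by (rule P(6))
        show "cmod (q r \<xi> - q s \<xi> - complex_of_real (r - s) * q' s \<xi>) \<le> K * (r - s)\<^sup>2"
          unfolding q_def q'_def of_real_diff[symmetric] of_real_mult[symmetric] norm_of_real by (rule P(7))
        show "cmod (p r \<xi> - p s \<xi> - complex_of_real (r - s) * p' s \<xi>) \<le> K * (r - s)\<^sup>2"
          unfolding p_def p'_def of_real_diff[symmetric] of_real_mult[symmetric] norm_of_real by (rule P(8))
      next
        fix \<xi> assume g: "g \<xi> \<noteq> 0"
        note P = PT[OF gR[OF g] s s]
        show "cmod (q' s \<xi>) \<le> K" unfolding q'_def norm_of_real by (rule P(3))
        show "cmod (p' s \<xi>) \<le> K" unfolding p'_def norm_of_real by (rule P(4))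
      qed (use L2 gL2 s K in auto)
    qed
    have h'0: "h' s = 0" if s: "s \<in> {0<..T}" for s
    proof -
      have s0: "s \<ge> 0" and sT: "s \<in> {0..T}" using s by auto
      note [measurable] = L2_measurable[OF L2(1)[OF s0]] L2_measurable[OF L2(2)[OF s0]] L2_measurable[OF L2(3)[OF s0]]
      have int: "integrable lborel (\<lambda>\<xi>. k \<xi> * g \<xi> * G \<xi>)"
        if "k \<in> borel_measurable borel" "\<And>\<xi>. g \<xi> \<noteq> 0 \<Longrightarrow> cmod (k \<xi>) \<le> K" "G \<in> L2" for k G
        by (intro L2_mult_integrable L2_bounded_mult[OF gL2, where M = K] that)
      have bd: "cmod (q s \<xi>) \<le> K" "cmod (p s \<xi>) \<le> K" "cmod (q' s \<xi>) \<le> K" "cmod (p' s \<xi>) \<le> K" if "g \<xi> \<noteq> 0" for \<xi>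
        using PT(1-4)[OF gR[OF that] sT sT] unfolding q_def p_def q'_def p'_def norm_of_real by simp_all
      have i: "integrable lborel (\<lambda>\<xi>. q' s \<xi> * g \<xi> * V s \<xi>)" "integrable lborel (\<lambda>\<xi>. q s \<xi> * g \<xi> * W s \<xi>)"
        "integrable lborel (\<lambda>\<xi>. p' s \<xi> * g \<xi> * U s \<xi>)" "integrable lborel (\<lambda>\<xi>. p s \<xi> * g \<xi> * V s \<xi>)"
        by (intro int bd L2 s0; measurable)+
      have "h' s = (LINT \<xi>|lborel. q' s \<xi> * g \<xi> * V s \<xi> + q s \<xi> * g \<xi> * W s \<xi> + (p' s \<xi> * g \<xi> * U s \<xi> + p s \<xi> * g \<xi> * V s \<xi>))"
        unfolding h'_def using i by (simp add: Bochner_Integration.integral_add)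
      also have "\<dots> = integral\<^sup>L lborel (\<lambda>\<xi>::'a. 0)"
      proof (rule integral_cong_AE)
        have "0 < s" using s by simp
        from eq[OF this]
        show "AE \<xi> in lborel. q' s \<xi> * g \<xi> * V s \<xi> + q s \<xi> * g \<xi> * W s \<xi> + (p' s \<xi> * g \<xi> * U s \<xi> + p s \<xi> * g \<xi> * V s \<xi>) = 0"
        proof eventually_elim
          case (elim \<xi>)
          have "q' s \<xi> * g \<xi> * V s \<xi> + q s \<xi> * g \<xi> * W s \<xi> + (p' s \<xi> * g \<xi> * U s \<xi> + p s \<xi> * g \<xi> * V s \<xi>)
             = q s \<xi> * g \<xi> * (W s \<xi> + complex_of_real (damping (norm \<xi>)) * V s \<xi> + complex_of_real ((norm \<xi>)\<^sup>2) * U s \<xi>)"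
            unfolding q'_def p'_def q_def p_def of_real_diff of_real_mult by (simp add: algebra_simps)
          then show ?case using elim by simp
        qed
      qed measurable
      finally show ?thesis by simp
    qed
    have "h T = h 0"
    proof (rule has_derivative_zero_unique_strong_interval[of "{0}" 0 T h "h 0" T])
      show "continuous_on {0..T} h"
        unfolding continuous_on_eq_continuous_within
        by (intro ballI has_vector_derivative_continuous[OF der])
      show "(h has_derivative (\<lambda>h. 0)) (at x within {0..T})" if "x \<in> {0..T} - {0}" for x
        using der[of x] h'0[of x] that by (auto simp: has_vector_derivative_def)
    qed (use T in auto)
    moreover have "h T = (LINT \<xi>|lborel. U T \<xi> * g \<xi>)"
      by (simp add: h_def q_def p_def mult.commute)
    moreover have "h 0 = (LINT \<xi>|lborel. (p 0 \<xi> * U 0 \<xi> + q 0 \<xi> * V 0 \<xi>) * g \<xi>)"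
      and i0: "integrable lborel (\<lambda>\<xi>. (p 0 \<xi> * U 0 \<xi> + q 0 \<xi> * V 0 \<xi>) * g \<xi>)"
    proof -
      have bd: "cmod (q 0 \<xi>) \<le> K" "cmod (p 0 \<xi>) \<le> K" if "g \<xi> \<noteq> 0" for \<xi>
        using PT(1-2)[OF gR[OF that], of 0 0] T unfolding q_def p_def norm_of_real by auto
      have i: "integrable lborel (\<lambda>\<xi>. q 0 \<xi> * g \<xi> * V 0 \<xi>)" "integrable lborel (\<lambda>\<xi>. p 0 \<xi> * g \<xi> * U 0 \<xi>)"
        by (intro L2_mult_integrable L2_bounded_mult[OF gL2, where M = K] L2 bd order_refl; measurable)+
      have e: "(p 0 \<xi> * U 0 \<xi> + q 0 \<xi> * V 0 \<xi>) * g \<xi> = q 0 \<xi> * g \<xi> * V 0 \<xi> + p 0 \<xi> * g \<xi> * U 0 \<xi>" for \<xi>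
        by (simp add: algebra_simps)
      show "h 0 = (LINT \<xi>|lborel. (p 0 \<xi> * U 0 \<xi> + q 0 \<xi> * V 0 \<xi>) * g \<xi>)"
        unfolding e h_def using i by (simp add: Bochner_Integration.integral_add)
      show "integrable lborel (\<lambda>\<xi>. (p 0 \<xi> * U 0 \<xi> + q 0 \<xi> * V 0 \<xi>) * g \<xi>)"
        unfolding e using i by simp
    qed
    moreover have iT: "integrable lborel (\<lambda>\<xi>. U T \<xi> * g \<xi>)"
      using T by (intro L2_mult_integrable L2 gL2) auto
    ultimately have "(LINT \<xi>|lborel. U T \<xi> * g \<xi> - (p 0 \<xi> * U 0 \<xi> + q 0 \<xi> * V 0 \<xi>) * g \<xi>) = 0"
      by (simp add: Bochner_Integration.integral_diff)
    moreover have "U T \<xi> * g \<xi> - (p 0 \<xi> * U 0 \<xi> + q 0 \<xi> * V 0 \<xi>) * g \<xi> = complex_of_real ((cmod (g \<xi>))\<^sup>2)" for \<xi>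
    proof -
      have "U T \<xi> * g \<xi> - (p 0 \<xi> * U 0 \<xi> + q 0 \<xi> * V 0 \<xi>) * g \<xi> = Z \<xi> * g \<xi>"
        by (simp add: Z_def left_diff_distrib)
      also have "\<dots> = g \<xi> * cnj (g \<xi>)" by (auto simp: g_def indicator_def)
      finally show ?thesis by (simp only: complex_norm_square)
    qed
    ultimately have "(LINT \<xi>|lborel. (cmod (g \<xi>))\<^sup>2) = 0" by (simp add: integral_complex_of_real del: of_real_power)
    then have "AE \<xi> in lborel. (cmod (g \<xi>))\<^sup>2 = 0"
      using integral_nonneg_eq_0_iff_AE[OF L2_sq_integrable[OF gL2]] by auto
    then show ?thesis
      by eventually_elim (auto simp: g_def B_def R_def indicator_def)
  qed
  then have "AE \<xi> in lborel. \<forall>N::nat. norm \<xi> \<le> real N \<longrightarrow> Z \<xi> = 0"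
    by (intro AE_all_countable[THEN iffD2] allI)
  then show ?thesis
  proof eventually_elim
    case (elim \<xi>)
    obtain N :: nat where "norm \<xi> \<le> real N" using real_arch_simple by blast
    with elim have "Z \<xi> = 0" by blast
    then show ?case by (simp add: Z_def p_def q_def)
  qed
qed

section \<open>Sobolev spaces on the Fourier side\<close>

lemma L2_norm_cong_AE:
  assumes [measurable]: "f \<in> borel_measurable borel" "g \<in> borel_measurable borel"
    and "AE x in lborel. f x = g x"
  shows "L2_norm f = L2_norm g"
  unfolding L2_norm_def using assms(3) by (intro arg_cong[where f = sqrt] integral_cong_AE) auto

text \<open>
  The square root of the weight in the definition of \<open>Sobolev\<close>, so that Sobolev norms become plain
  \<open>L2\<close> norms.
\<close>
definition bessel_weight :: "real \<Rightarrow> 'a::euclidean_space \<Rightarrow> real" where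
  "bessel_weight s \<xi> = (1 + (norm \<xi>)\<^sup>2) powr (s / 2)"

lemma bessel_weight_measurable[measurable]: "bessel_weight s \<in> borel_measurable borel"
  unfolding bessel_weight_def[abs_def] by measurable

lemma bessel_weight_nonneg: "0 \<le> bessel_weight s \<xi>"
  by (simp add: bessel_weight_def)

lemma cmod_bessel_weight_sq:
  "(cmod (complex_of_real (bessel_weight s \<xi>) * z))\<^sup>2 = (1 + (norm \<xi>)\<^sup>2) powr s * (cmod z)\<^sup>2"
proof -
  have "(bessel_weight s \<xi>)\<^sup>2 = (1 + (norm \<xi>)\<^sup>2) powr s"
    unfolding bessel_weight_def power2_eq_square by (simp add: powr_add[symmetric])
  then show ?thesis by (simp add: norm_mult power_mult_distrib)
qed

lemma Sobolev_iff:
  fixes f :: "'a::euclidean_space \<Rightarrow> complex"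
  shows "f \<in> Sobolev s \<longleftrightarrow> f \<in> L2 \<and> (\<lambda>\<xi>. complex_of_real (bessel_weight s \<xi>) * fourier_L2 f \<xi>) \<in> L2"
proof -
  have "fourier_L2 f \<in> borel_measurable borel" if "f \<in> L2"
    using fourier_L2_limit(1)[OF that] by (rule L2_measurable)
  then show ?thesis
    unfolding Sobolev_def L2_def[of] mem_Collect_eq cmod_bessel_weight_sq by auto
qed

lemma Sobolev_norm_eq: "Sobolev_norm s f = L2_norm (\<lambda>\<xi>. complex_of_real (bessel_weight s \<xi>) * fourier_L2 f \<xi>)"
  unfolding Sobolev_norm_def L2_norm_def cmod_bessel_weight_sq ..

lemma Sobolev_imp_L2: "f \<in> Sobolev s \<Longrightarrow> f \<in> L2"
  by (simp add: Sobolev_def)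

lemma Sobolev_diff:
  fixes f g :: "'a::euclidean_space \<Rightarrow> complex"
  assumes f: "f \<in> Sobolev s" and g: "g \<in> Sobolev s"
  shows "(\<lambda>x. f x - g x) \<in> Sobolev s"
  unfolding Sobolev_iff
proof (intro conjI)
  note L2 = Sobolev_imp_L2[OF f] Sobolev_imp_L2[OF g]
  show d: "(\<lambda>x. f x - g x) \<in> L2" by (intro L2_diff L2)
  note [measurable] = L2_measurable[OF fourier_L2_limit(1)[OF d]]
  have "(\<lambda>\<xi>. complex_of_real (bessel_weight s \<xi>) * fourier_L2 f \<xi> - complex_of_real (bessel_weight s \<xi>) * fourier_L2 g \<xi>) \<in> L2"
    using f g by (intro L2_diff) (auto simp: Sobolev_iff)
  then show "(\<lambda>\<xi>. complex_of_real (bessel_weight s \<xi>) * fourier_L2 (\<lambda>x. f x - g x) \<xi>) \<in> L2"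
  proof (rule L2_bound)
    show "AE \<xi> in lborel. cmod (complex_of_real (bessel_weight s \<xi>) * fourier_L2 (\<lambda>x. f x - g x) \<xi>)
        \<le> cmod (complex_of_real (bessel_weight s \<xi>) * fourier_L2 f \<xi> - complex_of_real (bessel_weight s \<xi>) * fourier_L2 g \<xi>)"
      using fourier_L2_diff[OF L2] by eventually_elim (simp add: right_diff_distrib)
  qed measurable
qed

lemma Sobolev_cmult:
  fixes f :: "'a::euclidean_space \<Rightarrow> complex"
  assumes f: "f \<in> Sobolev s"
  shows "(\<lambda>x. c * f x) \<in> Sobolev s"
  unfolding Sobolev_iff
proof (intro conjI)
  note L2 = Sobolev_imp_L2[OF f]
  show d: "(\<lambda>x. c * f x) \<in> L2" by (intro L2_cmult L2)
  note [measurable] = L2_measurable[OF fourier_L2_limit(1)[OF d]]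
  have "(\<lambda>\<xi>. c * (complex_of_real (bessel_weight s \<xi>) * fourier_L2 f \<xi>)) \<in> L2"
    using f by (intro L2_cmult) (auto simp: Sobolev_iff)
  then show "(\<lambda>\<xi>. complex_of_real (bessel_weight s \<xi>) * fourier_L2 (\<lambda>x. c * f x) \<xi>) \<in> L2"
  proof (rule L2_bound)
    show "AE \<xi> in lborel. cmod (complex_of_real (bessel_weight s \<xi>) * fourier_L2 (\<lambda>x. c * f x) \<xi>)
        \<le> cmod (c * (complex_of_real (bessel_weight s \<xi>) * fourier_L2 f \<xi>))"
      using fourier_L2_cmult[OF L2, of c] by eventually_elim (simp add: mult_ac)
  qed measurable
qed

lemma L2_norm_fourier_le_Sobolev_norm:
  fixes f :: "'a::euclidean_space \<Rightarrow> complex"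
  assumes f: "f \<in> Sobolev s" and s: "s \<ge> 0"
  shows "L2_norm (fourier_L2 f) \<le> Sobolev_norm s f"
proof -
  have "cmod (fourier_L2 f \<xi>) \<le> 1 * cmod (complex_of_real (bessel_weight s \<xi>) * fourier_L2 f \<xi>)" for \<xi>
  proof -
    have "1 \<le> bessel_weight s \<xi>"
      unfolding bessel_weight_def using s by (intro ge_one_powr_ge_zero) auto
    then show ?thesis by (simp add: norm_mult mult_left_le_one_le mult_le_cancel_right1)
  qed
  moreover have "(\<lambda>\<xi>. complex_of_real (bessel_weight s \<xi>) * fourier_L2 f \<xi>) \<in> L2"
    using f by (simp add: Sobolev_iff)
  ultimately show ?thesis
    using L2_scaled_bound(2)[of "\<lambda>\<xi>. complex_of_real (bessel_weight s \<xi>) * fourier_L2 f \<xi>" "fourier_L2 f" 1]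
      L2_measurable[OF fourier_L2_limit(1)[OF Sobolev_imp_L2[OF f]]]
    by (simp add: Sobolev_norm_eq)
qed

text \<open>
  The transform is linear almost everywhere, and the \<open>L2\<close> norm is dominated by the Sobolev norm; so
  differentiability in the Sobolev norm carries over to the curve of transforms.
\<close>
lemma Sobolev_deriv_fourier:
  fixes u v :: "real \<Rightarrow> 'a::euclidean_space \<Rightarrow> complex"
  assumes d: "Sobolev_deriv s u v" and s: "s \<ge> 0" and t: "t \<ge> 0"
  shows "((\<lambda>r. L2_norm (\<lambda>\<xi>. (fourier_L2 (u r) \<xi> - fourier_L2 (u t) \<xi>) / complex_of_real (r - t) - fourier_L2 (v t) \<xi>)) \<longlongrightarrow> 0) (at t within {0..})"
proof -
  have S: "u r \<in> Sobolev s" "v r \<in> Sobolev s" if "r \<ge> 0" for r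
    using d that by (auto simp: Sobolev_deriv_def)
  have lim: "((\<lambda>r. Sobolev_norm s (\<lambda>x. (u r x - u t x) /\<^sub>R (r - t) - v t x)) \<longlongrightarrow> 0) (at t within {0..})"
    using d t by (auto simp: Sobolev_deriv_def)
  show ?thesis
  proof (rule Lim_null_comparison[OF _ lim])
    have "norm (L2_norm (\<lambda>\<xi>. (fourier_L2 (u r) \<xi> - fourier_L2 (u t) \<xi>) / complex_of_real (r - t) - fourier_L2 (v t) \<xi>))
        \<le> Sobolev_norm s (\<lambda>x. (u r x - u t x) /\<^sub>R (r - t) - v t x)" if r: "r \<ge> 0" for r
    proof -
      let ?c = "inverse (complex_of_real (r - t))"
      let ?d = "\<lambda>x. ?c * (u r x - u t x)"
      have dS: "?d \<in> Sobolev s" by (intro Sobolev_cmult Sobolev_diff S r t)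
      have fS: "(\<lambda>x. ?d x - v t x) \<in> Sobolev s" by (intro Sobolev_diff dS S t)
      have eq: "(\<lambda>x. (u r x - u t x) /\<^sub>R (r - t) - v t x) = (\<lambda>x. ?d x - v t x)"
        by (simp add: scaleR_conv_of_real)
      note L2 = Sobolev_imp_L2[OF S(1)[OF r]] Sobolev_imp_L2[OF S(1)[OF t]] Sobolev_imp_L2[OF S(2)[OF t]]
      note [measurable] = L2[THEN fourier_L2_limit(1), THEN L2_measurable] L2_measurable[OF fourier_L2_limit(1)[OF Sobolev_imp_L2[OF fS]]]
      have "AE \<xi> in lborel. fourier_L2 (\<lambda>x. ?d x - v t x) \<xi> = (fourier_L2 (u r) \<xi> - fourier_L2 (u t) \<xi>) / complex_of_real (r - t) - fourier_L2 (v t) \<xi>"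
        using fourier_L2_diff[OF Sobolev_imp_L2[OF dS] L2(3)] fourier_L2_cmult[OF L2_diff[OF L2(1,2)], of ?c] fourier_L2_diff[OF L2(1,2)]
        by eventually_elim (simp add: divide_inverse mult.commute)
      then have "L2_norm (fourier_L2 (\<lambda>x. ?d x - v t x)) = L2_norm (\<lambda>\<xi>. (fourier_L2 (u r) \<xi> - fourier_L2 (u t) \<xi>) / complex_of_real (r - t) - fourier_L2 (v t) \<xi>)"
        by (intro L2_norm_cong_AE) measurable
      with L2_norm_fourier_le_Sobolev_norm[OF fS s] show ?thesis
        unfolding eq by (simp add: L2_norm_nonneg)
    qed
    then show "\<forall>\<^sub>F r in at t within {0..}. norm (L2_norm (\<lambda>\<xi>. (fourier_L2 (u r) \<xi> - fourier_L2 (u t) \<xi>) / complex_of_real (r - t) - fourier_L2 (v t) \<xi>))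
        \<le> Sobolev_norm s (\<lambda>x. (u r x - u t x) /\<^sub>R (r - t) - v t x)"
      by (auto simp: eventually_at_filter)
  qed
qed

lemma Cauchy_problem_fourier:
  fixes u :: "real \<Rightarrow> 'a::euclidean_space \<Rightarrow> complex"
  assumes u0: "integrable lborel u0" "u0 \<in> L2" and u1: "integrable lborel u1" "u1 \<in> L2"
    and sol: "solves_Cauchy_problem u0 u1 u" and t: "t > 0"
  shows "fourier_L2 (u t) \<in> L2"
    and "AE \<xi> in lborel. fourier_L2 (u t) \<xi> = complex_of_real (prop0 t (norm \<xi>)) * fourier u0 \<xi> + complex_of_real (prop1 t (norm \<xi>)) * fourier u1 \<xi>"
proof -
  obtain ut utt where d: "Sobolev_deriv 1 u ut" "Sobolev_deriv 1 ut utt"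
    and eq: "\<And>t \<phi>. t > 0 \<Longrightarrow> \<phi> \<in> test_functions \<Longrightarrow>
       dist_of (utt t) \<phi> - dist_laplacian (dist_of (utt t)) \<phi>
           + dist_laplacian (dist_laplacian (dist_of (u t))) \<phi>
           - dist_laplacian (dist_of (u t)) \<phi> + dist_of (ut t) \<phi> = 0"
    and init: "AE x in lborel. u 0 x = u0 x" "AE x in lborel. ut 0 x = u1 x"
    using sol unfolding solves_Cauchy_problem_def by blast
  have L2: "u r \<in> L2" "ut r \<in> L2" "utt r \<in> L2" if "r \<ge> 0" for r
    using d that by (auto simp: Sobolev_deriv_def Sobolev_def)
  show "fourier_L2 (u t) \<in> L2" using t by (intro fourier_L2_limit L2) auto
  have "AE \<xi> in lborel. fourier_L2 (u t) \<xi> = complex_of_real (prop0 t (norm \<xi>)) * fourier_L2 (u 0) \<xi> + complex_of_real (prop1 t (norm \<xi>)) * fourier_L2 (ut 0) \<xi>"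
  proof (rule oscillator_solution[where W = "\<lambda>t. fourier_L2 (utt t)"])
    fix r :: real assume r: "r > 0"
    have "AE \<xi> in lborel. fourier_L2 (utt r) \<xi> + complex_of_real (1 / (1 + (norm \<xi>)\<^sup>2)) * fourier_L2 (ut r) \<xi>
      + complex_of_real ((norm \<xi>)\<^sup>2) * fourier_L2 (u r) \<xi> = 0"
      using r by (intro distributional_equation_fourier L2 eq) auto
    then show "AE \<xi> in lborel. fourier_L2 (utt r) \<xi> + complex_of_real (damping (norm \<xi>)) * fourier_L2 (ut r) \<xi> + complex_of_real ((norm \<xi>)\<^sup>2) * fourier_L2 (u r) \<xi> = 0"
      by (simp add: damping_def)
  next
    fix r :: real assume r: "r \<ge> 0"
    show "((\<lambda>x. L2_norm (\<lambda>\<xi>. (fourier_L2 (u x) \<xi> - fourier_L2 (u r) \<xi>) / complex_of_real (x - r) - fourier_L2 (ut r) \<xi>)) \<longlongrightarrow> 0) (at r within {0..})"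
      by (rule Sobolev_deriv_fourier[OF d(1) _ r]) simp
    show "((\<lambda>x. L2_norm (\<lambda>\<xi>. (fourier_L2 (ut x) \<xi> - fourier_L2 (ut r) \<xi>) / complex_of_real (x - r) - fourier_L2 (utt r) \<xi>)) \<longlongrightarrow> 0) (at r within {0..})"
      by (rule Sobolev_deriv_fourier[OF d(2) _ r]) simp
  qed (use t L2 in \<open>auto intro: fourier_L2_limit(1)\<close>)
  moreover have "fourier_L2 (u 0) = fourier_L2 u0" "fourier_L2 (ut 0) = fourier_L2 u1"
    using init L2[of 0] u0 u1 by (auto intro!: fourier_L2_cong_AE L2_measurable)
  ultimately show "AE \<xi> in lborel. fourier_L2 (u t) \<xi> = complex_of_real (prop0 t (norm \<xi>)) * fourier u0 \<xi> + complex_of_real (prop1 t (norm \<xi>)) * fourier u1 \<xi>"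
    using fourier_L2_eq_fourier[OF u0] fourier_L2_eq_fourier[OF u1] by auto
qed

section \<open>Pointwise estimates for the propagators\<close>

text \<open>
  A power in front of an exponential is absorbed by halving the rate; all the estimates below trade
  powers of \<open>t \<rho>\<^sup>2\<close> or \<open>t / \<rho>\<^sup>2\<close> for rates in this way.
\<close>
lemma mult_exp_le: "c > 0 \<Longrightarrow> y * exp (- y / c) \<le> 2 * c * exp (- y / (2 * c))" for y c :: real
proof -
  assume c: "c > 0"
  have "y / (2 * c) \<le> exp (y / (2 * c))" using exp_ge_add_one_self[of "y / (2 * c)"] by linarith
  then have "y \<le> 2 * c * exp (y / (2 * c))" using c by (simp add: field_simps)
  then have "y * exp (- y / c) \<le> 2 * c * exp (y / (2 * c)) * exp (- y / c)"
    by (intro mult_right_mono) auto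
  also have "exp (y / (2 * c)) * exp (- y / c) = exp (- y / (2 * c))"
    using c by (simp add: exp_add[symmetric] field_simps)
  then have "2 * c * exp (y / (2 * c)) * exp (- y / c) = 2 * c * exp (- y / (2 * c))"
    by (simp add: mult.assoc)
  finally show ?thesis .
qed

lemma exp_diff_le: "x \<le> y \<Longrightarrow> exp (- x) - exp (- y) \<le> (y - x) * exp (- x)" for x y :: real
proof -
  have "1 - (y - x) \<le> exp (- (y - x))" using exp_ge_add_one_self[of "- (y - x)"] by linarith
  then have "(1 - (y - x)) * exp (- x) \<le> exp (- (y - x)) * exp (- x)" by (intro mult_right_mono) auto
  also have "\<dots> = exp (- y)" by (simp add: exp_add[symmetric])
  finally show ?thesis by (simp add: algebra_simps)
qed

lemma damping_lower: "1 - \<rho>\<^sup>2 \<le> damping \<rho>"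
proof -
  have "(1 - \<rho>\<^sup>2) * (1 + \<rho>\<^sup>2) \<le> 1" by (simp add: algebra_simps)
  then show ?thesis by (simp add: damping_def pos_le_divide_eq add_pos_nonneg)
qed

text \<open>
  In the overdamped case \<open>-\<kappa>\<close> is the fast characteristic root, and the slow root is \<open>-\<rho>\<^sup>2/\<kappa>\<close> because the
  product of the roots is \<open>\<rho>\<^sup>2\<close>.
\<close>
lemma prop_exponential_form:
  assumes D: "discr \<rho> > 0"
  defines "m \<equiv> sqrt (discr \<rho>)" and "\<kappa> \<equiv> damping \<rho> / 2 + sqrt (discr \<rho>)"
  shows "(damping \<rho> / 2 - m) * \<kappa> = \<rho>\<^sup>2" "decay \<rho> = \<rho>\<^sup>2 / \<kappa>"
    "prop1 t \<rho> = (exp (- (\<rho>\<^sup>2 / \<kappa>) * t) - exp (- \<kappa> * t)) / (2 * m)"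
    "prop0 t \<rho> = (\<kappa> * exp (- (\<rho>\<^sup>2 / \<kappa>) * t) - \<rho>\<^sup>2 / \<kappa> * exp (- \<kappa> * t)) / (2 * m)"
proof -
  let ?a = "damping \<rho>"
  have m: "m > 0" "m * m = discr \<rho>" using D by (auto simp: m_def)
  have \<kappa>: "\<kappa> > 0" "\<kappa> = ?a / 2 + m" using m damping_bounds(1)[of \<rho>] by (auto simp: \<kappa>_def m_def intro: add_pos_pos)
  show e: "(?a / 2 - m) * \<kappa> = \<rho>\<^sup>2"
  proof -
    have "(?a / 2 - m) * \<kappa> = ?a\<^sup>2 / 4 - m * m" unfolding \<kappa>(2) by (simp add: algebra_simps power2_eq_square)
    then show ?thesis by (simp add: m discr_def)
  qed
  then have am: "?a / 2 - m = \<rho>\<^sup>2 / \<kappa>" using \<kappa>(1) by (metis less_irrefl nonzero_eq_divide_eq)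
  then show "decay \<rho> = \<rho>\<^sup>2 / \<kappa>" using D by (simp add: decay_def m_def max_def)
  have E1: "exp (- ?a / 2 * t) * exp (m * t) = exp (- (\<rho>\<^sup>2 / \<kappa>) * t)"
    unfolding am[symmetric] exp_add[symmetric] by (simp add: algebra_simps)
  have E2: "exp (- ?a / 2 * t) * exp (- (m * t)) = exp (- \<kappa> * t)"
    unfolding \<kappa>(2) exp_add[symmetric] by (simp add: algebra_simps)
  have "prop1 t \<rho> = (exp (- ?a / 2 * t) * exp (m * t) - exp (- ?a / 2 * t) * exp (- (m * t))) / (2 * m)"
    using D by (simp add: prop1_def ysin_def sinh_def m_def[symmetric] right_diff_distrib diff_divide_distrib)
  then show "prop1 t \<rho> = (exp (- (\<rho>\<^sup>2 / \<kappa>) * t) - exp (- \<kappa> * t)) / (2 * m)" unfolding E1 E2 .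
  have "prop0 t \<rho> = (\<kappa> * (exp (- ?a / 2 * t) * exp (m * t)) - (?a / 2 - m) * (exp (- ?a / 2 * t) * exp (- (m * t)))) / (2 * m)"
    using D m(1) by (simp add: prop0_def ysin_def ycos_def sinh_def cosh_def m_def[symmetric] \<kappa>(2) field_simps)
  then show "prop0 t \<rho> = (\<kappa> * exp (- (\<rho>\<^sup>2 / \<kappa>) * t) - \<rho>\<^sup>2 / \<kappa> * exp (- \<kappa> * t)) / (2 * m)" unfolding E1 E2 am .
qed

text \<open>
  Here \<open>\<kappa> = 1 + O(\<rho>\<^sup>2)\<close> and \<open>2 m = 1 + O(\<rho>\<^sup>2)\<close>, so the amplitude of the slow mode is \<open>1 + O(\<rho>\<^sup>2)\<close> and its rate
  \<open>\<rho>\<^sup>2/\<kappa>\<close> is \<open>\<rho>\<^sup>2 + O(\<rho>\<^sup>4)\<close>; replacing the rate by \<open>\<rho>\<^sup>2\<close> costs \<open>t \<rho>\<^sup>4 exp (-t\<rho>\<^sup>2)\<close>, which is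
  \<open>O(\<rho>\<^sup>2)\<close> times \<open>exp (-t\<rho>\<^sup>2/2)\<close>. The fast mode decays at least like \<open>exp (-t/2)\<close>. The bound 1/4 keeps the
  discriminant away from 0.
\<close>
lemma low_frequency:
  assumes \<rho>: "0 \<le> \<rho>" "\<rho> \<le> 1 / 4" and t: "t \<ge> 0"
  shows "\<bar>prop1 t \<rho> - exp (- t * \<rho>\<^sup>2)\<bar> \<le> 12 * (\<rho> * exp (- t * \<rho>\<^sup>2 / 2) + exp (- t / 2))"
    "\<bar>prop0 t \<rho> - exp (- t * \<rho>\<^sup>2)\<bar> \<le> 12 * (\<rho> * exp (- t * \<rho>\<^sup>2 / 2) + exp (- t / 2))"
proof -
  let ?a = "damping \<rho>"
  have \<rho>2: "\<rho>\<^sup>2 \<le> 1 / 16" "0 \<le> \<rho>\<^sup>2" "\<rho>\<^sup>2 \<le> \<rho>"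
  proof -
    have "\<rho> * \<rho> \<le> (1 / 4) * (1 / 4)" using \<rho> by (intro mult_mono) auto
    moreover have "\<rho> * \<rho> \<le> \<rho> * 1" using \<rho> by (intro mult_left_mono) auto
    ultimately    show "\<rho>\<^sup>2 \<le> 1 / 16" "0 \<le> \<rho>\<^sup>2" "\<rho>\<^sup>2 \<le> \<rho>" by (auto simp: power2_eq_square)
  qed
  have a: "?a \<ge> 15 / 16" "?a \<le> 1" "1 - ?a \<le> \<rho>\<^sup>2" using damping_lower[of \<rho>] damping_bounds[of \<rho>] \<rho>2 by linarith+
  have "(15 / 16)\<^sup>2 \<le> ?a\<^sup>2" using a by (intro power_mono) auto
  then have Dl: "discr \<rho> \<ge> (3 / 8)\<^sup>2" using \<rho>2 by (simp add: discr_def power2_eq_square)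
  then have D: "discr \<rho> > 0" by (simp add: power2_eq_square)
  define m where "m = sqrt (discr \<rho>)"
  define \<kappa> where "\<kappa> = ?a / 2 + m"
  note F = prop_exponential_form[OF D, folded m_def, folded \<kappa>_def]
  have m: "m \<ge> 3 / 8" unfolding m_def using Dl by (intro real_le_rsqrt)
  have \<kappa>: "\<kappa> \<ge> 3 / 4" using m a by (simp add: \<kappa>_def)
  have am: "?a / 2 - m = \<rho>\<^sup>2 / \<kappa>" using F(1) \<kappa> by (simp add: field_simps)
  have r\<kappa>: "\<rho>\<^sup>2 / \<kappa> \<le> (4 / 3) * \<rho>\<^sup>2" "0 \<le> \<rho>\<^sup>2 / \<kappa>"
  proof -
    have "\<rho>\<^sup>2 / \<kappa> \<le> \<rho>\<^sup>2 / (3 / 4)" using \<kappa> \<rho>2 by (intro divide_left_mono) auto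
    then show "\<rho>\<^sup>2 / \<kappa> \<le> (4 / 3) * \<rho>\<^sup>2" by simp
  qed (use \<kappa> in auto)
  have \<kappa>1: "\<kappa> \<le> 1" using am r\<kappa> a by (simp add: \<kappa>_def)
  have k1: "1 - \<kappa> \<le> (7 / 3) * \<rho>\<^sup>2" using am r\<kappa> a unfolding \<kappa>_def by linarith
  have m2: "1 - 2 * m \<le> (11 / 3) * \<rho>\<^sup>2" "2 * m \<le> 1" "\<kappa> - 2 * m = \<rho>\<^sup>2 / \<kappa>" using am r\<kappa> a unfolding \<kappa>_def by linarith+
  let ?E = "exp (- t * \<rho>\<^sup>2)" let ?E1 = "exp (- (\<rho>\<^sup>2 / \<kappa>) * t)" let ?H = "exp (- t * \<rho>\<^sup>2 / 2)" let ?X = "exp (- \<kappa> * t)"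
  have E1E: "?E1 \<le> ?E"
  proof -
    have "\<rho>\<^sup>2 * 1 \<le> \<rho>\<^sup>2 * (1 / \<kappa>)" using \<kappa>1 \<kappa> by (intro mult_left_mono) auto
    then have "t * \<rho>\<^sup>2 \<le> t * (\<rho>\<^sup>2 / \<kappa>)" using t by (intro mult_left_mono) auto
    then show ?thesis by (simp add: mult.commute)
  qed
  have EH: "?E \<le> ?H" using t \<rho>2 by simp
  have XT: "?X \<le> exp (- t / 2)"
  proof -
    have "(1 / 2) * t \<le> \<kappa> * t" using \<kappa> t by (intro mult_right_mono) auto
    then show ?thesis by simp
  qed
  have diff: "?E - ?E1 \<le> 7 * (\<rho>\<^sup>2 * ?H)"
  proof -
    have "?E - ?E1 \<le> (\<rho>\<^sup>2 / \<kappa> * t - t * \<rho>\<^sup>2) * ?E"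
      using exp_diff_le[of "t * \<rho>\<^sup>2" "\<rho>\<^sup>2 / \<kappa> * t"] E1E by simp
    also have "\<rho>\<^sup>2 / \<kappa> * t - t * \<rho>\<^sup>2 = (t * \<rho>\<^sup>2) * ((1 - \<kappa>) / \<kappa>)" using \<kappa> by (simp add: field_simps)
    also have "\<dots> * ?E = ((1 - \<kappa>) / \<kappa>) * ((t * \<rho>\<^sup>2) * exp (- (t * \<rho>\<^sup>2) / 1))" by simp
    also have "\<dots> \<le> ((7 / 3 * \<rho>\<^sup>2) / (3 / 4)) * (2 * 1 * exp (- (t * \<rho>\<^sup>2) / (2 * 1)))"
      using k1 \<kappa> \<rho>2 \<kappa>1 t by (intro mult_mono mult_exp_le frac_le) auto
    also have "\<dots> \<le> 7 * (\<rho>\<^sup>2 * ?H)" using \<rho>2 by simp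
    finally show ?thesis .
  qed
  define b where "b = 1 / (2 * m)"
  have b: "1 \<le> b" "b \<le> 4 / 3" "b * (2 * m) = 1" using m m2 by (auto simp: b_def field_simps)
  have b1: "b - 1 \<le> 5 * \<rho>\<^sup>2"
  proof -
    have "b - 1 = b * (1 - 2 * m)" using b(3) by (simp add: right_diff_distrib)
    also have "\<dots> \<le> (4 / 3) * ((11 / 3) * \<rho>\<^sup>2)" using b m2 by (intro mult_mono) auto
    also have "\<dots> \<le> 5 * \<rho>\<^sup>2" using \<rho>2 by simp
    finally show ?thesis .
  qed
  have bk: "\<kappa> * b - 1 = b * (\<rho>\<^sup>2 / \<kappa>)" using b(3) m2(3) by (metis mult.commute right_diff_distrib)
  have bk1: "0 \<le> b * (\<rho>\<^sup>2 / \<kappa>)" "b * (\<rho>\<^sup>2 / \<kappa>) \<le> 5 * \<rho>\<^sup>2"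
  proof -
    show "0 \<le> b * (\<rho>\<^sup>2 / \<kappa>)" using b r\<kappa> by (intro mult_nonneg_nonneg) auto
    have "b * (\<rho>\<^sup>2 / \<kappa>) \<le> (4 / 3) * ((4 / 3) * \<rho>\<^sup>2)" using b r\<kappa> by (intro mult_mono) auto
    then show "b * (\<rho>\<^sup>2 / \<kappa>) \<le> 5 * \<rho>\<^sup>2" using \<rho>2 by linarith
  qed
  have sq: "\<rho>\<^sup>2 * ?H \<le> \<rho> * ?H" using \<rho>2 by (intro mult_right_mono) auto
  have gen: "\<bar>P - Q - R\<bar> \<le> 12 * (y + z)"
    if "0 \<le> P \<and> P \<le> 5 * x" "0 \<le> Q" "0 \<le> R \<and> R \<le> 4 / 3 * z" "Q \<le> 7 * x" "x \<le> y" for P Q R x y z :: real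
    using that by (simp add: abs_le_iff)
  have "prop1 t \<rho> - ?E = (b - 1) * ?E1 - (?E - ?E1) - b * ?X"
    unfolding F(3) b_def by (simp add: diff_divide_distrib left_diff_distrib)
  moreover have "0 \<le> (b - 1) * ?E1" "(b - 1) * ?E1 \<le> 5 * \<rho>\<^sup>2 * ?H"
    using b(1) mult_mono[OF b1 order_trans[OF E1E EH]] \<rho>2(2) by (auto simp: mult.assoc)
  moreover have "0 \<le> b * ?X" "b * ?X \<le> 4 / 3 * exp (- t / 2)"
    using b(1) mult_mono[OF b(2) XT] by auto
  moreover have "0 \<le> ?E - ?E1" using E1E by simp
  ultimately show "\<bar>prop1 t \<rho> - exp (- t * \<rho>\<^sup>2)\<bar> \<le> 12 * (\<rho> * exp (- t * \<rho>\<^sup>2 / 2) + exp (- t / 2))"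
    using gen[OF _ _ _ diff sq] by (simp only: mult.assoc)
  have "prop0 t \<rho> - ?E = (\<kappa> * b - 1) * ?E1 - (?E - ?E1) - b * (\<rho>\<^sup>2 / \<kappa>) * ?X"
    unfolding F(4) b_def by (simp add: diff_divide_distrib left_diff_distrib)
  moreover have "0 \<le> (\<kappa> * b - 1) * ?E1" "(\<kappa> * b - 1) * ?E1 \<le> 5 * \<rho>\<^sup>2 * ?H"
    unfolding bk using mult_nonneg_nonneg[OF bk1(1), of ?E1] mult_mono[OF bk1(2) order_trans[OF E1E EH]] \<rho>2(2)
    by (auto simp: mult.assoc)
  moreover have "0 \<le> b * (\<rho>\<^sup>2 / \<kappa>) * ?X" "b * (\<rho>\<^sup>2 / \<kappa>) * ?X \<le> 4 / 3 * exp (- t / 2)"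
  proof -
    have "b * (\<rho>\<^sup>2 / \<kappa>) \<le> 4 / 3" using bk1 \<rho>2 by linarith
    from mult_mono[OF this XT] show "b * (\<rho>\<^sup>2 / \<kappa>) * ?X \<le> 4 / 3 * exp (- t / 2)" by simp
    show "0 \<le> b * (\<rho>\<^sup>2 / \<kappa>) * ?X" by (rule mult_nonneg_nonneg[OF bk1(1)]) simp
  qed
  moreover have "0 \<le> ?E - ?E1" using E1E by simp
  ultimately show "\<bar>prop0 t \<rho> - exp (- t * \<rho>\<^sup>2)\<bar> \<le> 12 * (\<rho> * exp (- t * \<rho>\<^sup>2 / 2) + exp (- t / 2))"
    using gen[OF _ _ _ diff sq] by (simp only: mult.assoc)
qed

lemma decay_lower:
  assumes \<rho>: "0 \<le> \<rho>" "\<rho> \<le> 1"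
  shows "\<rho>\<^sup>2 / 4 \<le> decay \<rho>"
proof -
  have \<rho>2: "\<rho>\<^sup>2 \<le> 1" using \<rho> by (simp add: power_le_one)
  show ?thesis
  proof (cases "discr \<rho> > 0")
    case True
    let ?k = "damping \<rho> / 2 + sqrt (discr \<rho>)"
    have "?k \<le> 1" using discr_le[of \<rho>] damping_bounds[of \<rho>] True by (simp add: max_def)
    moreover have "?k > 0" using True damping_bounds[of \<rho>] by (intro add_pos_pos) auto
    ultimately have "\<rho>\<^sup>2 / 1 \<le> \<rho>\<^sup>2 / ?k" by (intro divide_left_mono) auto
    then show ?thesis using prop_exponential_form(2)[OF True] zero_le_power2[of \<rho>] by linarith
  next
    case False
    have "1 + \<rho>\<^sup>2 \<le> 2" using \<rho>2 by simp
    then have "1 / 2 \<le> damping \<rho>" unfolding damping_def by (intro divide_left_mono) (auto simp: add_pos_nonneg)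
    then show ?thesis using False \<rho>2 by (simp add: decay_def max_def)
  qed
qed

text \<open>
  For \<open>1/4 \<le> \<rho> \<le> 1\<close>, where the discriminant changes sign, all terms decay exponentially in \<open>t\<close> and
  nothing has to be compared.
\<close>
lemma bounded_frequency:
  assumes \<rho>: "0 \<le> \<rho>" "\<rho> \<le> 1" and t: "t \<ge> 0"
  shows "\<bar>prop1 t \<rho> - exp (- t * \<rho>\<^sup>2)\<bar> \<le> 150 * (\<rho> * exp (- t * \<rho>\<^sup>2 / 2) + exp (- t / 128))"
    "\<bar>prop0 t \<rho> - exp (- t * \<rho>\<^sup>2)\<bar> \<le> 150 * (\<rho> * exp (- t * \<rho>\<^sup>2 / 2) + exp (- t / 128))"
proof -
  let ?X = "exp (- t / 128)" let ?H = "\<rho> * exp (- t * \<rho>\<^sup>2 / 2)"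
  have H: "0 \<le> ?H" using \<rho> by simp
  have "\<bar>prop1 t \<rho> - exp (- t * \<rho>\<^sup>2)\<bar> \<le> 150 * (?H + ?X) \<and> \<bar>prop0 t \<rho> - exp (- t * \<rho>\<^sup>2)\<bar> \<le> 150 * (?H + ?X)"
  proof (cases "\<rho> \<le> 1 / 4")
    case True
    have gen: "12 * (h + x) \<le> 150 * (h + z)" if "x \<le> z" "0 \<le> h" "0 \<le> z" for h x z :: real
      using that by simp
    have "exp (- t / 2) \<le> ?X" using t by simp
    then have "12 * (?H + exp (- t / 2)) \<le> 150 * (?H + ?X)" by (rule gen[OF _ H exp_ge_zero])
    then show ?thesis using low_frequency[OF \<rho>(1) True t] by linarith
  next
    case False
    have "(1 / 4) * (1 / 4) \<le> \<rho> * \<rho>" using False by (intro mult_mono) auto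
    then have \<rho>2: "1 / 16 \<le> \<rho>\<^sup>2" by (simp add: power2_eq_square)
    then have "1 / 64 * t \<le> decay \<rho> * t" using decay_lower[OF \<rho>] t by (intro mult_right_mono) auto
    then have e: "exp (- decay \<rho> * t) \<le> exp (- t / 64)" by simp
    have te: "t * exp (- t / 64) \<le> 128 * ?X" using mult_exp_le[of 64 t] by simp
    have e2: "exp (- t / 64) \<le> ?X" using t by simp
    have "1 / 16 * t \<le> \<rho>\<^sup>2 * t" using \<rho>2 t by (intro mult_right_mono) auto
    then have E: "exp (- t * \<rho>\<^sup>2) \<le> ?X" using t by (simp add: mult.commute)
    have "t * exp (- decay \<rho> * t) \<le> t * exp (- t / 64)" using t e by (intro mult_left_mono)
    moreover have "(1 + t) * exp (- decay \<rho> * t) \<le> (1 + t) * exp (- t / 64)" using t e by (intro mult_left_mono) auto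
    moreover have "(1 + t) * exp (- t / 64) = exp (- t / 64) + t * exp (- t / 64)" by (simp add: distrib_right)
    ultimately have "\<bar>prop1 t \<rho>\<bar> \<le> 128 * ?X" "\<bar>prop0 t \<rho>\<bar> \<le> 129 * ?X"
      using prop1_bound[OF t, of \<rho>] prop0_bound[OF t, of \<rho>] te e2 by linarith+
    moreover have "\<bar>q - e\<bar> \<le> 150 * (h + x)" if "\<bar>q\<bar> \<le> 129 * x \<or> \<bar>q\<bar> \<le> 128 * x" "0 \<le> e" "e \<le> x" "0 \<le> h" for q e h x :: real
      using that by (simp add: abs_le_iff) linarith
    ultimately show ?thesis using E H by (metis exp_ge_zero)
  qed
  then show "\<bar>prop1 t \<rho> - exp (- t * \<rho>\<^sup>2)\<bar> \<le> 150 * (?H + ?X)" "\<bar>prop0 t \<rho> - exp (- t * \<rho>\<^sup>2)\<bar> \<le> 150 * (?H + ?X)"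
    by auto
qed

definition wave1 :: "real \<Rightarrow> real \<Rightarrow> real" where
  "wave1 t \<rho> = exp (- t / (2 * \<rho>\<^sup>2)) * (sin (t * \<rho>) / \<rho>)"

definition wave0 :: "real \<Rightarrow> real \<Rightarrow> real" where
  "wave0 t \<rho> = exp (- t / (2 * \<rho>\<^sup>2)) * cos (t * \<rho>)"

lemma wave_small:
  assumes \<rho>: "0 < \<rho>" "\<rho> \<le> 1" and t: "t \<ge> 0"
  shows "\<bar>wave1 t \<rho>\<bar> \<le> 4 * exp (- t / 128)" "\<bar>wave0 t \<rho>\<bar> \<le> 4 * exp (- t / 128)"
proof -
  have "t / 2 \<le> t / (2 * \<rho>\<^sup>2)" using \<rho> t by (intro divide_left_mono) (auto simp: power_le_one)
  then have e: "exp (- t / (2 * \<rho>\<^sup>2)) \<le> exp (- t / 2)" by simp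
  have "\<bar>sin (t * \<rho>) / \<rho>\<bar> \<le> t"
    using abs_sin_x_le_abs_x[of "t * \<rho>"] \<rho> t by (simp add: abs_mult divide_le_eq)
  then have "\<bar>wave1 t \<rho>\<bar> \<le> exp (- t / 2) * t"
    unfolding wave1_def abs_mult[of "exp _"] using e by (intro mult_mono) auto
  also have "\<dots> \<le> 4 * exp (- t / 4)" using mult_exp_le[of 2 t] by (simp add: mult.commute)
  also have "\<dots> \<le> 4 * exp (- t / 128)" using t by simp
  finally show "\<bar>wave1 t \<rho>\<bar> \<le> 4 * exp (- t / 128)" .
  have "\<bar>wave0 t \<rho>\<bar> \<le> exp (- t / 2) * 1"
    unfolding wave0_def abs_mult[of "exp _"] using e by (intro mult_mono) auto
  also have "\<dots> \<le> 4 * exp (- t / 128)"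
  proof -
    have "exp (- t / 2) \<le> exp (- t / 128)" using t by simp
    then show ?thesis using exp_ge_zero[of "- t / 128"] by linarith
  qed
  finally show "\<bar>wave0 t \<rho>\<bar> \<le> 4 * exp (- t / 128)" .
qed

lemma abs_sin_diff_le: "\<bar>sin x - sin y\<bar> \<le> \<bar>x - y\<bar>" for x y :: real
  using field_differentiable_bound[of UNIV sin cos 1 x y] by (auto intro: DERIV_sin)

lemma abs_cos_diff_le: "\<bar>cos x - cos y\<bar> \<le> \<bar>x - y\<bar>" for x y :: real
  using field_differentiable_bound[of UNIV cos "\<lambda>x. - sin x" 1 x y] by (auto intro!: derivative_eq_intros)

text \<open>
  The oscillator is underdamped with angular frequency \<open>\<omega>\<close>. In terms of \<open>y = t/\<rho>\<^sup>2\<close>, the damping factors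
  differ by \<open>O(y/\<rho>\<^sup>2)\<close> and the phases by \<open>O(y/\<rho>\<^sup>2)\<close>, in both cases times \<open>exp (-y/4)\<close>, and the factor
  \<open>y\<close> is absorbed by weakening the rate to \<open>1/8\<close>.
\<close>
lemma high_frequency:
  assumes \<rho>: "1 \<le> \<rho>" and t: "t \<ge> 0"
  shows "\<bar>prop1 t \<rho> - wave1 t \<rho>\<bar> \<le> 16 / \<rho>\<^sup>2 * exp (- t / (8 * \<rho>\<^sup>2))"
    "\<bar>prop0 t \<rho> - wave0 t \<rho>\<bar> \<le> 16 / \<rho> * exp (- t / (8 * \<rho>\<^sup>2))"
proof -
  let ?a = "damping \<rho>"
  have \<rho>0: "\<rho> > 0" using \<rho> by simp
  have \<rho>2: "1 \<le> \<rho>\<^sup>2" "\<rho> \<le> \<rho>\<^sup>2" using \<rho> by (auto simp: power2_eq_square mult_le_cancel_left1 one_le_power[of \<rho> 2, unfolded power2_eq_square])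
  have a: "1 / (2 * \<rho>\<^sup>2) \<le> ?a" "?a \<le> 1 / \<rho>\<^sup>2" "?a \<le> 1 / 2"
    unfolding damping_def using \<rho>2 by (auto intro!: divide_left_mono mult_pos_pos add_pos_nonneg)
  have a0: "0 < ?a" by (rule damping_bounds)
  have a2: "?a\<^sup>2 \<le> (1 / \<rho>\<^sup>2)\<^sup>2" "?a\<^sup>2 \<le> (1 / 2)\<^sup>2" using a a0 by (auto intro!: power_mono)
  define \<omega> where "\<omega> = sqrt (- discr \<rho>)"
  have D: "discr \<rho> < 0" using a2 \<rho>2 by (simp add: discr_def power2_eq_square)
  have w2: "\<omega> * \<omega> = \<rho>\<^sup>2 - ?a\<^sup>2 / 4" using D by (simp add: \<omega>_def discr_def)
  have w0: "\<omega> > 0" using D by (simp add: \<omega>_def)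
  have wl: "\<rho> / 2 \<le> \<omega>"
  proof -
    have "(\<rho> / 2)\<^sup>2 \<le> - discr \<rho>" using a2 \<rho>2 by (simp add: discr_def power2_eq_square)
    then show ?thesis unfolding \<omega>_def by (intro real_le_rsqrt)
  qed
  \<comment> \<open>From \<open>\<rho>\<^sup>2 - \<omega>\<^sup>2 = a\<^sup>2/4\<close>.\<close>
  have diff: "\<rho> - \<omega> \<le> 1 / (4 * \<rho>\<^sup>2 * \<rho>\<^sup>2)" and wr: "\<omega> \<le> \<rho>"
  proof -
    have eq: "(\<rho> - \<omega>) * (\<rho> + \<omega>) = ?a\<^sup>2 / 4" using w2 by (simp add: algebra_simps power2_eq_square)
    then have "\<rho> - \<omega> = (?a\<^sup>2 / 4) / (\<rho> + \<omega>)" using \<rho>0 w0 by (metis add_pos_pos less_irrefl nonzero_mult_div_cancel_right)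
    moreover have "(?a\<^sup>2 / 4) / (\<rho> + \<omega>) \<le> (?a\<^sup>2 / 4) / 1" using \<rho> w0 by (intro divide_left_mono) auto
    moreover have "?a\<^sup>2 \<le> 1 / (\<rho>\<^sup>2 * \<rho>\<^sup>2)" using a2(1) by (simp add: power2_eq_square[of "1 / \<rho>\<^sup>2"])
    moreover have "1 / (4 * \<rho>\<^sup>2 * \<rho>\<^sup>2) = 1 / (\<rho>\<^sup>2 * \<rho>\<^sup>2) / 4" by simp
    ultimately show "\<rho> - \<omega> \<le> 1 / (4 * \<rho>\<^sup>2 * \<rho>\<^sup>2)" by linarith
    show "\<omega> \<le> \<rho>" using \<open>\<rho> - \<omega> = (?a\<^sup>2 / 4) / (\<rho> + \<omega>)\<close> \<rho>0 w0 zero_le_divide_iff[of "?a\<^sup>2 / 4" "\<rho> + \<omega>"] by (smt (verit) zero_le_power2 divide_nonneg_pos)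
  qed
  define y where "y = t / \<rho>\<^sup>2"
  have y: "y \<ge> 0" using t by (simp add: y_def)
  let ?e1 = "exp (- ?a / 2 * t)" let ?e2 = "exp (- t / (2 * \<rho>\<^sup>2))" let ?Y = "exp (- y / 8)"
  have yY: "y * exp (- y / 4) \<le> 8 * ?Y" using mult_exp_le[of 4 y] by simp
  have e1: "?e1 \<le> exp (- y / 4)"
  proof -
    have "1 / (2 * \<rho>\<^sup>2) / 2 * t \<le> ?a / 2 * t" using a t by (intro mult_right_mono divide_right_mono) auto
    then show ?thesis by (simp add: y_def)
  qed
  have e2: "?e2 \<le> exp (- y / 4)" using y by (simp add: y_def)
  have Y4: "exp (- y / 4) \<le> ?Y" using y by simp
  have e12: "\<bar>?e1 - ?e2\<bar> \<le> 4 / \<rho>\<^sup>2 * ?Y"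
  proof -
    have le: "?a / 2 * t \<le> t / (2 * \<rho>\<^sup>2)" using mult_right_mono[OF a(2) t] by simp
    then have "\<bar>?e1 - ?e2\<bar> = ?e1 - ?e2" by simp
    also have "\<dots> \<le> (t / (2 * \<rho>\<^sup>2) - ?a / 2 * t) * ?e1"
      using exp_diff_le[OF le] by simp
    also have "\<dots> \<le> (1 / (2 * \<rho>\<^sup>2) * y) * exp (- y / 4)"
    proof (intro mult_mono e1)
      have "1 / \<rho>\<^sup>2 - ?a = 1 / (\<rho>\<^sup>2 * (1 + \<rho>\<^sup>2))"
      proof -
        have "1 / s - 1 / (1 + s) = 1 / (s * (1 + s))" if "s > 0" for s :: real
          using that by (simp add: field_simps)
        from this[of "\<rho>\<^sup>2"] show ?thesis using \<rho>0 by (simp add: damping_def)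
      qed
      also have "\<dots> \<le> 1 / (\<rho>\<^sup>2 * \<rho>\<^sup>2)" using \<rho>0 by (intro divide_left_mono mult_left_mono mult_pos_pos add_pos_nonneg) auto
      finally have *: "(1 / \<rho>\<^sup>2 - ?a) * (t / 2) \<le> 1 / (\<rho>\<^sup>2 * \<rho>\<^sup>2) * (t / 2)" using t by (intro mult_right_mono) auto
      show "t / (2 * \<rho>\<^sup>2) - ?a / 2 * t \<le> 1 / (2 * \<rho>\<^sup>2) * y"
      proof -
        have "t / (2 * \<rho>\<^sup>2) - ?a / 2 * t = (1 / \<rho>\<^sup>2 - ?a) * (t / 2)" by (simp add: left_diff_distrib)
        also note *
        also have "1 / (\<rho>\<^sup>2 * \<rho>\<^sup>2) * (t / 2) = 1 / (2 * \<rho>\<^sup>2) * y" by (simp add: y_def)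
        finally show ?thesis .
      qed
    qed (use y in auto)
    also have "\<dots> = 1 / (2 * \<rho>\<^sup>2) * (y * exp (- y / 4))" by simp
    also have "\<dots> \<le> 1 / (2 * \<rho>\<^sup>2) * (8 * ?Y)" using yY by (intro mult_left_mono) auto
    finally show ?thesis by simp
  qed
  have phase: "?e2 * \<bar>\<omega> * t - t * \<rho>\<bar> \<le> 2 / \<rho>\<^sup>2 * ?Y"
  proof -
    have "\<bar>\<omega> * t - t * \<rho>\<bar> = (\<rho> - \<omega>) * t" using wr t mult_right_mono[OF wr t] by (simp add: abs_if algebra_simps)
    also have "\<dots> \<le> 1 / (4 * \<rho>\<^sup>2 * \<rho>\<^sup>2) * t" using diff t by (intro mult_right_mono)
    also have "\<dots> = 1 / (4 * \<rho>\<^sup>2) * y" by (simp add: y_def)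
    finally have "?e2 * \<bar>\<omega> * t - t * \<rho>\<bar> \<le> exp (- y / 4) * (1 / (4 * \<rho>\<^sup>2) * y)"
      by (rule mult_mono[OF e2]) simp_all
    also have "\<dots> = 1 / (4 * \<rho>\<^sup>2) * (y * exp (- y / 4))" by simp
    also have "\<dots> \<le> 1 / (4 * \<rho>\<^sup>2) * (8 * ?Y)" using yY by (intro mult_left_mono) auto
    finally show ?thesis by simp
  qed
  have p1: "prop1 t \<rho> = ?e1 * (sin (\<omega> * t) / \<omega>)" using D by (simp add: prop1_def ysin_def \<omega>_def)
  have p0: "prop0 t \<rho> = ?e1 * (cos (\<omega> * t) + ?a / 2 * (sin (\<omega> * t) / \<omega>))" using D by (simp add: prop0_def ysin_def ycos_def \<omega>_def)
  have winv: "1 / \<omega> \<le> 2 / \<rho>" using wl w0 \<rho>0 by (simp add: field_simps)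
  have YY: "?Y = exp (- t / (8 * \<rho>\<^sup>2))" by (simp add: y_def)
  have P1: "prop1 t \<rho> - wave1 t \<rho> = (?e1 - ?e2) * (sin (\<omega> * t) * (1 / \<omega>)) + ?e2 * (sin (\<omega> * t) - sin (t * \<rho>)) * (1 / \<omega>)
      + ?e2 * sin (t * \<rho>) * (1 / \<omega> - 1 / \<rho>)"
    unfolding p1 wave1_def by (simp add: algebra_simps)
  have T1: "\<bar>(?e1 - ?e2) * (sin (\<omega> * t) * (1 / \<omega>))\<bar> \<le> (4 / \<rho>\<^sup>2 * ?Y) * (1 * (2 / \<rho>))"
    unfolding abs_mult using e12 winv w0 by (intro mult_mono) auto
  have T2: "\<bar>?e2 * (sin (\<omega> * t) - sin (t * \<rho>)) * (1 / \<omega>)\<bar> \<le> (2 / \<rho>\<^sup>2 * ?Y) * (2 / \<rho>)"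
  proof -
    have "\<bar>?e2 * (sin (\<omega> * t) - sin (t * \<rho>))\<bar> \<le> 2 / \<rho>\<^sup>2 * ?Y"
      using order_trans[OF mult_left_mono[OF abs_sin_diff_le[of "\<omega> * t" "t * \<rho>"], of ?e2] phase]
      by (simp only: abs_mult abs_exp_cancel exp_ge_zero simp_thms)
    then show ?thesis unfolding abs_mult[of "?e2 * _"] using winv w0 by (intro mult_mono) auto
  qed
  have T3: "\<bar>?e2 * sin (t * \<rho>) * (1 / \<omega> - 1 / \<rho>)\<bar> \<le> ?Y * 1 * (1 / \<rho>\<^sup>2)"
  proof -
    have "\<bar>1 / \<omega> - 1 / \<rho>\<bar> = (\<rho> - \<omega>) / (\<omega> * \<rho>)" using w0 \<rho>0 wr by (simp add: abs_if field_simps)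
    also have "\<dots> \<le> (1 / (4 * \<rho>\<^sup>2 * \<rho>\<^sup>2)) / (1 / 2 * 1)"
      using diff wr wl \<rho> by (intro frac_le mult_mono) auto
    also have "\<dots> = 1 / \<rho>\<^sup>2 * (1 / (2 * \<rho>\<^sup>2))" by simp
    also have "\<dots> \<le> 1 / \<rho>\<^sup>2 * 1"
    proof (intro mult_left_mono)
      show "1 / (2 * \<rho>\<^sup>2) \<le> 1" using \<rho>2(1) by (subst divide_le_eq_1_pos) linarith+
    qed simp
    also have "\<dots> = 1 / \<rho>\<^sup>2" by simp
    finally show ?thesis unfolding abs_mult using order_trans[OF e2 Y4] by (intro mult_mono) auto
  qed
  have tri: "\<bar>x1 + x2 + x3\<bar> \<le> c1 + c2 + c3" if "\<bar>x1\<bar> \<le> c1" "\<bar>x2\<bar> \<le> c2" "\<bar>x3\<bar> \<le> c3" for x1 x2 x3 c1 c2 c3 :: real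
    using that by linarith
  have r: "1 / \<rho> \<le> 1" using \<rho> by simp
  have "\<bar>prop1 t \<rho> - wave1 t \<rho>\<bar> \<le> (4 / \<rho>\<^sup>2 * ?Y) * (1 * (2 / \<rho>)) + (2 / \<rho>\<^sup>2 * ?Y) * (2 / \<rho>) + ?Y * 1 * (1 / \<rho>\<^sup>2)"
    unfolding P1 by (rule tri[OF T1 T2 T3])
  also have "\<dots> = (12 * (1 / \<rho>) + 1) * (?Y / \<rho>\<^sup>2)" unfolding divide_inverse by algebra
  also have "\<dots> \<le> 16 * (?Y / \<rho>\<^sup>2)" using r by (intro mult_right_mono) auto
  finally show "\<bar>prop1 t \<rho> - wave1 t \<rho>\<bar> \<le> 16 / \<rho>\<^sup>2 * exp (- t / (8 * \<rho>\<^sup>2))" unfolding YY by simp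
  have P0: "prop0 t \<rho> - wave0 t \<rho> = (?e1 - ?e2) * cos (\<omega> * t) + ?e2 * (cos (\<omega> * t) - cos (t * \<rho>)) + ?e1 * (?a / 2 * (sin (\<omega> * t) * (1 / \<omega>)))"
    unfolding p0 wave0_def by (simp add: algebra_simps)
  have S1: "\<bar>(?e1 - ?e2) * cos (\<omega> * t)\<bar> \<le> (4 / \<rho>\<^sup>2 * ?Y) * 1"
    unfolding abs_mult using e12 by (intro mult_mono) auto
  have S2: "\<bar>?e2 * (cos (\<omega> * t) - cos (t * \<rho>))\<bar> \<le> 2 / \<rho>\<^sup>2 * ?Y"
    using order_trans[OF mult_left_mono[OF abs_cos_diff_le[of "\<omega> * t" "t * \<rho>"], of ?e2] phase]
    by (simp only: abs_mult abs_exp_cancel exp_ge_zero simp_thms)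
  have S3: "\<bar>?e1 * (?a / 2 * (sin (\<omega> * t) * (1 / \<omega>)))\<bar> \<le> ?Y * ((1 / \<rho>\<^sup>2) / 2 * (1 * (2 / 1)))"
  proof -
    have "1 / \<omega> \<le> 2 / 1" using winv r by (simp add: field_simps)
    then show ?thesis unfolding abs_mult using a a0 w0 order_trans[OF e1 Y4] by (intro mult_mono) auto
  qed
  have "\<bar>prop0 t \<rho> - wave0 t \<rho>\<bar> \<le> (4 / \<rho>\<^sup>2 * ?Y) * 1 + 2 / \<rho>\<^sup>2 * ?Y + ?Y * ((1 / \<rho>\<^sup>2) / 2 * (1 * (2 / 1)))"
    unfolding P0 by (rule tri[OF S1 S2 S3])
  also have "\<dots> = 7 * ?Y * (1 / \<rho>\<^sup>2)" by (simp add: algebra_simps)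
  also have "\<dots> \<le> 16 * ?Y * (1 / \<rho>)" using \<rho>2 \<rho>0 by (intro mult_mono divide_left_mono) auto
  finally show "\<bar>prop0 t \<rho> - wave0 t \<rho>\<bar> \<le> 16 / \<rho> * exp (- t / (8 * \<rho>\<^sup>2))" unfolding YY by simp
qed

text \<open>
  The exponential inequality \<open>z \<le> exp z\<close> at \<open>z = y / (c \<alpha>)\<close>, raised to the power \<open>\<alpha>\<close>.
\<close>
lemma powr_exp_le:
  fixes \<alpha> y c :: real
  assumes "\<alpha> > 0" "y > 0" "c > 0"
  shows "y powr \<alpha> * exp (- y / c) \<le> (c * \<alpha>) powr \<alpha>"
proof -
  have "y / (c * \<alpha>) \<le> exp (y / (c * \<alpha>))" using exp_ge_add_one_self[of "y / (c * \<alpha>)"] by linarith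
  then have "y \<le> c * \<alpha> * exp (y / (c * \<alpha>))" using assms by (simp add: field_simps)
  then have "y powr \<alpha> \<le> (c * \<alpha> * exp (y / (c * \<alpha>))) powr \<alpha>" using assms by (intro powr_mono2) auto
  also have "\<dots> = (c * \<alpha>) powr \<alpha> * exp (y / c)"
    using assms by (simp add: powr_mult exp_powr_real)
  finally have "y powr \<alpha> * exp (- y / c) \<le> (c * \<alpha>) powr \<alpha> * exp (y / c) * exp (- y / c)"
    by (intro mult_right_mono) auto
  then show ?thesis by (simp add: mult.assoc exp_add[symmetric])
qed

section \<open>The asymptotic profile\<close>

lemma profile_eq:
  "profile u0 u1 t \<xi> = (mean u1 + mean u0) * complex_of_real (exp (- t * (norm \<xi>)\<^sup>2))
     + fourier u1 \<xi> * complex_of_real (wave1 t (norm \<xi>)) + fourier u0 \<xi> * complex_of_real (wave0 t (norm \<xi>))"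
  by (simp add: profile_def wave1_def wave0_def)

text \<open>
  Per datum, the error is \<open>(p - E) v + E (v - M) - w v\<close>, where \<open>p\<close> is the propagator, \<open>E\<close> the heat factor and
  \<open>w\<close> the wave factor, which is exponentially small in \<open>t\<close> for \<open>\<rho> \<le> 1\<close>. The constants add up to
  \<open>150 + 1 + 4\<close>.
\<close>
lemma profile_error_low:
  fixes v0 v1 M0 M1 :: complex
  assumes \<rho>: "0 < \<rho>" "\<rho> \<le> 1" and t: "t \<ge> 0"
    and v: "cmod v0 \<le> n0" "cmod v1 \<le> n1" "cmod (v0 - M0) \<le> \<rho> * n0" "cmod (v1 - M1) \<le> \<rho> * n1"
  shows "cmod (complex_of_real (prop0 t \<rho>) * v0 + complex_of_real (prop1 t \<rho>) * v1
      - ((M1 + M0) * complex_of_real (exp (- t * \<rho>\<^sup>2)) + v1 * complex_of_real (wave1 t \<rho>) + v0 * complex_of_real (wave0 t \<rho>)))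
    \<le> 155 * (n0 + n1) * (\<rho> * exp (- t * \<rho>\<^sup>2 / 2) + exp (- t / 128))"
proof -
  let ?E = "exp (- t * \<rho>\<^sup>2)" let ?B = "\<rho> * exp (- t * \<rho>\<^sup>2 / 2) + exp (- t / 128)"
  have one: "cmod (complex_of_real p * v - (M * complex_of_real ?E + v * complex_of_real w)) \<le> 155 * n * ?B"
    if p: "\<bar>p - ?E\<bar> \<le> 150 * ?B" and w: "\<bar>w\<bar> \<le> 4 * exp (- t / 128)" and v: "cmod v \<le> n" "cmod (v - M) \<le> \<rho> * n"
    for p w n :: real and v M :: complex
  proof -
    have n: "0 \<le> n" using v(1) norm_ge_zero order_trans by blast
    have "complex_of_real p * v - (M * complex_of_real ?E + v * complex_of_real w)
      = complex_of_real (p - ?E) * v + complex_of_real ?E * (v - M) - complex_of_real w * v"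
      by (simp add: algebra_simps)
    also have "cmod \<dots> \<le> \<bar>p - ?E\<bar> * cmod v + ?E * cmod (v - M) + \<bar>w\<bar> * cmod v"
      by (rule order_trans[OF norm_triangle_ineq4] order_trans[OF add_right_mono[OF norm_triangle_ineq]])+ (simp add: norm_mult del: of_real_diff)
    also have "\<dots> \<le> (150 * ?B) * n + exp (- t * \<rho>\<^sup>2 / 2) * (\<rho> * n) + (4 * exp (- t / 128)) * n"
      using p w v n \<rho> t by (intro add_mono mult_mono) auto
    also have "\<dots> \<le> 155 * n * ?B"
    proof -
      have "0 \<le> n * (\<rho> * exp (- t * \<rho>\<^sup>2 / 2))" "0 \<le> n * exp (- t / 128)" using n \<rho> by auto
      then show ?thesis by (simp add: distrib_left mult_ac)
    qed
    finally show ?thesis .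
  qed
  have "complex_of_real (prop0 t \<rho>) * v0 + complex_of_real (prop1 t \<rho>) * v1
      - ((M1 + M0) * complex_of_real ?E + v1 * complex_of_real (wave1 t \<rho>) + v0 * complex_of_real (wave0 t \<rho>))
    = (complex_of_real (prop0 t \<rho>) * v0 - (M0 * complex_of_real ?E + v0 * complex_of_real (wave0 t \<rho>)))
      + (complex_of_real (prop1 t \<rho>) * v1 - (M1 * complex_of_real ?E + v1 * complex_of_real (wave1 t \<rho>)))"
    by (simp add: algebra_simps)
  also have "cmod \<dots> \<le> 155 * n0 * ?B + 155 * n1 * ?B"
    using \<rho> by (intro norm_triangle_mono one bounded_frequency wave_small v t) auto
  finally show ?thesis by (simp add: algebra_simps)
qed

text \<open>
  The heat part of the profile is estimated on its own: for \<open>\<rho> \<ge> 1\<close> it is dominated by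
  \<open>\<rho> exp (-t\<rho>\<^sup>2/2)\<close>, the same function as at low frequencies.
\<close>
lemma profile_error_high:
  fixes v0 v1 M0 M1 :: complex
  assumes \<rho>: "1 \<le> \<rho>" and t: "t \<ge> 0" and M: "cmod M0 \<le> n0" "cmod M1 \<le> n1"
  shows "cmod (complex_of_real (prop0 t \<rho>) * v0 + complex_of_real (prop1 t \<rho>) * v1
      - ((M1 + M0) * complex_of_real (exp (- t * \<rho>\<^sup>2)) + v1 * complex_of_real (wave1 t \<rho>) + v0 * complex_of_real (wave0 t \<rho>)))
    \<le> (n0 + n1) * (\<rho> * exp (- t * \<rho>\<^sup>2 / 2)) + 16 / \<rho> * exp (- t / (8 * \<rho>\<^sup>2)) * cmod v0 + 16 / \<rho>\<^sup>2 * exp (- t / (8 * \<rho>\<^sup>2)) * cmod v1"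
proof -
  let ?E = "exp (- t * \<rho>\<^sup>2)"
  have n: "0 \<le> n0" "0 \<le> n1" using M norm_ge_zero order_trans by blast+
  have E: "?E \<le> \<rho> * exp (- t * \<rho>\<^sup>2 / 2)"
  proof -
    have "1 * ?E \<le> \<rho> * exp (- t * \<rho>\<^sup>2 / 2)" using \<rho> t by (intro mult_mono) auto
    then show ?thesis by simp
  qed
  have "complex_of_real (prop0 t \<rho>) * v0 + complex_of_real (prop1 t \<rho>) * v1
      - ((M1 + M0) * complex_of_real ?E + v1 * complex_of_real (wave1 t \<rho>) + v0 * complex_of_real (wave0 t \<rho>))
    = - ((M1 + M0) * complex_of_real ?E) + complex_of_real (prop0 t \<rho> - wave0 t \<rho>) * v0 + complex_of_real (prop1 t \<rho> - wave1 t \<rho>) * v1"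
    by (simp add: algebra_simps)
  also have "cmod \<dots> \<le> (n0 + n1) * (\<rho> * exp (- t * \<rho>\<^sup>2 / 2)) + 16 / \<rho> * exp (- t / (8 * \<rho>\<^sup>2)) * cmod v0 + 16 / \<rho>\<^sup>2 * exp (- t / (8 * \<rho>\<^sup>2)) * cmod v1"
  proof (intro norm_triangle_mono)
    have "cmod (M1 + M0) \<le> n0 + n1" using norm_triangle_ineq[of M1 M0] M by linarith
    then show "cmod (- ((M1 + M0) * complex_of_real ?E)) \<le> (n0 + n1) * (\<rho> * exp (- t * \<rho>\<^sup>2 / 2))"
      unfolding norm_minus_cancel norm_mult norm_of_real using E n by (intro mult_mono) auto
    show "cmod (complex_of_real (prop0 t \<rho> - wave0 t \<rho>) * v0) \<le> 16 / \<rho> * exp (- t / (8 * \<rho>\<^sup>2)) * cmod v0"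
      unfolding norm_mult norm_of_real using high_frequency(2)[OF \<rho> t] by (intro mult_right_mono) auto
    show "cmod (complex_of_real (prop1 t \<rho> - wave1 t \<rho>) * v1) \<le> 16 / \<rho>\<^sup>2 * exp (- t / (8 * \<rho>\<^sup>2)) * cmod v1"
      unfolding norm_mult norm_of_real using high_frequency(1)[OF \<rho> t] by (intro mult_right_mono) auto
  qed
  finally show ?thesis .
qed

text \<open>
  The factor \<open>exp (-t/(8s))\<close> gives no decay uniformly in \<open>s\<close>; each power of \<open>t\<close> has to be paid with a power
  of \<open>s = |\<xi>|\<^sup>2\<close>, since \<open>(t/s)\<close> to the power \<open>\<alpha>\<close> times the exponential is bounded.
\<close>
lemma regularity_loss:
  fixes s t \<alpha> \<beta> :: real
  assumes s: "s > 0" and t: "t > 0" and \<alpha>: "\<alpha> > 0" and \<beta>: "\<beta> \<ge> 0"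
  shows "s powr (\<beta> - \<alpha>) * exp (- t / (8 * s)) \<le> (8 * \<alpha>) powr \<alpha> * t powr (- \<alpha>) * (1 + s) powr \<beta>"
proof -
  have "s powr (\<beta> - \<alpha>) * exp (- t / (8 * s)) = s powr \<beta> * t powr (- \<alpha>) * ((t / s) powr \<alpha> * exp (- (t / s) / 8))"
  proof -
    have 1: "t powr (- \<alpha>) * t powr \<alpha> = 1" using t by (simp add: powr_add[symmetric])
    have "s powr \<beta> * t powr (- \<alpha>) * ((t / s) powr \<alpha> * exp (- (t / s) / 8))
      = (t powr (- \<alpha>) * t powr \<alpha>) * (s powr \<beta> / s powr \<alpha> * exp (- t / (8 * s)))"
    proof -
      have e: "- (t / s) / 8 = - t / (8 * s)" by simp
      have d: "(t / s) powr \<alpha> = t powr \<alpha> * inverse (s powr \<alpha>)"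
        unfolding divide_inverse[symmetric] using s t by (simp add: powr_divide)
      show ?thesis unfolding e d divide_inverse[of "s powr \<beta>"] by (simp only: mult_ac)
    qed
    also have "\<dots> = s powr (\<beta> - \<alpha>) * exp (- t / (8 * s))" by (simp only: 1 mult_1 powr_diff)
    finally show ?thesis by (rule sym)
  qed
  also have "\<dots> \<le> (1 + s) powr \<beta> * t powr (- \<alpha>) * (8 * \<alpha>) powr \<alpha>"
  proof (rule mult_mono)
    show "s powr \<beta> * t powr (- \<alpha>) \<le> (1 + s) powr \<beta> * t powr (- \<alpha>)"
      using s \<beta> by (intro mult_right_mono powr_mono2) auto
    show "(t / s) powr \<alpha> * exp (- (t / s) / 8) \<le> (8 * \<alpha>) powr \<alpha>"
      using s t \<alpha> by (intro powr_exp_le) auto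
  qed auto
  finally show ?thesis by (simp add: mult_ac)
qed

text \<open>
  Minkowski's inequality up to a constant, from \<open>|a + b|\<^sup>2 \<le> 2 |a|\<^sup>2 + 2 |b|\<^sup>2\<close>.
\<close>
lemma L2_norm_add_le:
  assumes f: "f \<in> L2" and g: "g \<in> L2"
  shows "L2_norm (\<lambda>x. f x + g x) \<le> 2 * (L2_norm f + L2_norm g)"
proof (rule power2_le_imp_le)
  have "(L2_norm (\<lambda>x. f x + g x))\<^sup>2 \<le> (LINT x|lborel. 2 * (cmod (f x))\<^sup>2 + 2 * (cmod (g x))\<^sup>2)"
    unfolding L2_norm_squared using f g
    by (intro integral_mono cmod_add_sq_le L2_sq_integrable L2_add Bochner_Integration.integrable_add integrable_mult_right) auto
  also have "\<dots> = 2 * (L2_norm f)\<^sup>2 + 2 * (L2_norm g)\<^sup>2"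
    using f g by (simp add: L2_norm_squared L2_sq_integrable)
  also have "\<dots> \<le> (2 * (L2_norm f + L2_norm g))\<^sup>2"
    using L2_norm_nonneg[of f] L2_norm_nonneg[of g] by (simp add: power2_eq_square algebra_simps)
  finally show "(L2_norm (\<lambda>x. f x + g x))\<^sup>2 \<le> (2 * (L2_norm f + L2_norm g))\<^sup>2" .
qed (simp add: L2_norm_nonneg)

text \<open>
  The square of the function is at most \<open>2/t\<close> times a Gaussian of width \<open>t\<close> to the power \<open>-1/2\<close>, whose integral
  is known by scaling.
\<close>
lemma heat_weight_L2:
  fixes t :: real
  assumes t: "t > 0"
  defines "h \<equiv> \<lambda>\<xi>::'a::euclidean_space. complex_of_real (norm \<xi> * exp (- t * (norm \<xi>)\<^sup>2 / 2))"
  shows "h \<in> L2" "L2_norm h \<le> sqrt (2 * sqrt (2 * pi) ^ DIM('a)) * t powr (- (real DIM('a) + 2) / 4)"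
proof -
  let ?c = "sqrt (2 * pi) ^ DIM('a)" let ?\<alpha> = "(real DIM('a) + 2) / 4"
  have [measurable]: "h \<in> borel_measurable borel" unfolding h_def by measurable
  have le: "(cmod (h \<xi>))\<^sup>2 \<le> 2 / t * gauss (sqrt t *\<^sub>R \<xi>)" for \<xi>
  proof -
    have "(cmod (h \<xi>))\<^sup>2 = (norm \<xi>)\<^sup>2 * exp (- t * (norm \<xi>)\<^sup>2)"
      unfolding h_def norm_of_real by (simp add: power_mult_distrib exp_double[symmetric])
    also have "\<dots> = 1 / t * ((t * (norm \<xi>)\<^sup>2) * exp (- (t * (norm \<xi>)\<^sup>2) / 1))" using t by simp
    also have "\<dots> \<le> 1 / t * (2 * 1 * exp (- (t * (norm \<xi>)\<^sup>2) / (2 * 1)))"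
      using t by (intro mult_left_mono mult_exp_le) auto
    also have "\<dots> = 2 / t * gauss (sqrt t *\<^sub>R \<xi>)" using t by (simp add: gauss_def power_mult_distrib)
    finally show ?thesis .
  qed
  have gi: "integrable lborel (\<lambda>\<xi>::'a. gauss (sqrt t *\<^sub>R \<xi>))"
    using integrable_Re[OF gauss_scaled_integrable[of "sqrt t"]] t by simp
  have i: "integrable lborel (\<lambda>\<xi>. (cmod (h \<xi>))\<^sup>2)"
  proof (rule Bochner_Integration.integrable_bound[OF integrable_mult_right[OF gi, of "2 / t"]])
    have "norm ((cmod (h \<xi>))\<^sup>2) \<le> norm (2 / t * gauss (sqrt t *\<^sub>R \<xi>))" for \<xi>
      using order_trans[OF le abs_ge_self] by (simp only: real_norm_def abs_power2)
    then show "AE \<xi> in lborel. norm ((cmod (h \<xi>))\<^sup>2) \<le> norm (2 / t * gauss (sqrt t *\<^sub>R \<xi>))" by simp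
  qed measurable
  then show "h \<in> L2" by (simp add: L2_def)
  have "complex_of_real ?c = complex_of_real (\<bar>sqrt t\<bar> ^ DIM('a)) * (LINT \<xi>|lborel. complex_of_real (gauss (0 + sqrt t *\<^sub>R (\<xi>::'a))))"
    unfolding gauss_integral[symmetric] integral_complex_of_real[symmetric] using t by (intro integral_affine) auto
  also have "\<dots> = complex_of_real (sqrt t ^ DIM('a) * (LINT \<xi>|lborel. gauss (sqrt t *\<^sub>R (\<xi>::'a))))" using t by simp
  finally have gint: "sqrt t ^ DIM('a) * (LINT \<xi>|lborel. gauss (sqrt t *\<^sub>R (\<xi>::'a))) = ?c"
    by (simp only: of_real_eq_iff)
  have sp: "sqrt t ^ DIM('a) = t powr (real DIM('a) / 2)"
    using t by (simp add: powr_half_sqrt[symmetric] powr_realpow[symmetric] powr_powr)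
  have "(L2_norm h)\<^sup>2 \<le> (LINT \<xi>|lborel. 2 / t * gauss (sqrt t *\<^sub>R (\<xi>::'a)))"
    unfolding L2_norm_squared using i gi le by (intro integral_mono) auto
  also have "\<dots> = 2 / t * (?c / sqrt t ^ DIM('a))"
    unfolding gint[symmetric] using t by simp
  also have "\<dots> = 2 * ?c * t powr (- 2 * ?\<alpha>)"
  proof -
    have "- 2 * ?\<alpha> = - 1 - real DIM('a) / 2" by (simp add: field_simps)
    then have "t powr (- 2 * ?\<alpha>) = t powr (- 1 - real DIM('a) / 2)" by (simp only:)
    also have "\<dots> = 1 / t / t powr (real DIM('a) / 2)" using t by (simp add: powr_diff powr_minus_divide)
    finally show ?thesis unfolding sp by simp
  qed
  also have "\<dots> = (sqrt (2 * ?c) * t powr (- ?\<alpha>))\<^sup>2"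
  proof -
    have "t powr (- ?\<alpha>) * t powr (- ?\<alpha>) = t powr (- 2 * ?\<alpha>)"
      unfolding powr_add[symmetric] by (rule arg_cong[where f = "(powr) t"]) linarith
    then show ?thesis unfolding power_mult_distrib power2_eq_square[of "t powr _"] by simp
  qed
  finally have "L2_norm h \<le> sqrt (2 * ?c) * t powr (- ?\<alpha>)"
    by (rule power2_le_imp_le) simp
  then show "L2_norm h \<le> sqrt (2 * ?c) * t powr (- (real DIM('a) + 2) / 4)"
    unfolding minus_divide_left .
qed

lemma L11_bounds:
  fixes f :: "'a::euclidean_space \<Rightarrow> complex"
  assumes f: "f \<in> L11"
  shows "cmod (fourier f \<xi>) \<le> L11_norm f" "cmod (mean f) \<le> L11_norm f" "0 \<le> L11_norm f"
proof -
  have i: "integrable lborel f" "integrable lborel (\<lambda>x. (1 + norm x) * cmod (f x))"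
    using f by (auto simp: L11_def L1_def)
  have "(LINT x|lborel. cmod (f x)) \<le> L11_norm f"
    unfolding L11_norm_def using i by (intro integral_mono) (auto simp: distrib_right)
  with fourier_norm_le[of f] show F: "cmod (fourier f \<xi>) \<le> L11_norm f" for \<xi> using order_trans by blast
  show "cmod (mean f) \<le> L11_norm f" using F[of 0] by (simp add: fourier_def mean_def)
  then show "0 \<le> L11_norm f" using norm_ge_zero order_trans by blast
qed

lemma weighted_fourier:
  fixes f :: "'a::euclidean_space \<Rightarrow> complex"
  assumes f: "f \<in> Sobolev s" "f \<in> L11"
  shows "(\<lambda>\<xi>. complex_of_real (bessel_weight s \<xi>) * fourier f \<xi>) \<in> L2"
    "L2_norm (\<lambda>\<xi>. complex_of_real (bessel_weight s \<xi>) * fourier f \<xi>) = Sobolev_norm s f"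
proof -
  have L2: "f \<in> L2" and i: "integrable lborel f" using f by (auto simp: Sobolev_def L11_def L1_def)
  note [measurable] = L2_measurable[OF L2] L2_measurable[OF fourier_L2_limit(1)[OF L2]]
  have AE: "AE \<xi> in lborel. complex_of_real (bessel_weight s \<xi>) * fourier f \<xi> = complex_of_real (bessel_weight s \<xi>) * fourier_L2 f \<xi>"
    using fourier_L2_eq_fourier[OF i L2] by eventually_elim simp
  have W: "(\<lambda>\<xi>. complex_of_real (bessel_weight s \<xi>) * fourier_L2 f \<xi>) \<in> L2" using f by (simp add: Sobolev_iff)
  show "(\<lambda>\<xi>. complex_of_real (bessel_weight s \<xi>) * fourier f \<xi>) \<in> L2"
  proof (rule L2_bound[OF W])
    show "AE \<xi> in lborel. cmod (complex_of_real (bessel_weight s \<xi>) * fourier f \<xi>) \<le> cmod (complex_of_real (bessel_weight s \<xi>) * fourier_L2 f \<xi>)"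
      using AE by eventually_elim (metis order_refl)
  qed measurable
  show "L2_norm (\<lambda>\<xi>. complex_of_real (bessel_weight s \<xi>) * fourier f \<xi>) = Sobolev_norm s f"
    unfolding Sobolev_norm_eq by (rule L2_norm_cong_AE[OF _ _ AE]) measurable
qed

text \<open>
  The pointwise error is dominated by the sum of four square integrable functions: the heat weight \<open>B1\<close>,
  an exponentially small multiple \<open>B2\<close> of the indicator of the unit ball, and the Sobolev weighted transforms
  \<open>B3\<close>, \<open>B4\<close> of the data, each with norm of the order \<open>t\<close> to the power \<open>-\<alpha>\<close>.
\<close>
lemma asymptotic_profile:
  fixes l :: real
  defines "l \<equiv> real DIM('a::euclidean_space) / 2 - 1"
  assumes dim: "DIM('a) \<ge> 2"
  shows "\<exists>C>0. \<forall>(u0 :: 'a \<Rightarrow> complex) u1 u.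
    u0 \<in> Sobolev (l + 1) \<inter> L11 \<longrightarrow> u1 \<in> Sobolev l \<inter> L11 \<longrightarrow> solves_Cauchy_problem u0 u1 u \<longrightarrow>
    (\<forall>t\<ge>1. (\<lambda>\<xi>. fourier_L2 (u t) \<xi> - profile u0 u1 t \<xi>) \<in> L2 \<and>
       L2_norm (\<lambda>\<xi>. fourier_L2 (u t) \<xi> - profile u0 u1 t \<xi>)
         \<le> C * I0 l u0 u1 * t powr (- (real DIM('a) + 2) / 4))"
proof -
  define \<alpha> where "\<alpha> = (real DIM('a) + 2) / 4"
  have \<alpha>: "\<alpha> > 0" by (simp add: \<alpha>_def)
  define c1 where "c1 = sqrt (2 * sqrt (2 * pi) ^ DIM('a))"
  define c2 where "c2 = L2_norm (\<lambda>\<xi>::'a. complex_of_real (indicat_real (cball 0 1) \<xi>)) * (128 * \<alpha>) powr \<alpha>"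
  define K where "K = (8 * \<alpha>) powr \<alpha>"
  have c: "0 \<le> c1" "0 \<le> c2" "0 \<le> K" by (auto simp: c1_def c2_def K_def L2_norm_nonneg)
  define C where "C = 8 * (155 * c1 + 155 * c2 + 16 * K) + 1"
  have "C > 0" using c by (simp add: C_def)
  moreover
  {
    fix u0 u1 :: "'a \<Rightarrow> complex" and u and t :: real
    assume u0: "u0 \<in> Sobolev (l + 1)" "u0 \<in> L11" and u1: "u1 \<in> Sobolev l" "u1 \<in> L11"
      and sol: "solves_Cauchy_problem u0 u1 u" and t1: "t \<ge> 1"
    have t: "t > 0" "t \<ge> 0" using t1 by auto
    have i: "integrable lborel u0" "u0 \<in> L2" "integrable lborel u1" "u1 \<in> L2"
      using u0 u1 by (auto simp: L11_def L1_def Sobolev_def)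
    note [measurable] = L2_measurable[OF i(2)] L2_measurable[OF i(4)]
    define \<tau> where "\<tau> = t powr (- \<alpha>)"
    define n where "n = L11_norm u0 + L11_norm u1"
    have n: "0 \<le> n" using L11_bounds(3)[OF u0(2)] L11_bounds(3)[OF u1(2)] by (simp add: n_def)
    have \<tau>: "0 \<le> \<tau>" by (simp add: \<tau>_def)
    let ?diff = "\<lambda>\<xi>. fourier_L2 (u t) \<xi> - profile u0 u1 t \<xi>"
    let ?ind = "\<lambda>\<xi>::'a. complex_of_real (indicat_real (cball 0 1) \<xi>)"
    define G where "G \<xi> = complex_of_real (norm \<xi> * exp (- t * (norm \<xi>)\<^sup>2 / 2))" for \<xi> :: 'a
    define B1 where "B1 \<xi> = complex_of_real (155 * n) * G \<xi>" for \<xi>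
    define B2 where "B2 \<xi> = complex_of_real (155 * n * exp (- t / 128)) * ?ind \<xi>" for \<xi>
    define B3 where "B3 \<xi> = complex_of_real (16 * K * \<tau> * cmod (complex_of_real (bessel_weight (l + 1) \<xi>) * fourier u0 \<xi>))" for \<xi>
    define B4 where "B4 \<xi> = complex_of_real (16 * K * \<tau> * cmod (complex_of_real (bessel_weight l \<xi>) * fourier u1 \<xi>))" for \<xi>
    define B where "B \<xi> = B1 \<xi> + (B2 \<xi> + (B3 \<xi> + B4 \<xi>))" for \<xi>
    note W0 = weighted_fourier[OF u0] and W1 = weighted_fourier[OF u1]
    note GL = heat_weight_L2[where 'a = 'a, OF t(1), folded G_def[abs_def] c1_def]
    have [measurable]: "G \<in> borel_measurable borel" using GL(1) by (rule L2_measurable)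
    note [measurable] = L2_measurable[OF cball_indicator_L2[where c = "0::'a" and r = 1]]
    have "cmod (B1 \<xi>) \<le> 155 * n * cmod (G \<xi>)" for \<xi> unfolding B1_def norm_mult norm_of_real using n by simp
    then have B1: "B1 \<in> L2" "L2_norm B1 \<le> 155 * n * L2_norm G"
      using L2_scaled_bound[OF GL(1), of B1 "155 * n"] n by (auto simp: B1_def[abs_def])
    have "cmod (B2 \<xi>) \<le> 155 * n * exp (- t / 128) * cmod (?ind \<xi>)" for \<xi>
      unfolding B2_def norm_mult[of "complex_of_real (155 * n * exp (- t / 128))"] norm_of_real[of "155 * n * exp (- t / 128)"] using n by simp
    then have B2: "B2 \<in> L2" "L2_norm B2 \<le> 155 * n * exp (- t / 128) * L2_norm ?ind"
      using L2_scaled_bound[OF cball_indicator_L2[of 0 1], of B2 "155 * n * exp (- t / 128)"] n by (auto simp: B2_def[abs_def])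
    have "cmod (B3 \<xi>) \<le> 16 * K * \<tau> * cmod (complex_of_real (bessel_weight (l + 1) \<xi>) * fourier u0 \<xi>)" for \<xi>
      unfolding B3_def norm_of_real using c \<tau> by simp
    then have B3: "B3 \<in> L2" "L2_norm B3 \<le> 16 * K * \<tau> * Sobolev_norm (l + 1) u0"
      using L2_scaled_bound[OF W0(1), of B3 "16 * K * \<tau>"] c \<tau> unfolding W0(2) by (auto simp: B3_def[abs_def])
    have "cmod (B4 \<xi>) \<le> 16 * K * \<tau> * cmod (complex_of_real (bessel_weight l \<xi>) * fourier u1 \<xi>)" for \<xi>
      unfolding B4_def norm_of_real using c \<tau> by simp
    then have B4: "B4 \<in> L2" "L2_norm B4 \<le> 16 * K * \<tau> * Sobolev_norm l u1"
      using L2_scaled_bound[OF W1(1), of B4 "16 * K * \<tau>"] c \<tau> unfolding W1(2) by (auto simp: B4_def[abs_def])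
    have BL2: "B \<in> L2" unfolding B_def[abs_def] by (intro L2_add B1 B2 B3 B4)
    have cmodB: "cmod (B \<xi>) = 155 * n * (norm \<xi> * exp (- t * (norm \<xi>)\<^sup>2 / 2)) + (155 * n * exp (- t / 128) * indicat_real (cball 0 1) \<xi>
        + (16 * K * \<tau> * (bessel_weight (l + 1) \<xi> * cmod (fourier u0 \<xi>)) + 16 * K * \<tau> * (bessel_weight l \<xi> * cmod (fourier u1 \<xi>))))"
      (is "_ = ?r \<xi>") for \<xi>
    proof -
      have "B \<xi> = complex_of_real (?r \<xi>)"
        unfolding B_def B1_def B2_def B3_def B4_def G_def norm_mult
        by (simp add: abs_of_nonneg bessel_weight_nonneg)
      moreover have "?r \<xi> \<ge> 0" using n c \<tau> by (intro add_nonneg_nonneg mult_nonneg_nonneg bessel_weight_nonneg) auto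
      ultimately show ?thesis by (simp only: norm_of_real abs_of_nonneg)
    qed
    have sol_t: "AE \<xi> in lborel. fourier_L2 (u t) \<xi> = complex_of_real (prop0 t (norm \<xi>)) * fourier u0 \<xi> + complex_of_real (prop1 t (norm \<xi>)) * fourier u1 \<xi>"
      and FL2: "fourier_L2 (u t) \<in> L2"
      using Cauchy_problem_fourier[OF i sol t(1)] by auto
    note [measurable] = L2_measurable[OF FL2]
    have dm: "?diff \<in> borel_measurable borel" unfolding profile_def by measurable
    \<comment> \<open>At the origin the damping factor of the wave part is 1 because of the division by 0.\<close>
    have "AE \<xi> in lborel. \<xi> \<noteq> (0::'a)" by (rule AE_lborel_singleton)
    with sol_t have le: "AE \<xi> in lborel. cmod (?diff \<xi>) \<le> 1 * cmod (B \<xi>)"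
    proof eventually_elim
      case (elim \<xi>)
      let ?\<rho> = "norm \<xi>"
      have \<rho>0: "0 < ?\<rho>" using elim by simp
      have r34: "0 \<le> 16 * K * \<tau> * (bessel_weight (l + 1) \<xi> * cmod (fourier u0 \<xi>))" "0 \<le> 16 * K * \<tau> * (bessel_weight l \<xi> * cmod (fourier u1 \<xi>))"
        using c \<tau> by (intro mult_nonneg_nonneg bessel_weight_nonneg; simp)+
      have eq: "?diff \<xi> = complex_of_real (prop0 t ?\<rho>) * fourier u0 \<xi> + complex_of_real (prop1 t ?\<rho>) * fourier u1 \<xi>
        - ((mean u1 + mean u0) * complex_of_real (exp (- t * ?\<rho>\<^sup>2)) + fourier u1 \<xi> * complex_of_real (wave1 t ?\<rho>) + fourier u0 \<xi> * complex_of_real (wave0 t ?\<rho>))"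
        using elim unfolding profile_eq by simp
      have drop_tail: "d \<le> x1 + x2 \<Longrightarrow> 0 \<le> x3 \<Longrightarrow> 0 \<le> x4 \<Longrightarrow> d \<le> x1 + (x2 + (x3 + x4))" for d x1 x2 x3 x4 :: real
        by simp
      show ?case
      proof (cases "?\<rho> \<le> 1")
        case True
        have "cmod (?diff \<xi>) \<le> 155 * n * (?\<rho> * exp (- t * ?\<rho>\<^sup>2 / 2) + exp (- t / 128))"
          unfolding eq n_def
          by (intro profile_error_low \<rho>0 True t L11_bounds u0 u1 fourier_minus_mean)
        also have "\<dots> = 155 * n * (?\<rho> * exp (- t * ?\<rho>\<^sup>2 / 2)) + 155 * n * exp (- t / 128) * indicat_real (cball 0 1) \<xi>"
          using True by (simp add: distrib_left)
        finally show ?thesis unfolding cmodB mult_1 using r34 by (rule drop_tail)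
      next
        case False
        then have \<rho>1: "1 \<le> ?\<rho>" by simp
        \<comment> \<open>The indices are matched here: \<open>(l + 1)/2 - \<alpha> = -1/2\<close> and \<open>l/2 - \<alpha> = -1\<close>.\<close>
        have w: "1 / ?\<rho> * exp (- t / (8 * ?\<rho>\<^sup>2)) \<le> K * \<tau> * bessel_weight (l + 1) \<xi>"
          "1 / ?\<rho>\<^sup>2 * exp (- t / (8 * ?\<rho>\<^sup>2)) \<le> K * \<tau> * bessel_weight l \<xi>"
        proof -
          have "(?\<rho>\<^sup>2) powr ((l + 1) / 2 - \<alpha>) = 1 / ?\<rho>"
          proof -
            have "(l + 1) / 2 - \<alpha> = - (1 / 2)" by (simp add: l_def \<alpha>_def field_simps)
            then show ?thesis using \<rho>0 by (simp add: powr_minus_divide powr_half_sqrt)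
          qed
          then show "1 / ?\<rho> * exp (- t / (8 * ?\<rho>\<^sup>2)) \<le> K * \<tau> * bessel_weight (l + 1) \<xi>"
            using regularity_loss[of "?\<rho>\<^sup>2" t \<alpha> "(l + 1) / 2"] \<rho>0 t \<alpha> by (simp add: K_def \<tau>_def bessel_weight_def l_def)
          have "(?\<rho>\<^sup>2) powr (l / 2 - \<alpha>) = 1 / ?\<rho>\<^sup>2"
          proof -
            have "l / 2 - \<alpha> = - 1" by (simp add: l_def \<alpha>_def field_simps)
            then show ?thesis using \<rho>0 by (simp add: powr_minus_divide)
          qed
          moreover have "l / 2 \<ge> 0" using dim by (simp add: l_def)
          ultimately show "1 / ?\<rho>\<^sup>2 * exp (- t / (8 * ?\<rho>\<^sup>2)) \<le> K * \<tau> * bessel_weight l \<xi>"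
            using regularity_loss[of "?\<rho>\<^sup>2" t \<alpha> "l / 2"] \<rho>0 t \<alpha> by (simp add: K_def \<tau>_def bessel_weight_def)
        qed
        have "cmod (?diff \<xi>) \<le> n * (?\<rho> * exp (- t * ?\<rho>\<^sup>2 / 2)) + 16 / ?\<rho> * exp (- t / (8 * ?\<rho>\<^sup>2)) * cmod (fourier u0 \<xi>)
            + 16 / ?\<rho>\<^sup>2 * exp (- t / (8 * ?\<rho>\<^sup>2)) * cmod (fourier u1 \<xi>)"
          unfolding eq n_def by (intro profile_error_high \<rho>1 t L11_bounds u0 u1)
        also have "\<dots> \<le> 155 * n * (?\<rho> * exp (- t * ?\<rho>\<^sup>2 / 2)) + 16 * K * \<tau> * (bessel_weight (l + 1) \<xi> * cmod (fourier u0 \<xi>))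
            + 16 * K * \<tau> * (bessel_weight l \<xi> * cmod (fourier u1 \<xi>))"
        proof (intro add_mono)
          show "n * (?\<rho> * exp (- t * ?\<rho>\<^sup>2 / 2)) \<le> 155 * n * (?\<rho> * exp (- t * ?\<rho>\<^sup>2 / 2))"
            using n by (intro mult_right_mono) auto
          show "16 / ?\<rho> * exp (- t / (8 * ?\<rho>\<^sup>2)) * cmod (fourier u0 \<xi>) \<le> 16 * K * \<tau> * (bessel_weight (l + 1) \<xi> * cmod (fourier u0 \<xi>))"
            using mult_right_mono[OF mult_left_mono[OF w(1), of 16], of "cmod (fourier u0 \<xi>)"] by (simp add: mult_ac)
          show "16 / ?\<rho>\<^sup>2 * exp (- t / (8 * ?\<rho>\<^sup>2)) * cmod (fourier u1 \<xi>) \<le> 16 * K * \<tau> * (bessel_weight l \<xi> * cmod (fourier u1 \<xi>))"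
            using mult_right_mono[OF mult_left_mono[OF w(2), of 16], of "cmod (fourier u1 \<xi>)"] by (simp add: mult_ac)
        qed
        also have "\<dots> \<le> ?r \<xi>"
        proof -
          have "0 \<le> 155 * n * exp (- t / 128) * indicat_real (cball 0 1) \<xi>" using n by simp
          then show ?thesis by simp
        qed
        finally show ?thesis unfolding cmodB mult_1 .
      qed
    qed
    have Gb: "155 * n * L2_norm G \<le> 155 * n * (c1 * \<tau>)"
      using GL(2) n unfolding \<tau>_def \<alpha>_def minus_divide_left by (intro mult_left_mono) simp_all
    have Ib: "155 * n * exp (- t / 128) * L2_norm ?ind \<le> 155 * n * (c2 * \<tau>)"
    proof -
      have "exp (- t / 128) = \<tau> * (t powr \<alpha> * exp (- t / 128))" using t by (simp add: \<tau>_def powr_minus)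
      also have "\<dots> \<le> \<tau> * (128 * \<alpha>) powr \<alpha>" using t \<alpha> \<tau> by (intro mult_left_mono powr_exp_le) auto
      finally have "(155 * n * L2_norm ?ind) * exp (- t / 128) \<le> (155 * n * L2_norm ?ind) * (\<tau> * (128 * \<alpha>) powr \<alpha>)"
        using n L2_norm_nonneg by (intro mult_left_mono mult_nonneg_nonneg) auto
      then show ?thesis by (simp add: c2_def mult_ac)
    qed
    have S: "0 \<le> Sobolev_norm (l + 1) u0" "0 \<le> Sobolev_norm l u1" by (simp_all add: Sobolev_norm_eq L2_norm_nonneg)
    have chain: "x \<le> 2 * (b1 + y) \<Longrightarrow> y \<le> 2 * (b2 + z) \<Longrightarrow> z \<le> w \<Longrightarrow> x \<le> 2 * (b1 + 2 * (b2 + w))" for x y z w b1 b2 :: real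
      by simp
    have collect: "x \<le> 8 * (d1 + d2 + d3 + d4)"
      if "x \<le> 2 * (b1 + 2 * (b2 + 2 * (b3 + b4)))" "b1 \<le> d1" "b2 \<le> d2" "b3 \<le> d3" "b4 \<le> d4" "0 \<le> b1" "0 \<le> b2"
      for x b1 b2 b3 b4 d1 d2 d3 d4 :: real
      using that by simp
    have "L2_norm ?diff \<le> L2_norm B"
      using L2_scaled_bound(2)[OF BL2 dm le] by simp
    also have "L2_norm B \<le> 2 * (L2_norm B1 + 2 * (L2_norm B2 + 2 * (L2_norm B3 + L2_norm B4)))"
      unfolding B_def[abs_def]
      by (rule chain[OF L2_norm_add_le[OF B1(1) L2_add[OF B2(1) L2_add[OF B3(1) B4(1)]]]
        L2_norm_add_le[OF B2(1) L2_add[OF B3(1) B4(1)]] L2_norm_add_le[OF B3(1) B4(1)]])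
    finally have "L2_norm ?diff \<le> 8 * (155 * n * (c1 * \<tau>) + 155 * n * (c2 * \<tau>) + 16 * K * \<tau> * Sobolev_norm (l + 1) u0 + 16 * K * \<tau> * Sobolev_norm l u1)"
      by (rule collect[OF _ order_trans[OF B1(2) Gb] order_trans[OF B2(2) Ib] B3(2) B4(2) L2_norm_nonneg L2_norm_nonneg])
    also have "\<dots> = 8 * ((155 * c1 + 155 * c2) * n + 16 * K * (Sobolev_norm (l + 1) u0 + Sobolev_norm l u1)) * \<tau>"
      by (simp add: algebra_simps)
    also have "\<dots> \<le> C * I0 l u0 u1 * \<tau>"
    proof (intro mult_right_mono \<tau>)
      define A where "A = 155 * c1 + 155 * c2"
      define s where "s = Sobolev_norm (l + 1) u0 + Sobolev_norm l u1"
      have A: "0 \<le> A" "0 \<le> s" using c S by (auto simp: A_def s_def)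
      have I: "I0 l u0 u1 = s + n" by (simp add: I0_def s_def n_def)
      have "8 * (A * n + 16 * K * s) \<le> (8 * (A + 16 * K) + 1) * (s + n)"
      proof -
        have "0 \<le> A * s" "0 \<le> K * n" using A n c by auto
        then show ?thesis using A n by (simp add: algebra_simps)
      qed
      then show "8 * ((155 * c1 + 155 * c2) * n + 16 * K * (Sobolev_norm (l + 1) u0 + Sobolev_norm l u1)) \<le> C * I0 l u0 u1"
        unfolding I C_def A_def[symmetric] s_def[symmetric] by (simp add: A_def)
    qed
    finally have "L2_norm ?diff \<le> C * I0 l u0 u1 * t powr (- (real DIM('a) + 2) / 4)"
      unfolding \<tau>_def \<alpha>_def minus_divide_left .
    with L2_scaled_bound(1)[OF BL2 dm le zero_le_one]
    have "?diff \<in> L2 \<and> L2_norm ?diff \<le> C * I0 l u0 u1 * t powr (- (real DIM('a) + 2) / 4)"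
      by (rule conjI)
  }
  ultimately show ?thesis by blast
qed

theorem theorem3p3:
  fixes n :: nat and l :: real
  assumes "n = CARD('n::finite)" and "n \<ge> 6" and "l = real n / 2 - 1"
  shows "\<exists>C>0. \<forall>(u0 :: real ^ 'n \<Rightarrow> complex) u1 u.
    u0 \<in> Sobolev (l + 1) \<inter> L11 \<longrightarrow> u1 \<in> Sobolev l \<inter> L11 \<longrightarrow>
    u \<in> X2 \<longrightarrow> solves_Cauchy_problem u0 u1 u \<longrightarrow>
    (\<forall>t\<ge>1. (\<lambda>\<xi>. fourier_L2 (u t) \<xi> - profile u0 u1 t \<xi>) \<in> L2 \<and>
       L2_norm (\<lambda>\<xi>. fourier_L2 (u t) \<xi> - profile u0 u1 t \<xi>)
         \<le> C * I0 l u0 u1 * t powr (- (real n + 2) / 4))"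
proof -
  have "DIM(real ^ 'n) = n" using assms(1) by simp
  then show ?thesis
    using asymptotic_profile[where 'a = "real ^ 'n"] assms by auto
qed

end
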